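(* Let $G\supset G'$ be a real reductive linear Lie group and an algebraic reductive subgroup, and let $(\lambda,\nu)\in\mathfrak j_{\mathbb C}^\vee/W(\mathfrak j_{\mathbb C})\times(\mathfrak j'_{\mathbb C})^\vee/W(\mathfrak j'_{\mathbb C})$ be a pair of $(\mathfrak Z_G,\mathfrak Z_{G'})$-infinitesimal characters. The multiplication map $$\varphi:G\times G'\to G,\qquad (g,h)\mapsto gh^{-1}$$ induces the following linear isomorphism $$\varphi^*:\operatorname{Sh}(\lambda,\nu)\overset\sim\to\operatorname{Hom}_{K\times K'}\big(\mathbf 1\boxtimes\mathbf 1,\;C^\infty((G\times G')/\operatorname{diag}G';\chi^L_{\lambda,\nu})\big),$$ where $\mathbf 1$ denotes the trivial one-dimensional representation of the group $K$ (or that of $K'$).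
   Context: $K$ is a maximal compact subgroup of $G$ such that $K':=K\cap G'$ is a maximal compact subgroup of $G'$; $\mathfrak g\supset\mathfrak g'$ are the Lie algebras of $G\supset G'$. For $X\in\mathfrak g$ and $f\in C^\infty(G)$: $(L_Xf)(g)=\frac{d}{dt}|_{t=0}f(\exp(-tX)g)$, $(R_Xf)(g)=\frac{d}{dt}|_{t=0}f(g\exp(tX))$, and these actions are extended to the universal enveloping algebra $U(\mathfrak g_{\mathbb C})$; the same notation is used for other Lie groups. $\mathfrak Z_G:=U(\mathfrak g_{\mathbb C})^G$ is the algebra of $\operatorname{Ad}(G)$-invariant elements of $U(\mathfrak g_{\mathbb C})$. With $\mathfrak j$ a Cartan subalgebra of $\mathfrak g$ and $W(\mathfrak j_{\mathbb C}):=N_{\widetilde G}(\mathfrak j_{\mathbb C})/Z_{\widetilde G}(\mathfrak j_{\mathbb C})$ ($\widetilde G$ the group generated by $\operatorname{Ad}(G)$ and $\operatorname{Int}(\mathfrak g_{\mathbb C})$), the Harish-Chandra isomorphism identifies algebra homomorphisms $\chi_\lambda:\mathfrak Z_G\to\mathbb C$ with $\lambda\in\mathfrak j_{\mathbb C}^\vee/W(\mathfrak j_{\mathbb C})$; similarly for $G'$, with Cartan subalgebra $\mathfrak j'$ of $\mathfrak g'$ and $\nu\in(\mathfrak j'_{\mathbb C})^\vee/W(\mathfrak j'_{\mathbb C})$. $\chi_{\lambda,\nu}$ is the corresponding character of $\mathfrak Z_{G\times G'}\simeq\mathfrak Z_G\otimes\mathfrak Z_{G'}$. $\operatorname{Sh}(\lambda,\nu)$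 is the space of Shintani functions, i.e. of $f\in C^\infty(G)$ with $f(k'gk)=f(g)$ ($k'\in K'$, $k\in K$), $R_uf=\chi_\lambda(u)f$ ($u\in\mathfrak Z_G$), and $L_vf=\chi_\nu(v)f$ ($v\in\mathfrak Z_{G'}$). $C^\infty((G\times G')/\operatorname{diag}G';\chi^L_{\lambda,\nu})$ is the space of smooth functions $F$ on $(G\times G')/\operatorname{diag}G'$, where $\operatorname{diag}G'=\{(x,x):x\in G'\}$, with $L_uF=\chi_{\lambda,\nu}(u)F$ for all $u\in\mathfrak Z_{G\times G'}$; $G\times G'$ acts on it by left translation. $\operatorname{Hom}_{K\times K'}(\mathbf 1\boxtimes\mathbf 1,V)$ is identified with the space of $(K\times K')$-fixed vectors of $V$. The map $\varphi^*$ is the pull-back of functions, $\varphi^*f=f\circ\varphi$.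
   Formalization: The map φ is taken to be (g,h) ↦ hg⁻¹ instead of gh⁻¹: with the stated conventions gh⁻¹ fails (G=GL(1,R), G'=1, f(x)=|x|^s has R-eigenvalue s, but its pull-back has L-eigenvalue −s). *)

theory Defs
  imports
    "HOL-Analysis.Analysis"
    "HOL-Algebra.QuotRing"
    "HOL-Library.Function_Algebras"
begin

section \<open>Linear groups and their Lie algebras\<close>

definition GL :: "('a::field^'n^'n) monoid" where
  "GL = \<lparr>carrier = {A. invertible A}, mult = (**), one = mat 1\<rparr>"

primrec mpow :: "'a::semiring_1^'n^'n \<Rightarrow> nat \<Rightarrow> 'a^'n^'n" where
  "mpow A 0 = mat 1"
| "mpow A (Suc k) = A ** mpow A k"

definition mexp :: "real^'n^'n \<Rightarrow> real^'n^'n" where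
  "mexp A = (\<Sum>k. mpow A k /\<^sub>R fact k)"

definition unipotent :: "real^'n^'n \<Rightarrow> bool" where
  "unipotent A \<longleftrightarrow> (\<exists>k. mpow (A - mat 1) k = 0)"

definition real_algebraic_group :: "(real^'n^'n) set \<Rightarrow> bool" where
  "real_algebraic_group H \<longleftrightarrow> subgroup H GL \<and>
     (\<exists>P. (\<forall>p\<in>P. real_polynomial_function p) \<and> H = {A. invertible A \<and> (\<forall>p\<in>P. p A = 0)})"

text \<open>
  Trivial unipotent radical.  The Zariski closure of a normal unipotent subgroup is again normal
  and unipotent, and unipotent algebraic groups in characteristic 0 are connected, so the
  normal subgroups below need not be required to be closed or connected.  The unipotent radical of
  the complexification is defined over the reals and its real points are Zariski dense in it, so it
  is enough to look at real points.
\<close>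
definition reductive_algebraic_group :: "(real^'n^'n) set \<Rightarrow> bool" where
  "reductive_algebraic_group H \<longleftrightarrow> real_algebraic_group H \<and>
     (\<forall>N. N \<lhd> (GL\<lparr>carrier := H\<rparr>) \<and> (\<forall>A\<in>N. unipotent A) \<longrightarrow> N = {mat 1})"

text \<open>
  A real reductive linear Lie group is an open subgroup of the group of real points of a reductive
  algebraic group; for the subgroup, being algebraic means being cut out in \<open>G\<close> by polynomial
  equations.
\<close>
definition real_reductive_linear_group :: "(real^'n^'n) set \<Rightarrow> bool" where
  "real_reductive_linear_group G \<longleftrightarrow> subgroup G GL \<and>
     (\<exists>H. reductive_algebraic_group H \<and> openin (top_of_set H) G)"

definition algebraic_reductive_subgroup :: "(real^'n^'n) set \<Rightarrow> (real^'n^'n) set \<Rightarrow> bool" where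
  "algebraic_reductive_subgroup G' G \<longleftrightarrow> subgroup G' GL \<and>
     (\<exists>H'. reductive_algebraic_group H' \<and> openin (top_of_set H') G' \<and> G' = G \<inter> H')"

definition maximal_compact_subgroup :: "(real^'n^'n) set \<Rightarrow> (real^'n^'n) set \<Rightarrow> bool" where
  "maximal_compact_subgroup K G \<longleftrightarrow> subgroup K GL \<and> compact K \<and> K \<subseteq> G \<and>
     (\<forall>C. subgroup C GL \<and> compact C \<and> C \<subseteq> G \<and> K \<subseteq> C \<longrightarrow> C = K)"

definition lie_algebra :: "(real^'n^'n) set \<Rightarrow> (real^'n^'n) set" where
  "lie_algebra G = {X. \<forall>t. mexp (t *\<^sub>R X) \<in> G}"

definition bracket :: "'a::ring_1^'n^'n \<Rightarrow> 'a^'n^'n \<Rightarrow> 'a^'n^'n" where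
  "bracket X Y = X ** Y - Y ** X"

text \<open>The complexification \<open>V + \<i>V\<close> of a real subspace \<open>V\<close> of the real matrices.\<close>
definition complexification :: "(real^'n^'n) set \<Rightarrow> (complex^'n^'n) set" where
  "complexification V = {Z. map_matrix Re Z \<in> V \<and> map_matrix Im Z \<in> V}"

definition msmult :: "complex \<Rightarrow> complex^'n^'n \<Rightarrow> complex^'n^'n" where
  "msmult c = map_matrix ((*) c)"

definition Ad :: "real^'n^'n \<Rightarrow> complex^'n^'n \<Rightarrow> complex^'n^'n" where
  "Ad g X = map_matrix complex_of_real g ** X ** map_matrix complex_of_real (matrix_inv g)"


section \<open>Smooth functions on linear groups\<close>

primrec Ck_on :: "nat \<Rightarrow> 'a::euclidean_space set \<Rightarrow> ('a \<Rightarrow> 'b::real_normed_vector) \<Rightarrow> bool" where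
  "Ck_on 0 U f \<longleftrightarrow> continuous_on U f"
| "Ck_on (Suc k) U f \<longleftrightarrow> (\<forall>x\<in>U. f differentiable (at x)) \<and>
     (\<forall>v. Ck_on k U (\<lambda>x. frechet_derivative f (at x) v))"

text \<open>
  Functions on a subset \<open>G\<close> of a type are represented by functions on the whole type that vanish off
  \<open>G\<close>.  The groups considered here are embedded submanifolds of the space of matrices, so
  smoothness is the local existence of smooth extensions.
\<close>
definition smooth_functions :: "(real^'n^'n) set \<Rightarrow> (real^'n^'n \<Rightarrow> complex) set" where
  "smooth_functions G = {f. (\<forall>x. x \<notin> G \<longrightarrow> f x = 0) \<and>
     (\<forall>g\<in>G. \<exists>U F. open U \<and> g \<in> U \<and> (\<forall>k. Ck_on k U F) \<and> (\<forall>x\<in>U \<inter> G. f x = F x))}"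


section \<open>The universal enveloping algebra\<close>

text \<open>The free associative complex algebra on a set, as the monoid algebra of the words.\<close>
definition free_alg :: "'a set \<Rightarrow> ('a list \<Rightarrow> complex) ring" where
  "free_alg S =
     \<lparr>carrier = {u. finite {w. u w \<noteq> 0} \<and> (\<forall>w. u w \<noteq> 0 \<longrightarrow> set w \<subseteq> S)},
      mult = (\<lambda>u v w. \<Sum>k\<le>length w. u (take k w) * v (drop k w)),
      one = (\<lambda>w. if w = [] then 1 else 0),
      zero = (\<lambda>w. 0),
      add = (\<lambda>u v w. u w + v w)\<rparr>"

definition word_ind :: "'a list \<Rightarrow> 'a list \<Rightarrow> complex" where
  "word_ind v w = (if w = v then 1 else 0)"

text \<open>
  The generators of the free algebra are all elements of the Lie algebra; dividing by the first
  family of relations gives the tensor algebra.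
\<close>
definition uea_relations :: "(complex^'n^'n) set \<Rightarrow> ((complex^'n^'n) list \<Rightarrow> complex) set" where
  "uea_relations L =
     {\<lambda>w. word_ind [msmult a X + msmult b Y] w - a * word_ind [X] w - b * word_ind [Y] w
        | a b X Y. X \<in> L \<and> Y \<in> L} \<union>
     {\<lambda>w. word_ind [X, Y] w - word_ind [Y, X] w - word_ind [bracket X Y] w | X Y. X \<in> L \<and> Y \<in> L}"

definition uea_ideal :: "(complex^'n^'n) set \<Rightarrow> ((complex^'n^'n) list \<Rightarrow> complex) set" where
  "uea_ideal L = Idl\<^bsub>free_alg L\<^esub> (uea_relations L)"

definition uea :: "(complex^'n^'n) set \<Rightarrow> ((complex^'n^'n) list \<Rightarrow> complex) set ring" where
  "uea L = free_alg L Quot uea_ideal L"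

definition uea_class ::
  "(complex^'n^'n) set \<Rightarrow> ((complex^'n^'n) list \<Rightarrow> complex) \<Rightarrow> ((complex^'n^'n) list \<Rightarrow> complex) set"
  where "uea_class L u = uea_ideal L +>\<^bsub>free_alg L\<^esub> u"

definition rep :: "'a set \<Rightarrow> 'a" where
  "rep c = (SOME u. u \<in> c)"

definition push_words :: "('a \<Rightarrow> 'b) \<Rightarrow> ('a list \<Rightarrow> complex) \<Rightarrow> 'b list \<Rightarrow> complex" where
  "push_words h u w = (\<Sum>v | u v \<noteq> 0 \<and> map h v = w. u v)"

text \<open>
  The map \<open>U(L) \<rightarrow> U(M)\<close> induced by a homomorphism \<open>h\<close> of Lie algebras; it does not depend on the
  representative.
\<close>
definition uea_map ::
  "(complex^'m^'m) set \<Rightarrow> (complex^'n^'n \<Rightarrow> complex^'m^'m)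
     \<Rightarrow> ((complex^'n^'n) list \<Rightarrow> complex) set \<Rightarrow> ((complex^'m^'m) list \<Rightarrow> complex) set" where
  "uea_map M h c = uea_class M (push_words h (rep c))"

abbreviation lie_algebra_C :: "(real^'n^'n) set \<Rightarrow> (complex^'n^'n) set" where
  "lie_algebra_C G \<equiv> complexification (lie_algebra G)"

abbreviation U_alg :: "(real^'n^'n) set \<Rightarrow> ((complex^'n^'n) list \<Rightarrow> complex) set ring" where
  "U_alg G \<equiv> uea (lie_algebra_C G)"

definition Z_alg :: "(real^'n^'n) set \<Rightarrow> ((complex^'n^'n) list \<Rightarrow> complex) set ring" where
  "Z_alg G = (U_alg G)\<lparr>carrier :=
     {u \<in> carrier (U_alg G). \<forall>g\<in>G. uea_map (lie_algebra_C G) (Ad g) u = u}\<rparr>"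

definition complex_ring :: "complex ring" where
  "complex_ring = \<lparr>carrier = UNIV, mult = (*), one = 1, zero = 0, add = (+)\<rparr>"

text \<open>
  Homomorphisms of complex algebras; complex linearity amounts to fixing the scalar multiples of
  the unit.
\<close>
definition Z_character ::
  "(real^'n^'n) set \<Rightarrow> (((complex^'n^'n) list \<Rightarrow> complex) set \<Rightarrow> complex) \<Rightarrow> bool" where
  "Z_character G \<eta> \<longleftrightarrow> \<eta> \<in> ring_hom (Z_alg G) complex_ring \<and>
     (\<forall>c. \<eta> (uea_class (lie_algebra_C G) (\<lambda>w. c * word_ind [] w)) = c)"


section \<open>The actions by differential operators\<close>

definition R_real :: "real^'n^'n \<Rightarrow> (real^'n^'n \<Rightarrow> complex) \<Rightarrow> real^'n^'n \<Rightarrow> complex" where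
  "R_real X f g = vector_derivative (\<lambda>t. f (g ** mexp (t *\<^sub>R X))) (at 0)"

definition L_real :: "real^'n^'n \<Rightarrow> (real^'n^'n \<Rightarrow> complex) \<Rightarrow> real^'n^'n \<Rightarrow> complex" where
  "L_real X f g = vector_derivative (\<lambda>t. f (mexp ((- t) *\<^sub>R X) ** g)) (at 0)"

definition R_lie :: "complex^'n^'n \<Rightarrow> (real^'n^'n \<Rightarrow> complex) \<Rightarrow> real^'n^'n \<Rightarrow> complex" where
  "R_lie Z f g = R_real (map_matrix Re Z) f g + \<i> * R_real (map_matrix Im Z) f g"

definition L_lie :: "complex^'n^'n \<Rightarrow> (real^'n^'n \<Rightarrow> complex) \<Rightarrow> real^'n^'n \<Rightarrow> complex" where
  "L_lie Z f g = L_real (map_matrix Re Z) f g + \<i> * L_real (map_matrix Im Z) f g"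

text \<open>
  On smooth functions the actions below vanish on the defining ideal, so that they do not depend on
  the chosen representatives.
\<close>
definition word_action ::
  "('x \<Rightarrow> ('g \<Rightarrow> complex) \<Rightarrow> 'g \<Rightarrow> complex) \<Rightarrow> ('x list \<Rightarrow> complex) \<Rightarrow> ('g \<Rightarrow> complex) \<Rightarrow> 'g \<Rightarrow> complex"
  where "word_action D u f g = (\<Sum>w | u w \<noteq> 0. u w * foldr D w f g)"

definition R_act ::
  "((complex^'n^'n) list \<Rightarrow> complex) set \<Rightarrow> (real^'n^'n \<Rightarrow> complex) \<Rightarrow> real^'n^'n \<Rightarrow> complex" where
  "R_act u = word_action R_lie (rep u)"

definition L_act ::
  "((complex^'n^'n) list \<Rightarrow> complex) set \<Rightarrow> (real^'n^'n \<Rightarrow> complex) \<Rightarrow> real^'n^'n \<Rightarrow> complex" where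
  "L_act u = word_action L_lie (rep u)"


section \<open>Infinitesimal characters\<close>

primrec lower_central_series :: "(real^'n^'n) set \<Rightarrow> nat \<Rightarrow> (real^'n^'n) set" where
  "lower_central_series V 0 = V"
| "lower_central_series V (Suc k) = span {bracket X Y | X Y. X \<in> V \<and> Y \<in> lower_central_series V k}"

definition cartan_subalgebra :: "(real^'n^'n) set \<Rightarrow> (real^'n^'n) set \<Rightarrow> bool" where
  "cartan_subalgebra \<jj> \<gg> \<longleftrightarrow> subspace \<jj> \<and> \<jj> \<subseteq> \<gg> \<and> (\<forall>X\<in>\<jj>. \<forall>Y\<in>\<jj>. bracket X Y \<in> \<jj>) \<and>
     (\<exists>k. lower_central_series \<jj> k = {0}) \<and>
     {X \<in> \<gg>. \<forall>Y\<in>\<jj>. bracket X Y \<in> \<jj>} = \<jj>"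

definition dual_space :: "(complex^'n^'n) set \<Rightarrow> (complex^'n^'n \<Rightarrow> complex) set" where
  "dual_space V = {\<mu>. (\<forall>X. X \<notin> V \<longrightarrow> \<mu> X = 0) \<and>
     (\<forall>X\<in>V. \<forall>Y\<in>V. \<forall>a b. \<mu> (msmult a X + msmult b Y) = a * \<mu> X + b * \<mu> Y)}"

definition exp_ad :: "complex^'n^'n \<Rightarrow> complex^'n^'n \<Rightarrow> complex^'n^'n" where
  "exp_ad X Y = (\<Sum>k. ((bracket X ^^ k) Y) /\<^sub>R fact k)"

text \<open>The group generated by \<open>Ad(G)\<close> and the inner automorphisms of the complexified Lie algebra.\<close>
inductive_set G_tilde :: "(real^'n^'n) set \<Rightarrow> (complex^'n^'n \<Rightarrow> complex^'n^'n) set"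
  for G :: "(real^'n^'n) set" where
  "id \<in> G_tilde G"
| "\<gamma> \<in> G_tilde G \<Longrightarrow> g \<in> G \<Longrightarrow> Ad g \<circ> \<gamma> \<in> G_tilde G"
| "\<gamma> \<in> G_tilde G \<Longrightarrow> X \<in> lie_algebra_C G \<Longrightarrow> exp_ad X \<circ> \<gamma> \<in> G_tilde G"

definition W_orbit ::
  "(real^'n^'n) set \<Rightarrow> (real^'n^'n) set \<Rightarrow> (complex^'n^'n \<Rightarrow> complex) \<Rightarrow> (complex^'n^'n \<Rightarrow> complex) set"
  where "W_orbit G \<jj> \<mu> =
    {(\<lambda>X. if X \<in> complexification \<jj> then \<mu> (\<gamma> X) else 0) | \<gamma>.
       \<gamma> \<in> G_tilde G \<and> \<gamma> ` complexification \<jj> = complexification \<jj>}"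

definition hc_parameters ::
  "(real^'n^'n) set \<Rightarrow> (real^'n^'n) set \<Rightarrow> (complex^'n^'n \<Rightarrow> complex) set set" where
  "hc_parameters G \<jj> = W_orbit G \<jj> ` dual_space (complexification \<jj>)"

definition root_space ::
  "(real^'n^'n) set \<Rightarrow> (real^'n^'n) set \<Rightarrow> (complex^'n^'n \<Rightarrow> complex) \<Rightarrow> (complex^'n^'n) set" where
  "root_space G \<jj> \<alpha> =
     {X \<in> lie_algebra_C G. \<forall>H\<in>complexification \<jj>. bracket H X = msmult (\<alpha> H) X}"

definition roots ::
  "(real^'n^'n) set \<Rightarrow> (real^'n^'n) set \<Rightarrow> (complex^'n^'n \<Rightarrow> complex) set" where
  "roots G \<jj> = {\<alpha> \<in> dual_space (complexification \<jj>). \<alpha> \<noteq> 0 \<and> root_space G \<jj> \<alpha> \<noteq> {0}}"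

definition positive_system ::
  "(real^'n^'n) set \<Rightarrow> (real^'n^'n) set \<Rightarrow> (complex^'n^'n \<Rightarrow> complex) set \<Rightarrow> bool" where
  "positive_system G \<jj> P \<longleftrightarrow> P \<subseteq> roots G \<jj> \<and>
     (\<forall>\<alpha>\<in>roots G \<jj>. \<alpha> \<in> P \<longleftrightarrow> - \<alpha> \<notin> P) \<and>
     (\<forall>\<alpha>\<in>P. \<forall>\<beta>\<in>P. \<alpha> + \<beta> \<in> roots G \<jj> \<longrightarrow> \<alpha> + \<beta> \<in> P)"

definition half_sum :: "(complex^'n^'n \<Rightarrow> complex) set \<Rightarrow> complex^'n^'n \<Rightarrow> complex" where
  "half_sum P H = (\<Sum>\<alpha>\<in>P. \<alpha> H) / 2"

inductive_set left_ideal :: "('a, 'b) ring_scheme \<Rightarrow> 'a set \<Rightarrow> 'a set"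
  for R :: "('a, 'b) ring_scheme" and S :: "'a set" where
  "\<zero>\<^bsub>R\<^esub> \<in> left_ideal R S"
| "x \<in> left_ideal R S \<Longrightarrow> u \<in> carrier R \<Longrightarrow> s \<in> S \<Longrightarrow> x \<oplus>\<^bsub>R\<^esub> u \<otimes>\<^bsub>R\<^esub> s \<in> left_ideal R S"

text \<open>The value at \<open>\<mu>\<close> of an element of the enveloping (that is, symmetric) algebra of a Cartan subalgebra.\<close>
definition eval_at :: "('x \<Rightarrow> complex) \<Rightarrow> ('x list \<Rightarrow> complex) \<Rightarrow> complex" where
  "eval_at \<mu> q = (\<Sum>w | q w \<noteq> 0. q w * prod_list (map \<mu> w))"

text \<open>
  \<open>\<eta>\<close> is the character that the Harish-Chandra isomorphism attaches to the orbit \<open>\<Lambda>\<close>: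
  if \<open>u \<in> q + U(\<gg>) \<nn>\<^sup>+\<close> with \<open>q\<close> in the enveloping algebra of the Cartan subalgebra, then
  \<open>\<eta>(u) = q(\<mu> - \<rho>)\<close> for \<open>\<mu> \<in> \<Lambda>\<close>.  By the theorem of Harish-Chandra there is exactly one such
  \<open>\<eta>\<close> (up to its values off the algebra of invariants), it does not depend on the positive system,
  and every algebra homomorphism to the complex numbers arises from exactly one \<open>\<Lambda>\<close>.
\<close>
definition infinitesimal_character ::
  "(real^'n^'n) set \<Rightarrow> (real^'n^'n) set \<Rightarrow> (complex^'n^'n \<Rightarrow> complex) set
     \<Rightarrow> (((complex^'n^'n) list \<Rightarrow> complex) set \<Rightarrow> complex) \<Rightarrow> bool" where
  "infinitesimal_character G \<jj> \<Lambda> \<eta> \<longleftrightarrow> Z_character G \<eta> \<and>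
     (\<exists>P. positive_system G \<jj> P \<and>
       (\<forall>\<mu>\<in>\<Lambda>. \<forall>u\<in>carrier (Z_alg G). \<exists>q\<in>carrier (free_alg (complexification \<jj>)).
          u \<ominus>\<^bsub>U_alg G\<^esub> uea_class (lie_algebra_C G) q
            \<in> left_ideal (U_alg G)
                {uea_class (lie_algebra_C G) (word_ind [X]) | X \<alpha>. \<alpha> \<in> P \<and> X \<in> root_space G \<jj> \<alpha>} \<and>
          \<eta> u = eval_at (\<mu> - half_sum P) q))"


section \<open>The product group and its homogeneous space\<close>

definition blk :: "'a::zero^'n^'n \<Rightarrow> 'a^'m^'m \<Rightarrow> 'a^('n + 'm)^('n + 'm)" where
  "blk A B = (\<chi> i j. case (i, j) of
      (Inl a, Inl b) \<Rightarrow> A $ a $ b | (Inr a, Inr b) \<Rightarrow> B $ a $ b | _ \<Rightarrow> 0)"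

definition prod_group ::
  "(real^'n^'n) set \<Rightarrow> (real^'m^'m) set \<Rightarrow> (real^('n + 'm)^('n + 'm)) set" where
  "prod_group G H = {blk g h | g h. g \<in> G \<and> h \<in> H}"

definition diag_group :: "(real^'n^'n) set \<Rightarrow> (real^('n + 'n)^('n + 'n)) set" where
  "diag_group H = {blk x x | x. x \<in> H}"

text \<open>The character of \<open>Z(G \<times> H) \<simeq> Z(G) \<otimes> Z(H)\<close> determined by characters of the two factors.\<close>
definition prod_character ::
  "(real^'n^'n) set \<Rightarrow> (real^'m^'m) set
    \<Rightarrow> (((complex^'n^'n) list \<Rightarrow> complex) set \<Rightarrow> complex)
    \<Rightarrow> (((complex^'m^'m) list \<Rightarrow> complex) set \<Rightarrow> complex)
    \<Rightarrow> ((complex^('n + 'm)^('n + 'm)) list \<Rightarrow> complex) set \<Rightarrow> complex" where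
  "prod_character G H \<eta> \<eta>' = (SOME \<psi>. Z_character (prod_group G H) \<psi> \<and>
     (\<forall>u\<in>carrier (Z_alg G). \<forall>v\<in>carrier (Z_alg H).
        \<psi> (uea_map (lie_algebra_C (prod_group G H)) (\<lambda>X. blk X 0) u
             \<otimes>\<^bsub>U_alg (prod_group G H)\<^esub>
           uea_map (lie_algebra_C (prod_group G H)) (\<lambda>Y. blk 0 Y) v) = \<eta> u * \<eta>' v))"

definition coset_space :: "(real^'n^'n) set \<Rightarrow> (real^'n^'n) set \<Rightarrow> (real^'n^'n) set set" where
  "coset_space X D = {x <#\<^bsub>GL\<^esub> D | x. x \<in> X}"

definition lift_fun ::
  "(real^'n^'n) set \<Rightarrow> (real^'n^'n) set \<Rightarrow> ((real^'n^'n) set \<Rightarrow> complex) \<Rightarrow> real^'n^'n \<Rightarrow> complex" where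
  "lift_fun X D F x = (if x \<in> X then F (x <#\<^bsub>GL\<^esub> D) else 0)"

text \<open>
  Smooth functions on \<open>X/D\<close>; as \<open>X \<rightarrow> X/D\<close> is a surjective submersion, a function on \<open>X/D\<close> is smooth
  iff its lift to \<open>X\<close> is.
\<close>
definition smooth_functions_quot ::
  "(real^'n^'n) set \<Rightarrow> (real^'n^'n) set \<Rightarrow> ((real^'n^'n) set \<Rightarrow> complex) set" where
  "smooth_functions_quot X D = {F. (\<forall>c. c \<notin> coset_space X D \<longrightarrow> F c = 0) \<and>
     lift_fun X D F \<in> smooth_functions X}"

text \<open>
  The projection \<open>X \<rightarrow> X/D\<close> is equivariant for left translations, so the differential operator \<open>L\<^sub>u\<close> on
  \<open>X/D\<close> is computed on lifts.
\<close>
definition eigen_functions_quot ::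
  "(real^'n^'n) set \<Rightarrow> (real^'n^'n) set \<Rightarrow> (((complex^'n^'n) list \<Rightarrow> complex) set \<Rightarrow> complex)
     \<Rightarrow> ((real^'n^'n) set \<Rightarrow> complex) set" where
  "eigen_functions_quot X D \<psi> = {F \<in> smooth_functions_quot X D.
     \<forall>u\<in>carrier (Z_alg X). L_act u (lift_fun X D F) = (\<lambda>x. \<psi> u * lift_fun X D F x)}"

definition fixed_vectors ::
  "(real^'n^'n) set \<Rightarrow> ((real^'n^'n) set \<Rightarrow> complex) set
     \<Rightarrow> (real^'n^'n) set set \<Rightarrow> ((real^'n^'n) set \<Rightarrow> complex) set" where
  "fixed_vectors M V Q = {F \<in> V. \<forall>k\<in>M. \<forall>c\<in>Q. F (matrix_inv k <#\<^bsub>GL\<^esub> c) = F c}"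

definition Hom_trivial ::
  "(real^'n^'n) set \<Rightarrow> (real^'n^'n) set \<Rightarrow> (real^'n^'n) set
    \<Rightarrow> (((complex^'n^'n) list \<Rightarrow> complex) set \<Rightarrow> complex)
    \<Rightarrow> (((complex^'n^'n) list \<Rightarrow> complex) set \<Rightarrow> complex)
    \<Rightarrow> ((real^('n + 'n)^('n + 'n)) set \<Rightarrow> complex) set" where
  "Hom_trivial G G' K \<eta> \<eta>' =
     fixed_vectors (prod_group K (K \<inter> G'))
       (eigen_functions_quot (prod_group G G') (diag_group G') (prod_character G G' \<eta> \<eta>'))
       (coset_space (prod_group G G') (diag_group G'))"


section \<open>Shintani functions\<close>

definition Sh ::
  "(real^'n^'n) set \<Rightarrow> (real^'n^'n) set \<Rightarrow> (real^'n^'n) set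
    \<Rightarrow> (((complex^'n^'n) list \<Rightarrow> complex) set \<Rightarrow> complex)
    \<Rightarrow> (((complex^'n^'n) list \<Rightarrow> complex) set \<Rightarrow> complex)
    \<Rightarrow> (real^'n^'n \<Rightarrow> complex) set" where
  "Sh G G' K \<eta> \<eta>' = {f \<in> smooth_functions G.
     (\<forall>k'\<in>K \<inter> G'. \<forall>k\<in>K. \<forall>g\<in>G. f (k' ** g ** k) = f g) \<and>
     (\<forall>u\<in>carrier (Z_alg G). R_act u f = (\<lambda>g. \<eta> u * f g)) \<and>
     (\<forall>v\<in>carrier (Z_alg G'). L_act v f = (\<lambda>g. \<eta>' v * f g))}"

text \<open>
  The order of the factors is forced by the conventions for Shintani functions
  (left invariance under \<open>K \<inter> G'\<close>, right invariance under \<open>K\<close>, and \<open>R\<close> for \<open>G\<close>, \<open>L\<close> for \<open>G'\<close>):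
  left translation by \<open>(k, k')\<close> turns \<open>h g\<^sup>-\<^sup>1\<close> into \<open>k' h g\<^sup>-\<^sup>1 k\<^sup>-\<^sup>1\<close>.  Pulling back along the inverse
  \<open>g h\<^sup>-\<^sup>1\<close> would interchange the two sides: already for \<open>G = GL(1,\<real>)\<close>, \<open>G' = 1\<close>, \<open>f(x) = |x|\<^sup>s\<close> it
  turns the eigenvalue \<open>s\<close> of \<open>R\<close> into the eigenvalue \<open>-s\<close> of \<open>L\<close>.
\<close>
definition phi :: "(real^'n^'n) \<times> (real^'n^'n) \<Rightarrow> real^'n^'n" where
  "phi = (\<lambda>(g, h). h ** matrix_inv g)"

definition phi_pullback ::
  "(real^'n^'n) set \<Rightarrow> (real^'n^'n) set \<Rightarrow> (real^'n^'n \<Rightarrow> complex)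
     \<Rightarrow> (real^('n + 'n)^('n + 'n)) set \<Rightarrow> complex" where
  "phi_pullback G G' f c =
     (if c \<in> coset_space (prod_group G G') (diag_group G')
      then f (phi (SOME p. case p of (g, h) \<Rightarrow> blk g h \<in> c)) else 0)"

definition fscale :: "complex \<Rightarrow> ('a \<Rightarrow> complex) \<Rightarrow> 'a \<Rightarrow> complex" where
  "fscale c f = (\<lambda>x. c * f x)"

definition linear_isomorphism ::
  "(('a \<Rightarrow> complex) \<Rightarrow> 'b \<Rightarrow> complex) \<Rightarrow> ('a \<Rightarrow> complex) set \<Rightarrow> ('b \<Rightarrow> complex) set \<Rightarrow> bool" where
  "linear_isomorphism T V W \<longleftrightarrow> module.subspace fscale V \<and> module.subspace fscale W \<and>
     (\<forall>f\<in>V. \<forall>g\<in>V. T (f + g) = T f + T g) \<and> (\<forall>c. \<forall>f\<in>V. T (fscale c f) = fscale c (T f)) \<and>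
     bij_betw T V W"

end

theory Submission
  imports Defs
begin

text \<open>
  With \<open>\<phi>(g, h) = h g\<^sup>-\<^sup>1\<close>, left translation on \<open>G \<times> G'\<close> turns into right translation by \<open>G\<close> and left
  translation by \<open>G'\<close> on \<open>G\<close>: for \<open>F = f \<circ> \<phi>\<close> one has \<open>L\<^bsub>(X,0)\<^esub> F = (R\<^sub>X f) \<circ> \<phi>\<close> and
  \<open>L\<^bsub>(0,Y)\<^esub> F = (L\<^sub>Y f) \<circ> \<phi>\<close>. As \<open>\<phi>\<close> identifies \<open>(G \<times> G')/diag G'\<close> with \<open>G\<close>, everything reduces to
  \<open>Z(G \<times> G') = Z(G) \<otimes> Z(G')\<close>: write an invariant \<open>z\<close> as a sum of products \<open>a\<^sub>i b\<^sub>i\<close> with as few terms as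
  possible; then both families are linearly independent, and contracting \<open>z\<close> with dual functionals
  shows that every \<open>a\<^sub>i\<close> and every \<open>b\<^sub>i\<close> is invariant. The same functionals produce the character of
  \<open>Z(G \<times> G')\<close> from those of the factors. That the actions descend to the enveloping algebras rests on the
  symmetry of second derivatives, and that the Lie algebra of a closed linear group is a Lie algebra
  on \<open>\<gamma>(t/n)\<^sup>n \<rightarrow> exp(t \<gamma>'(0))\<close>.
\<close>

section \<open>Matrices as a Banach algebra\<close>

text \<open>Elements of Z(G) are cosets of functions on words, and both the actions and the induced
  maps go through the arbitrary representative \<open>rep\<close>. Everything is therefore computed
  in the free algebra modulo \<open>uea_ideal\<close>, without a Poincare-Birkhoff-Witt basis:
  linear independence means independence modulo the ideal, and membership in the ideal is tested by
  functionals that vanish on it. The obstacle is to see that \<alpha> \<otimes> \<beta> is well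
  defined on the enveloping algebra of the product, whose words mix both kinds of letters; the
  operators \<open>tensor_op\<close> produce it from a representation, so it kills the ideal for the
  same reason as differential operators do. A functional extending a character is only known to be
  multiplicative on invariants, which is why multiplicativity of the product character already
  requires invariant factors. Since \<open>prod_character\<close> is a choice, its defining property
  is available only once such a character has been constructed. Functions on a group are extended by
  0 to all matrices and operators act at every matrix, hence the recurring distinction between
  points on and off the group.\<close>

text \<open>
  A copy of the type of square matrices that carries the operator norm, so that the library theory of
  \<^const>\<open>exp\<close> in Banach algebras becomes available for \<^const>\<open>mexp\<close>.
\<close>

typedef ('n::finite) mop = "UNIV :: (real^'n^'n) set"
  by simp

setup_lifting type_definition_mop

lemma matrix_mult_add_left: "(A + B) ** C = A ** C + B ** C"
  for A B :: "'a::semiring_1^'n^'m" and C :: "'a^'p^'n"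
  by (simp add: matrix_matrix_mult_def vec_eq_iff distrib_right sum.distrib)

lemma onorm_matrix_mult_le:
  fixes A B :: "real^'n^'n"
  shows "onorm ((*v) (A ** B)) \<le> onorm ((*v) A) * onorm ((*v) B)"
proof -
  have "(*v) (A ** B) = (*v) A \<circ> (*v) B"
    by (auto simp: matrix_vector_mul_assoc)
  then show ?thesis
    using onorm_compose[of "(*v) A" "(*v) B"] by simp
qed

instantiation mop :: (finite) real_algebra_1
begin
lift_definition zero_mop :: "'a mop" is 0 .
lift_definition one_mop :: "'a mop" is "mat 1" .
lift_definition plus_mop :: "'a mop \<Rightarrow> 'a mop \<Rightarrow> 'a mop" is "(+)" .
lift_definition minus_mop :: "'a mop \<Rightarrow> 'a mop \<Rightarrow> 'a mop" is "(-)" .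
lift_definition uminus_mop :: "'a mop \<Rightarrow> 'a mop" is "uminus" .
lift_definition times_mop :: "'a mop \<Rightarrow> 'a mop \<Rightarrow> 'a mop" is "(**)" .
lift_definition scaleR_mop :: "real \<Rightarrow> 'a mop \<Rightarrow> 'a mop" is "scaleR" .
instance
proof
  show "(0::'a mop) \<noteq> 1"
    by transfer (auto simp: vec_eq_iff mat_def)
qed (transfer; simp add: matrix_mul_assoc matrix_scalar_ac scaleR_add_right
      scaleR_add_left matrix_add_ldistrib matrix_mult_add_left
      flip: scalar_matrix_assoc)+
end

instantiation mop :: (finite) real_normed_algebra_1
begin
lift_definition norm_mop :: "'a mop \<Rightarrow> real" is "\<lambda>A. onorm ((*v) A)" .
definition dist_mop :: "'a mop \<Rightarrow> 'a mop \<Rightarrow> real" where "dist_mop A B = norm (A - B)"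
definition sgn_mop :: "'a mop \<Rightarrow> 'a mop" where "sgn_mop A = A /\<^sub>R norm A"
definition uniformity_mop :: "('a mop \<times> 'a mop) filter" where
  "uniformity_mop = (INF e\<in>{0<..}. principal {(x, y). dist x y < e})"
definition open_mop :: "'a mop set \<Rightarrow> bool" where
  "open_mop U = (\<forall>x\<in>U. eventually (\<lambda>(x', y). x' = x \<longrightarrow> y \<in> U) uniformity)"
instance
proof
  fix A B :: "'a mop" and c :: real
  show "norm A = 0 \<longleftrightarrow> A = 0"
    by transfer (auto simp: onorm_eq_0 matrix_eq)
  show "norm (A + B) \<le> norm A + norm B"
  proof transfer
    fix A B :: "real^'a^'a"
    have "(*v) (A + B) = (\<lambda>x. A *v x + B *v x)"
      by (auto simp: matrix_vector_mult_add_rdistrib)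
    then show "onorm ((*v) (A + B)) \<le> onorm ((*v) A) + onorm ((*v) B)"
      by (simp add: onorm_triangle)
  qed
  show "norm (c *\<^sub>R A) = \<bar>c\<bar> * norm A"
  proof transfer
    fix A :: "real^'a^'a" and c :: real
    have "(*v) (c *\<^sub>R A) = (\<lambda>x. c *\<^sub>R (A *v x))"
      by (auto simp: scaleR_matrix_vector_assoc)
    then show "onorm ((*v) (c *\<^sub>R A)) = \<bar>c\<bar> * onorm ((*v) A)"
      by (simp add: onorm_scaleR)
  qed
  show "norm (A * B) \<le> norm A * norm B"
    by transfer (rule onorm_matrix_mult_le)
  show "norm (1 :: 'a mop) = 1"
  proof transfer
    have "(*v) (mat 1 :: real^'a^'a) = (\<lambda>x. x)" by auto
    then show "onorm ((*v) (mat 1 :: real^'a^'a)) = 1" by (simp add: onorm_id)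
  qed
qed (simp_all add: dist_mop_def sgn_mop_def uniformity_mop_def open_mop_def)
end

text \<open>With \<open>norm_Abs_mop_le\<close> this shows that the operator norm and the Euclidean
  norm are equivalent: \<open>Rep_mop\<close> and \<open>Abs_mop\<close> are bounded linear, so
  limits, series and derivatives pass between the copy and the matrices.\<close>

lemma norm_Rep_mop_le:
  fixes A :: "'n::finite mop"
  shows "norm (Rep_mop A) \<le> real (CARD('n) * CARD('n)) * norm A"
proof -
  have "norm (Rep_mop A) \<le> (\<Sum>i\<in>UNIV. norm (Rep_mop A $ i))"
    unfolding norm_vec_def by (rule L2_set_le_sum) simp
  also have "\<dots> \<le> (\<Sum>i\<in>(UNIV::'n set). \<Sum>j\<in>(UNIV::'n set). norm A)"
  proof (rule sum_mono)
    fix i :: 'n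
    have "norm (Rep_mop A $ i) \<le> (\<Sum>j\<in>UNIV. norm (Rep_mop A $ i $ j))"
      unfolding norm_vec_def by (rule L2_set_le_sum) simp
    also have "\<dots> \<le> (\<Sum>j\<in>(UNIV::'n set). norm A)"
      unfolding norm_mop.rep_eq by (intro sum_mono) (simp add: matrix_component_le_onorm)
    finally show "norm (Rep_mop A $ i) \<le> (\<Sum>j\<in>(UNIV::'n set). norm A)" .
  qed
  finally show ?thesis by simp
qed

lemma norm_Abs_mop_le:
  fixes A :: "real^'n^'n"
  shows "norm (Abs_mop A) \<le> real (CARD('n) * CARD('n)) * norm A"
proof -
  have "norm (Abs_mop A) = onorm ((*v) A)"
    by (simp add: norm_mop.rep_eq Abs_mop_inverse)
  also have "\<dots> \<le> real (CARD('n)) * real (CARD('n)) * norm A"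
  proof (rule onorm_le_matrix_component)
    fix i j
    have "\<bar>A $ i $ j\<bar> \<le> norm (A $ i)" by (rule component_le_norm_cart)
    also have "\<dots> \<le> norm A" by (rule Finite_Cartesian_Product.norm_nth_le)
    finally show "\<bar>A $ i $ j\<bar> \<le> norm A" .
  qed
  finally show ?thesis by simp
qed

lemma bounded_linear_Rep_mop: "bounded_linear Rep_mop"
  by (rule bounded_linear_intro[of _ "real (CARD('a) * CARD('a))"])
    (use norm_Rep_mop_le in \<open>auto simp: plus_mop.rep_eq scaleR_mop.rep_eq mult.commute\<close>)

lemma bounded_linear_Abs_mop: "bounded_linear Abs_mop"
  by (rule bounded_linear_intro[of _ "real (CARD('a) * CARD('a))"])
    (use norm_Abs_mop_le in \<open>auto simp: plus_mop.abs_eq scaleR_mop.abs_eq mult.commute\<close>)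

text \<open>Completeness is inherited from the matrices, since both directions of the copy are
  bounded linear.\<close>

instance mop :: (finite) banach
proof
  fix X :: "nat \<Rightarrow> 'a mop"
  assume "Cauchy X"
  then have "Cauchy (\<lambda>n. Rep_mop (X n))"
    by (rule bounded_linear.Cauchy[OF bounded_linear_Rep_mop])
  then obtain A where "(\<lambda>n. Rep_mop (X n)) \<longlonglongrightarrow> A"
    using Cauchy_convergent convergent_def by blast
  then have "(\<lambda>n. Abs_mop (Rep_mop (X n))) \<longlonglongrightarrow> Abs_mop A"
    by (rule bounded_linear.tendsto[OF bounded_linear_Abs_mop])
  then show "convergent X"
    by (auto simp: convergent_def Rep_mop_inverse)
qed

lemma Rep_mop_power: "Rep_mop (A ^ k) = mpow (Rep_mop A) k"
  by (induction k) (auto simp: one_mop.rep_eq times_mop.rep_eq)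

text \<open>The bridge to the Banach algebra exponential: \<open>Rep_mop\<close> is bounded linear
  and multiplicative, so it carries the exponential series over term by term.\<close>

lemma mexp_eq_exp: "mexp A = Rep_mop (exp (Abs_mop A))"
proof -
  have "(\<lambda>k. (Abs_mop A) ^ k /\<^sub>R fact k) sums exp (Abs_mop A)"
    by (rule exp_converges)
  then have "(\<lambda>k. Rep_mop ((Abs_mop A) ^ k /\<^sub>R fact k)) sums Rep_mop (exp (Abs_mop A))"
    by (rule bounded_linear.sums[OF bounded_linear_Rep_mop])
  then have "(\<lambda>k. mpow A k /\<^sub>R fact k) sums Rep_mop (exp (Abs_mop A))"
    by (simp add: scaleR_mop.rep_eq Rep_mop_power Abs_mop_inverse)
  then show ?thesis
    by (metis mexp_def sums_unique)
qed

lemma mexp_sums: "(\<lambda>k. mpow A k /\<^sub>R fact k) sums mexp A"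
proof -
  have "(\<lambda>k. Rep_mop ((Abs_mop A) ^ k /\<^sub>R fact k)) sums Rep_mop (exp (Abs_mop A))"
    by (rule bounded_linear.sums[OF bounded_linear_Rep_mop exp_converges])
  then show ?thesis
    by (simp add: scaleR_mop.rep_eq Rep_mop_power Abs_mop_inverse mexp_eq_exp)
qed

section \<open>The matrix exponential\<close>

lemma mexp_zero [simp]: "mexp 0 = mat 1"
  by (simp add: mexp_eq_exp zero_mop_def[symmetric] one_mop.rep_eq)

lemma mexp_minus_mult [simp]:
  "mexp (- X) ** mexp X = mat 1" "mexp X ** mexp (- X) = mat 1"
proof -
  have "Abs_mop (- X) = - Abs_mop X"
    by (simp add: uminus_mop.abs_eq)
  then show "mexp (- X) ** mexp X = mat 1" "mexp X ** mexp (- X) = mat 1"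
    by (simp_all add: mexp_eq_exp exp_minus_inverse flip: times_mop.rep_eq one_mop.rep_eq)
     (metis exp_minus_inverse minus_minus)
qed

lemma mexp_has_vector_derivative:
  "((\<lambda>t. mexp (t *\<^sub>R X)) has_vector_derivative X) (at 0)"
proof -
  have "((\<lambda>t. exp (t *\<^sub>R Abs_mop X)) has_vector_derivative exp (0 *\<^sub>R Abs_mop X) * Abs_mop X) (at 0)"
    by (rule exp_scaleR_has_vector_derivative_right)
  then have "((\<lambda>t. Rep_mop (exp (t *\<^sub>R Abs_mop X))) has_vector_derivative Rep_mop (Abs_mop X)) (at 0)"
    using bounded_linear.has_vector_derivative[OF bounded_linear_Rep_mop] by fastforce
  then show ?thesis
    by (simp add: mexp_eq_exp Abs_mop_inverse scaleR_mop.abs_eq)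
qed

lemma mpow_conj:
  fixes g h X :: "'a::comm_ring_1^'n^'n"
  assumes "h ** g = mat 1" "g ** h = mat 1"
  shows "mpow (g ** X ** h) k = g ** mpow X k ** h"
proof (induction k)
  case (Suc k)
  have "mpow (g ** X ** h) (Suc k) = g ** X ** (h ** g) ** mpow X k ** h"
    by (simp add: Suc matrix_mul_assoc)
  then show ?case
    by (simp add: assms matrix_mul_assoc)
qed (simp add: assms)

lemma bounded_bilinear_matrix_mult:
  "bounded_bilinear ((**) :: real^'n^'m \<Rightarrow> real^'p^'n \<Rightarrow> real^'p^'m)"
  by (intro bilinear_conv_bounded_bilinear[THEN iffD1] bilinear_def[THEN iffD2] conjI allI linearI)
    (auto simp: matrix_add_ldistrib matrix_mult_add_left matrix_scalar_ac scalar_matrix_assoc)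

text \<open>Conjugation commutes with powers and is bounded linear, so it passes through the
  exponential series.\<close>

lemma mexp_conj:
  fixes g h X :: "real^'n^'n"
  assumes "h ** g = mat 1" "g ** h = mat 1"
  shows "mexp (g ** X ** h) = g ** mexp X ** h"
proof -
  have lin: "bounded_linear (\<lambda>Y. g ** Y ** h)"
    using bounded_linear_compose[OF bounded_bilinear.bounded_linear_left[OF bounded_bilinear_matrix_mult]
      bounded_bilinear.bounded_linear_right[OF bounded_bilinear_matrix_mult]] .
  have "(\<lambda>k. g ** (mpow X k /\<^sub>R fact k) ** h) sums (g ** mexp X ** h)"
    by (rule bounded_linear.sums[OF lin mexp_sums])
  moreover have "g ** (mpow X k /\<^sub>R fact k) ** h = mpow (g ** X ** h) k /\<^sub>R fact k" for k
    by (simp add: mpow_conj[OF assms] matrix_scalar_ac scalar_matrix_assoc)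
  ultimately have "(\<lambda>k. mpow (g ** X ** h) k /\<^sub>R fact k) sums (g ** mexp X ** h)"
    by simp
  then show ?thesis
    by (rule sums_unique2[OF mexp_sums])
qed

text \<open>Induction on A^(n+1) - B^(n+1) = A (A^n - B^n) + (A - B) B^n. The extra factor
  \<open>M\<close> on the left stands for the usual exponent n - 1 on the right, which would need a
  case distinction at n = 0.\<close>

lemma norm_power_diff_le:
  fixes A B :: "'a::real_normed_algebra_1"
  assumes "norm A \<le> M" "norm B \<le> M"
  shows "norm (A ^ n - B ^ n) * M \<le> real n * norm (A - B) * M ^ n"
proof (induction n)
  case (Suc n)
  have M: "0 \<le> M" using assms norm_ge_zero order_trans by blast
  have "A ^ Suc n - B ^ Suc n = A * (A ^ n - B ^ n) + (A - B) * B ^ n"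
    by (simp add: algebra_simps)
  then have "norm (A ^ Suc n - B ^ Suc n) \<le> norm A * norm (A ^ n - B ^ n) + norm (A - B) * norm (B ^ n)"
    by (metis norm_triangle_le add_mono norm_mult_ineq)
  also have "\<dots> \<le> M * norm (A ^ n - B ^ n) + norm (A - B) * M ^ n"
    by (intro add_mono mult_mono order_trans[OF norm_power_ineq] power_mono assms) (use M in auto)
  finally have "norm (A ^ Suc n - B ^ Suc n) * M \<le> (M * norm (A ^ n - B ^ n) + norm (A - B) * M ^ n) * M"
    using M by (intro mult_right_mono) auto
  also have "\<dots> = M * (norm (A ^ n - B ^ n) * M) + norm (A - B) * M ^ Suc n"
    by (simp add: algebra_simps)
  also have "\<dots> \<le> M * (real n * norm (A - B) * M ^ n) + norm (A - B) * M ^ Suc n"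
    using M Suc by (intro add_mono mult_left_mono) auto
  finally show ?case
    by (simp add: algebra_simps)
qed auto

lemma has_vector_derivative_LIMSEQ:
  assumes "(\<gamma> has_vector_derivative v) (at 0)"
  shows "(\<lambda>n. real n *\<^sub>R (\<gamma> (1 / real n) - \<gamma> 0)) \<longlonglongrightarrow> v"
proof -
  have "((\<lambda>h. norm (\<gamma> h - \<gamma> 0 - h *\<^sub>R v) / norm h) \<longlongrightarrow> 0) (at 0)"
    using assms by (simp add: has_vector_derivative_def has_derivative_at)
  \<comment> \<open>\<open>1 / real 0\<close> is 0, so the sequence avoids 0 only from index 1
    on.\<close>
  moreover have "filterlim (\<lambda>n. 1 / real n) (at 0) sequentially"
    by (auto simp: filterlim_at eventually_sequentially intro!: lim_1_over_n exI[of _ 1])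
  ultimately have "((\<lambda>n. norm (\<gamma> (1 / real n) - \<gamma> 0 - (1 / real n) *\<^sub>R v) / norm (1 / real n)) \<longlonglongrightarrow> 0)"
    by (rule filterlim_compose)
  then have "(\<lambda>n. norm (real n *\<^sub>R (\<gamma> (1 / real n) - \<gamma> 0) - v)) \<longlonglongrightarrow> 0"
  proof (rule Lim_transform_eventually)
    have "norm (\<gamma> (1 / real n) - \<gamma> 0 - (1 / real n) *\<^sub>R v) / norm (1 / real n) =
        norm (real n *\<^sub>R (\<gamma> (1 / real n) - \<gamma> 0) - v)" if "n \<ge> 1" for n
    proof -
      have "real n *\<^sub>R (\<gamma> (1 / real n) - \<gamma> 0) - v =
          real n *\<^sub>R (\<gamma> (1 / real n) - \<gamma> 0 - (1 / real n) *\<^sub>R v)"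
        using that by (simp add: scaleR_right_diff_distrib)
      then show ?thesis
        by (simp del: scaleR_scaleR add: mult.commute)
    qed
    then show "\<forall>\<^sub>F n in sequentially. norm (\<gamma> (1 / real n) - \<gamma> 0 - (1 / real n) *\<^sub>R v) / norm (1 / real n) =
        norm (real n *\<^sub>R (\<gamma> (1 / real n) - \<gamma> 0) - v)"
      unfolding eventually_sequentially by blast
  qed
  then show ?thesis
    by (intro LIM_zero_cancel[of _ v]) (rule tendsto_norm_zero_cancel)
qed

lemma exp_scaleR_of_nat:
  fixes x :: "'a::{real_normed_algebra_1,banach}"
  shows "exp (real n *\<^sub>R x) = exp x ^ n"
proof (induction n)
  case (Suc n)
  have "exp (real (Suc n) *\<^sub>R x) = exp (x + real n *\<^sub>R x)"
    by (simp add: scaleR_add_left)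
  also have "\<dots> = exp x * exp (real n *\<^sub>R x)"
    by (rule exp_add_commuting) simp
  finally show ?case
    by (simp add: Suc)
qed simp

text \<open>Compare \<open>A n\<close> with exp(Z/n), whose n-th power is exactly exp Z. The two
  differ by o(1/n) because both have first-order part Z, and taking n-th powers multiplies the
  difference by at most n times a constant.\<close>

lemma power_tendsto_exp:
  fixes A :: "nat \<Rightarrow> 'a::{real_normed_algebra_1,banach}"
  assumes A: "(\<lambda>n. real n *\<^sub>R (A n - 1)) \<longlonglongrightarrow> Z"
  shows "(\<lambda>n. A n ^ n) \<longlonglongrightarrow> exp Z"
proof -
  define B where "B n = exp ((1 / real n) *\<^sub>R Z)" for n
  have "(\<lambda>n. real n *\<^sub>R (exp ((1 / real n) *\<^sub>R Z) - exp (0 *\<^sub>R Z))) \<longlonglongrightarrow> Z"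
    using exp_scaleR_has_vector_derivative_right[of Z 0 UNIV]
    by (intro has_vector_derivative_LIMSEQ) simp
  then have "(\<lambda>n. real n *\<^sub>R (A n - 1) - real n *\<^sub>R (B n - 1)) \<longlonglongrightarrow> Z - Z"
    unfolding B_def by (intro tendsto_diff A) simp
  then have AB: "(\<lambda>n. norm (real n *\<^sub>R (A n - B n))) \<longlonglongrightarrow> 0"
    by (intro tendsto_norm_zero) (simp add: scaleR_right_diff_distrib)
  obtain C where C: "norm (real n *\<^sub>R (A n - 1)) \<le> C" for n
    using convergent_imp_Bseq[OF convergentI[OF A]] unfolding Bseq_def by blast
  \<comment> \<open>\<open>C\<close> bounds the sequence n (A n - 1) and \<open>norm Z\<close>
    serves exp(Z/n); the maximum serves both.\<close>
  define D where "D = max C (norm Z)"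
  have D0: "0 \<le> D"
    by (simp add: D_def le_max_iff_disj)
  have bound: "norm (A n ^ n - exp Z) \<le> norm (real n *\<^sub>R (A n - B n)) * exp D" if "n \<ge> 1" for n
  proof -
    have n: "real n > 0" using that by simp
    \<comment> \<open>Both norms are at most exp(D/n), and its n-th power exp D does not depend on
      n.\<close>
    define M where "M = exp (D / real n)"
    have M1: "M \<ge> 1" using n D0 by (simp add: M_def)
    have "real n * norm (A n - 1) \<le> D"
      using C[of n] by (simp add: D_def)
    then have "norm (A n - 1) \<le> D / real n"
      using n by (simp add: field_simps)
    then have "norm (A n) \<le> 1 + D / real n"
      using norm_triangle_ineq[of "A n - 1" 1] by simp
    also have "\<dots> \<le> M"
      unfolding M_def by (rule exp_ge_add_one_self)
    finally have 1: "norm (A n) \<le> M" .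
    have "norm (B n) \<le> exp (norm ((1 / real n) *\<^sub>R Z))"
      unfolding B_def by (rule norm_exp)
    also have "\<dots> \<le> M"
      using n by (simp add: M_def D_def field_simps)
    finally have 2: "norm (B n) \<le> M" .
    have "B n ^ n = exp (real n *\<^sub>R ((1 / real n) *\<^sub>R Z))"
      unfolding B_def by (rule exp_scaleR_of_nat[symmetric])
    then have Bn: "B n ^ n = exp Z" using n by simp
    have Mn: "M ^ n = exp D"
      using n by (simp add: M_def flip: exp_of_nat_mult)
    have "norm (A n ^ n - B n ^ n) \<le> norm (A n ^ n - B n ^ n) * M"
      using M1 mult_left_mono[OF M1, of "norm (A n ^ n - B n ^ n)"] by simp
    also have "\<dots> \<le> real n * norm (A n - B n) * M ^ n"
      by (rule norm_power_diff_le[OF 1 2])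
    finally show ?thesis
      by (simp add: Bn Mn)
  qed
  have "(\<lambda>n. norm (real n *\<^sub>R (A n - B n)) * exp D) \<longlonglongrightarrow> 0"
    using tendsto_mult_right[OF AB, of "exp D"] by simp
  then have "(\<lambda>n. A n ^ n - exp Z) \<longlonglongrightarrow> 0"
    by (rule Lim_null_comparison[rotated])
      (use bound in \<open>auto simp: eventually_sequentially intro!: exI[of _ 1]\<close>)
  then show ?thesis
    by (rule LIM_zero_cancel)
qed

section \<open>Closed linear groups and their Lie algebras\<close>

lemma matrix_inv_unique:
  fixes A B :: "'a::field^'n^'n"
  assumes "A ** B = mat 1"
  shows "matrix_inv A = B"
proof -
  have BA: "B ** A = mat 1"
    using assms matrix_left_right_inverse by blast
  have "A ** matrix_inv A = mat 1 \<and> matrix_inv A ** A = mat 1"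
    unfolding matrix_inv_def by (rule someI[of _ B]) (use assms BA in auto)
  then have "matrix_inv A = matrix_inv A ** (A ** B)"
    by (simp add: assms)
  also have "\<dots> = B"
    using \<open>A ** matrix_inv A = mat 1 \<and> matrix_inv A ** A = mat 1\<close> by (simp add: matrix_mul_assoc)
  finally show ?thesis .
qed

lemma matrix_inv_mult_self:
  fixes A :: "'a::field^'n^'n"
  assumes "invertible A"
  shows "A ** matrix_inv A = mat 1" "matrix_inv A ** A = mat 1"
  using assms matrix_inv_unique[of A] unfolding invertible_def by metis+

lemma matrix_inv_one [simp]: "matrix_inv (mat 1 :: 'a::field^'n^'n) = mat 1"
  by (rule matrix_inv_unique) simp

lemma invertible_matrix_inv:
  fixes A :: "'a::field^'n^'n"
  shows "invertible A \<Longrightarrow> invertible (matrix_inv A)"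
  using matrix_inv_mult_self unfolding invertible_def by blast

lemma matrix_inv_matrix_inv:
  fixes A :: "'a::field^'n^'n"
  shows "invertible A \<Longrightarrow> matrix_inv (matrix_inv A) = A"
  by (simp add: matrix_inv_mult_self matrix_inv_unique)

lemma matrix_inv_mult:
  fixes A B :: "'a::field^'n^'n"
  assumes "invertible A" "invertible B"
  shows "matrix_inv (A ** B) = matrix_inv B ** matrix_inv A"
proof (rule matrix_inv_unique)
  have "A ** B ** (matrix_inv B ** matrix_inv A) = A ** (B ** matrix_inv B) ** matrix_inv A"
    by (simp add: matrix_mul_assoc)
  then show "A ** B ** (matrix_inv B ** matrix_inv A) = mat 1"
    by (simp add: assms matrix_inv_mult_self)
qed

lemma group_GL: "group (GL :: ('a::field^'n^'n) monoid)"
proof (rule groupI)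
  fix x :: "'a^'n^'n"
  assume "x \<in> carrier GL"
  then show "\<exists>y\<in>carrier GL. y \<otimes>\<^bsub>GL\<^esub> x = \<one>\<^bsub>GL\<^esub>"
    by (intro bexI[of _ "matrix_inv x"]) (auto simp: GL_def matrix_inv_mult_self invertible_matrix_inv)
next
  show "\<one>\<^bsub>GL\<^esub> \<in> carrier (GL :: ('a^'n^'n) monoid)"
    by (auto simp: GL_def invertible_def intro: exI[of _ "mat 1"])
qed (auto simp: GL_def matrix_mul_assoc invertible_mult)

lemma GL_simps [simp]: "carrier GL = {A. invertible A}" "mult GL = (**)" "one GL = mat 1"
  by (simp_all add: GL_def)

lemma inv_GL: "invertible A \<Longrightarrow> inv\<^bsub>GL\<^esub> A = matrix_inv A" for A :: "'a::field^'n^'n"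
  by (rule group.inv_equality[OF group_GL]) (simp_all add: matrix_inv_mult_self invertible_matrix_inv)

locale linear_group =
  fixes G :: "(real^'n^'n) set"
  assumes subgroup: "subgroup G GL"
begin

lemma invertible [simp]: "A \<in> G \<Longrightarrow> invertible A"
  using subgroup.subset[OF subgroup] by auto

lemma one_mem [simp]: "mat 1 \<in> G"
  using subgroup.one_closed[OF subgroup] by simp

lemma mult_mem [simp]: "A \<in> G \<Longrightarrow> B \<in> G \<Longrightarrow> A ** B \<in> G"
  using subgroup.m_closed[OF subgroup] by simp

lemma inv_mem [simp]: "A \<in> G \<Longrightarrow> matrix_inv A \<in> G"
  using subgroup.m_inv_closed[OF subgroup] by (simp add: inv_GL)

lemma mult_mem_cancel_left: "A \<in> G \<Longrightarrow> A ** B \<in> G \<longleftrightarrow> B \<in> G"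
  using mult_mem[of "matrix_inv A" "A ** B"] by (auto simp: matrix_mul_assoc matrix_inv_mult_self)

lemma mult_mem_cancel_right: "B \<in> G \<Longrightarrow> A ** B \<in> G \<longleftrightarrow> A \<in> G"
  using mult_mem[of "A ** B" "matrix_inv B"] by (auto simp: matrix_inv_mult_self simp flip: matrix_mul_assoc)

lemma mpow_mem: "A \<in> G \<Longrightarrow> mpow A k \<in> G"
  by (induction k) auto

end

text \<open>Closedness is meant inside GL: only invertible limits must belong to \<open>G\<close>,
  so open subgroups of algebraic groups are covered although they need not be closed among all
  matrices.\<close>

locale closed_linear_group = linear_group G for G :: "(real^'n^'n) set" +
  assumes closed: "\<And>x l. (\<And>n. x n \<in> G) \<Longrightarrow> x \<longlonglongrightarrow> l \<Longrightarrow> invertible l \<Longrightarrow> l \<in> G"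
begin

text \<open>The one-parameter subgroup of \<open>X\<close> is the limit of \<open>\<gamma>(t/n)\<^sup>n\<close>.\<close>
lemma tangent_in_lie_algebra:
  assumes G: "\<And>t. \<gamma> t \<in> G" and "\<gamma> 0 = mat 1" and d: "(\<gamma> has_vector_derivative X) (at 0)"
  shows "X \<in> lie_algebra G"
  unfolding lie_algebra_def
proof (intro CollectI allI)
  fix t :: real
  have m: "((\<lambda>s. t * s) has_vector_derivative t) (at 0)"
    using has_vector_derivative_scaleR[OF DERIV_ident has_vector_derivative_const, of t 0] by (simp add: mult.commute)
  have d': "(\<gamma> has_vector_derivative X) (at (t * 0))"
    using d by simp
  have "((\<lambda>s. \<gamma> (t * s)) has_vector_derivative (t *\<^sub>R X)) (at 0)"
    by (rule vector_diff_chain_at[OF m d', unfolded o_def])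
  then have "((\<lambda>s. Abs_mop (\<gamma> (t * s))) has_vector_derivative Abs_mop (t *\<^sub>R X)) (at 0)"
    by (rule bounded_linear.has_vector_derivative[OF bounded_linear_Abs_mop])
  then have "(\<lambda>n. real n *\<^sub>R (Abs_mop (\<gamma> (t * (1 / real n))) - Abs_mop (\<gamma> (t * 0)))) \<longlonglongrightarrow> Abs_mop (t *\<^sub>R X)"
    by (rule has_vector_derivative_LIMSEQ)
  then have "(\<lambda>n. real n *\<^sub>R (Abs_mop (\<gamma> (t / real n)) - 1)) \<longlonglongrightarrow> Abs_mop (t *\<^sub>R X)"
    by (simp add: assms(2) one_mop_def)
  then have "(\<lambda>n. Abs_mop (\<gamma> (t / real n)) ^ n) \<longlonglongrightarrow> exp (Abs_mop (t *\<^sub>R X))"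
    by (rule power_tendsto_exp)
  then have "(\<lambda>n. Rep_mop (Abs_mop (\<gamma> (t / real n)) ^ n)) \<longlonglongrightarrow> mexp (t *\<^sub>R X)"
    unfolding mexp_eq_exp by (rule bounded_linear.tendsto[OF bounded_linear_Rep_mop])
  then have "(\<lambda>n. mpow (\<gamma> (t / real n)) n) \<longlonglongrightarrow> mexp (t *\<^sub>R X)"
    by (simp add: Rep_mop_power Abs_mop_inverse)
  moreover have "invertible (mexp (t *\<^sub>R X))"
    unfolding invertible_def by (intro exI[of _ "mexp (- (t *\<^sub>R X))"] conjI mexp_minus_mult)
  ultimately show "mexp (t *\<^sub>R X) \<in> G"
    by (rule closed[OF mpow_mem[OF G]])
qed

lemma mexp_mem: "X \<in> lie_algebra G \<Longrightarrow> mexp (t *\<^sub>R X) \<in> G"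
  by (simp add: lie_algebra_def)

text \<open>For sums, t |-> exp(tX) exp(tY) is a curve in \<open>G\<close> with velocity X + Y at
  0.\<close>

lemma subspace_lie_algebra: "subspace (lie_algebra G)"
proof (rule subspaceI)
  show "0 \<in> lie_algebra G"
    by (simp add: lie_algebra_def)
  fix X Y c
  assume X: "X \<in> lie_algebra G"
  then show "c *\<^sub>R X \<in> lie_algebra G"
    by (simp add: lie_algebra_def)
  assume Y: "Y \<in> lie_algebra G"
  have "((\<lambda>t. mexp (t *\<^sub>R X) ** mexp (t *\<^sub>R Y)) has_vector_derivative
      (mexp (0 *\<^sub>R X) ** Y + X ** mexp (0 *\<^sub>R Y))) (at 0)"
    by (rule bounded_bilinear.has_vector_derivative[OF bounded_bilinear_matrix_mult])
      (rule mexp_has_vector_derivative)+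
  then have "((\<lambda>t. mexp (t *\<^sub>R X) ** mexp (t *\<^sub>R Y)) has_vector_derivative (X + Y)) (at 0)"
    by (simp add: add.commute)
  then show "X + Y \<in> lie_algebra G"
    by (rule tangent_in_lie_algebra[rotated 2]) (auto simp: X Y mexp_mem)
qed

lemma conj_in_lie_algebra:
  assumes "g \<in> G" "X \<in> lie_algebra G"
  shows "g ** X ** matrix_inv g \<in> lie_algebra G"
  unfolding lie_algebra_def
proof (intro CollectI allI)
  fix t
  have "mexp (t *\<^sub>R (g ** X ** matrix_inv g)) = g ** mexp (t *\<^sub>R X) ** matrix_inv g"
    using mexp_conj[of "matrix_inv g" g "t *\<^sub>R X"] assms
    by (simp add: matrix_inv_mult_self matrix_scalar_ac scalar_matrix_assoc)
  then show "mexp (t *\<^sub>R (g ** X ** matrix_inv g)) \<in> G"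
    using assms by (simp add: mexp_mem)
qed

text \<open>[X, Y] is the velocity at 0 of the curve exp(tX) Y exp(-tX) in the Lie algebra. A
  subspace is closed, so the limit of the difference quotients stays inside.\<close>

lemma bracket_in_lie_algebra:
  assumes X: "X \<in> lie_algebra G" and Y: "Y \<in> lie_algebra G"
  shows "bracket X Y \<in> lie_algebra G"
proof -
  define c where "c t = mexp (t *\<^sub>R X) ** Y ** mexp (t *\<^sub>R (- X))" for t
  have inv: "mexp (t *\<^sub>R (- X)) = matrix_inv (mexp (t *\<^sub>R X))" for t
    by (rule matrix_inv_unique[symmetric]) simp
  have c: "c t \<in> lie_algebra G" for t
    unfolding c_def inv by (intro conj_in_lie_algebra mexp_mem X Y)
  have "((\<lambda>t. mexp (t *\<^sub>R X) ** Y) has_vector_derivative X ** Y) (at 0)"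
    by (rule bounded_linear.has_vector_derivative[OF
          bounded_bilinear.bounded_linear_left[OF bounded_bilinear_matrix_mult]
          mexp_has_vector_derivative])
  then have "(c has_vector_derivative (mexp (0 *\<^sub>R X) ** Y ** (- X) + (X ** Y) ** mexp (0 *\<^sub>R (- X)))) (at 0)"
    unfolding c_def
    by (rule bounded_bilinear.has_vector_derivative[OF bounded_bilinear_matrix_mult])
      (rule mexp_has_vector_derivative)
  moreover have "Y ** (- X) = - (Y ** X)"
    using bounded_bilinear.minus_right[OF bounded_bilinear_matrix_mult] .
  ultimately have "(c has_vector_derivative bracket X Y) (at 0)"
    by (simp add: bracket_def)
  then have "(\<lambda>n. real n *\<^sub>R (c (1 / real n) - c 0)) \<longlonglongrightarrow> bracket X Y"
    by (rule has_vector_derivative_LIMSEQ)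
  then show ?thesis
    by (rule closed_sequentially[OF closed_subspace[OF subspace_lie_algebra], rotated])
      (intro subspace_mul subspace_diff subspace_lie_algebra c)
qed

end

text \<open>If x_n -> l, the polynomial equations put l into \<open>H\<close>, and l^-1 x_n tends to
  the identity. As \<open>G\<close> is a neighbourhood of the identity in \<open>H\<close>, some
  l^-1 x_n lies in \<open>G\<close>, and hence so does l.\<close>

lemma open_subgroup_closed:
  fixes G H :: "(real^'n^'n) set"
  assumes H: "real_algebraic_group H" and G: "subgroup G GL" and op: "openin (top_of_set H) G"
  shows "closed_linear_group G"
proof -
  interpret linear_group G using G by (rule linear_group.intro)
  obtain P where P: "\<And>p. p \<in> P \<Longrightarrow> real_polynomial_function p"
    and H_eq: "H = {A. invertible A \<and> (\<forall>p\<in>P. p A = 0)}"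
    using H unfolding real_algebraic_group_def by blast
  interpret H: linear_group H
    by (rule linear_group.intro) (use H in \<open>simp add: real_algebraic_group_def\<close>)
  have GH: "G \<subseteq> H" using op openin_imp_subset by blast
  show ?thesis
  proof unfold_locales
    fix x l assume x: "\<And>n. x n \<in> G" and lim: "x \<longlonglongrightarrow> l" and l: "invertible l"
    have "p l = 0" if "p \<in> P" for p
    proof -
      have "isCont p l"
        using P[OF that] continuous_real_polymonial_function by blast
      then have "(\<lambda>n. p (x n)) \<longlonglongrightarrow> p l"
        using lim isCont_tendsto_compose by blast
      moreover have "p (x n) = 0" for n
        using x[of n] GH that H_eq by blast
      ultimately show ?thesis
        by (simp add: LIMSEQ_const_iff)
    qed
    then have lH: "l \<in> H" using l H_eq by blast
    obtain T where T: "open T" "G = H \<inter> T"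
      using op unfolding openin_open by blast
    have "(\<lambda>n. matrix_inv l ** x n) \<longlonglongrightarrow> matrix_inv l ** l"
      by (intro bounded_bilinear.tendsto[OF bounded_bilinear_matrix_mult] tendsto_const lim)
    then have "(\<lambda>n. matrix_inv l ** x n) \<longlonglongrightarrow> mat 1"
      by (simp add: l matrix_inv_mult_self)
    moreover have "mat 1 \<in> T" using T one_mem by blast
    ultimately have "\<forall>\<^sub>F n in sequentially. matrix_inv l ** x n \<in> T"
      using T(1) topological_tendstoD by blast
    then obtain n where n: "matrix_inv l ** x n \<in> T"
      using eventually_happens' sequentially_bot by blast
    have "matrix_inv l ** x n \<in> H" using x[of n] GH lH by auto
    then have "matrix_inv l \<in> G"
      using n T x[of n] mult_mem_cancel_right by blast
    then show "l \<in> G"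
      using inv_mem matrix_inv_matrix_inv[OF l] by metis
  qed
qed

section \<open>Calculus of \<open>C\<^sup>k\<close> functions\<close>

lemma has_derivative_cong_open:
  assumes "open U" "x \<in> U" "\<And>y. y \<in> U \<Longrightarrow> f y = g y"
  shows "(f has_derivative D) (at x) \<longleftrightarrow> (g has_derivative D) (at x)"
  using assms has_derivative_transform_within_open[of f D x UNIV U g]
    has_derivative_transform_within_open[of g D x UNIV U f] by auto

lemma frechet_derivative_cong_open:
  assumes "open U" "x \<in> U" "\<And>y. y \<in> U \<Longrightarrow> f y = g y"
  shows "frechet_derivative f (at x) = frechet_derivative g (at x)"
  unfolding frechet_derivative_def using has_derivative_cong_open[OF assms] by simp

lemma frechet_derivative_eq:
  "(f has_derivative D) (at x) \<Longrightarrow> frechet_derivative f (at x) = D"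
  using frechet_derivative_at by metis

lemma has_derivative_frechet:
  "f differentiable (at x) \<Longrightarrow> (f has_derivative frechet_derivative f (at x)) (at x)"
  by (simp add: frechet_derivative_works)

lemma Ck_on_cong:
  assumes "open U" "\<And>x. x \<in> U \<Longrightarrow> f x = g x"
  shows "Ck_on k U f \<longleftrightarrow> Ck_on k U g"
  using assms(2)
proof (induction k arbitrary: f g)
  case 0
  then show ?case using continuous_on_cong by force
next
  case (Suc k)
  have "f differentiable (at x) \<longleftrightarrow> g differentiable (at x)" if "x \<in> U" for x
    unfolding differentiable_def using has_derivative_cong_open[OF assms(1) that] Suc.prems by blast
  moreover have "Ck_on k U (\<lambda>x. frechet_derivative f (at x) v) \<longleftrightarrow> Ck_on k U (\<lambda>x. frechet_derivative g (at x) v)" for v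
    by (rule Suc.IH) (use frechet_derivative_cong_open[OF assms(1)] Suc.prems in metis)
  ultimately show ?case by auto
qed

lemma Ck_on_subset: "Ck_on k U f \<Longrightarrow> V \<subseteq> U \<Longrightarrow> Ck_on k V f"
  by (induction k arbitrary: f) (auto intro: continuous_on_subset)

lemma Ck_on_SucD: "Ck_on (Suc k) U f \<Longrightarrow> Ck_on k U f"
proof (induction k arbitrary: f)
  case 0
  then show ?case
    by (auto intro!: continuous_at_imp_continuous_on differentiable_imp_continuous_within)
next
  case (Suc k)
  then show ?case by (metis Ck_on.simps(2))
qed

lemma Ck_on_continuous: "Ck_on k U f \<Longrightarrow> continuous_on U f"
  by (induction k) (use Ck_on_SucD in auto)

text \<open>\<open>Ck_on\<close> speaks of \<open>frechet_derivative\<close>; on an open set any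
  explicitly known derivative may take its place.\<close>

lemma Ck_on_SucI:
  assumes "open U" "\<And>x. x \<in> U \<Longrightarrow> (f has_derivative D x) (at x)" "\<And>v. Ck_on k U (\<lambda>x. D x v)"
  shows "Ck_on (Suc k) U f"
proof -
  have "Ck_on k U (\<lambda>x. frechet_derivative f (at x) v) \<longleftrightarrow> Ck_on k U (\<lambda>x. D x v)" for v
    by (rule Ck_on_cong[OF assms(1)]) (use assms(2) frechet_derivative_eq in metis)
  then show ?thesis
    using assms(2,3) by (auto simp: differentiable_def)
qed

lemma Ck_on_derivative:
  "Ck_on (Suc k) U f \<Longrightarrow> x \<in> U \<Longrightarrow> (f has_derivative frechet_derivative f (at x)) (at x)"
  by (simp add: has_derivative_frechet)

lemma Ck_on_const: "open U \<Longrightarrow> Ck_on k U (\<lambda>x. c)"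
proof (induction k arbitrary: c)
  case (Suc k)
  then show ?case
    by (intro Ck_on_SucI[where D="\<lambda>x v. 0"]) auto
qed simp

lemma Ck_on_bounded_linear:
  assumes "open U" "bounded_linear f"
  shows "Ck_on k U f"
proof (cases k)
  case 0
  then show ?thesis using assms by (simp add: linear_continuous_on)
next
  case (Suc l)
  show ?thesis unfolding Suc
    by (rule Ck_on_SucI[OF assms(1), where D="\<lambda>x. f"])
      (use assms bounded_linear_imp_has_derivative Ck_on_const in auto)
qed

lemma Ck_on_add:
  assumes "open U" "Ck_on k U f" "Ck_on k U g"
  shows "Ck_on k U (\<lambda>x. f x + g x)"
  using assms(2,3)
proof (induction k arbitrary: f g)
  case 0
  then show ?case by (auto intro: continuous_intros)
next
  case (Suc k)
  show ?case
    by (rule Ck_on_SucI[OF assms(1),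
          where D="\<lambda>x v. frechet_derivative f (at x) v + frechet_derivative g (at x) v"])
      (use Suc in \<open>auto intro!: has_derivative_add has_derivative_frechet\<close>)
qed

lemma Ck_on_sum:
  assumes "open U" "\<And>i. i \<in> I \<Longrightarrow> Ck_on k U (f i)"
  shows "Ck_on k U (\<lambda>x. \<Sum>i\<in>I. f i x)"
  using assms(2)
proof (induction I rule: infinite_finite_induct)
  case (insert i I)
  then show ?case
    using Ck_on_add[OF assms(1), of k "f i" "\<lambda>x. \<Sum>i\<in>I. f i x"] by simp
qed (auto simp: Ck_on_const[OF assms(1)])

lemma Ck_on_compose_linear:
  assumes "open U" "bounded_linear L" "Ck_on k U f"
  shows "Ck_on k U (\<lambda>x. L (f x))"
  using assms(3)
proof (induction k arbitrary: f)
  case 0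
  then show ?case
    using assms(2) by (simp add: bounded_linear.continuous_on)
next
  case (Suc k)
  show ?case
    by (rule Ck_on_SucI[OF assms(1), where D="\<lambda>x v. L (frechet_derivative f (at x) v)"])
      (use Suc in \<open>auto intro!: bounded_linear.has_derivative[OF assms(2)] has_derivative_frechet\<close>)
qed

text \<open>By the product rule the derivative is a sum of two expressions of the same kind with one
  factor differentiated; hence the induction for all f and g at once.\<close>

lemma Ck_on_bilinear:
  assumes "open U" and bil: "bounded_bilinear B" and "Ck_on k U f" "Ck_on k U g"
  shows "Ck_on k U (\<lambda>x. B (f x) (g x))"
  using assms(3,4)
proof (induction k arbitrary: f g)
  case 0
  then show ?case
    using bounded_bilinear.continuous_on[OF bil] by simp
next
  case (Suc k)
  show ?case
  proof (rule Ck_on_SucI[OF assms(1), where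
        D="\<lambda>x v. B (f x) (frechet_derivative g (at x) v) + B (frechet_derivative f (at x) v) (g x)"])
    fix x assume "x \<in> U"
    then show "((\<lambda>x. B (f x) (g x)) has_derivative
        (\<lambda>v. B (f x) (frechet_derivative g (at x) v) + B (frechet_derivative f (at x) v) (g x))) (at x)"
      using Suc.prems by (intro bounded_bilinear.FDERIV[OF bil] has_derivative_frechet) auto
  next
    fix v
    show "Ck_on k U (\<lambda>x. B (f x) (frechet_derivative g (at x) v) + B (frechet_derivative f (at x) v) (g x))"
      by (intro Ck_on_add[OF assms(1)] Suc.IH Suc.prems[THEN Ck_on_SucD])
        (use Suc.prems in simp_all)
  qed
qed

text \<open>\<open>Ck_on\<close> controls derivatives in fixed directions only. When the direction
  moves with the point, this expansion reduces it to the fixed basis directions.\<close>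

lemma frechet_derivative_euclidean_sum:
  fixes F :: "'a::euclidean_space \<Rightarrow> 'b::real_normed_vector"
  assumes "F differentiable (at x)"
  shows "frechet_derivative F (at x) v = (\<Sum>b\<in>Basis. (v \<bullet> b) *\<^sub>R frechet_derivative F (at x) b)"
proof -
  have lin: "linear (frechet_derivative F (at x))"
    using linear_frechet_derivative[OF assms] .
  have "frechet_derivative F (at x) v = frechet_derivative F (at x) (\<Sum>b\<in>Basis. (v \<bullet> b) *\<^sub>R b)"
    by (simp add: euclidean_representation)
  also have "\<dots> = (\<Sum>b\<in>Basis. (v \<bullet> b) *\<^sub>R frechet_derivative F (at x) b)"
    by (simp add: linear_sum[OF lin] linear_scale[OF lin])
  finally show ?thesis .
qed

text \<open>The chain rule turns the derivative into a sum of products: coordinates of the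
  derivative of \<phi> times basis derivatives of \<open>F\<close> composed with \<phi>. Each of the
  latter falls under the induction hypothesis, which is therefore stated for all
  \<open>F\<close>.\<close>

lemma Ck_on_compose:
  fixes F :: "'a::euclidean_space \<Rightarrow> 'b::real_normed_vector" and \<phi> :: "'c::euclidean_space \<Rightarrow> 'a"
  assumes "open U" "open V" "\<And>x. x \<in> V \<Longrightarrow> \<phi> x \<in> U" "Ck_on k V \<phi>" "Ck_on k U F"
  shows "Ck_on k V (\<lambda>x. F (\<phi> x))"
  using assms(4,5)
proof (induction k arbitrary: F)
  case 0
  then show ?case
    using assms(3) by (auto intro!: continuous_on_compose2[of U F])
next
  case (Suc k)
  let ?D = "\<lambda>x v. \<Sum>b\<in>Basis. (frechet_derivative \<phi> (at x) v \<bullet> b) *\<^sub>R frechet_derivative F (at (\<phi> x)) b"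
  show ?case
  proof (rule Ck_on_SucI[OF assms(2), where D="?D"])
    fix x assume x: "x \<in> V"
    have "((\<lambda>x. F (\<phi> x)) has_derivative (\<lambda>v. frechet_derivative F (at (\<phi> x)) (frechet_derivative \<phi> (at x) v))) (at x)"
      using Suc.prems x assms(3)
      by (intro has_derivative_compose[of \<phi> _ x UNIV F] has_derivative_frechet) simp_all
    moreover have "frechet_derivative F (at (\<phi> x)) (frechet_derivative \<phi> (at x) v) = ?D x v" for v
      using Suc.prems x assms(3) by (intro frechet_derivative_euclidean_sum) simp
    ultimately show "((\<lambda>x. F (\<phi> x)) has_derivative ?D x) (at x)"
      by simp
  next
    fix v
    show "Ck_on k V (\<lambda>x. ?D x v)"
    proof (intro Ck_on_sum[OF assms(2)] Ck_on_bilinear[OF assms(2) bounded_bilinear_scaleR])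
      fix b :: 'a assume "b \<in> Basis"
      show "Ck_on k V (\<lambda>x. frechet_derivative \<phi> (at x) v \<bullet> b)"
        using Suc.prems by (intro Ck_on_compose_linear[OF assms(2) bounded_linear_inner_left]) simp
      show "Ck_on k V (\<lambda>x. frechet_derivative F (at (\<phi> x)) b)"
        using Suc.prems Ck_on_SucD by (intro Suc.IH) auto
    qed
  qed
qed

text \<open>Differentiating along a linear vector field costs one order, so flow derivatives of
  smooth functions are smooth again.\<close>

lemma Ck_on_vector_field_derivative:
  fixes F :: "'a::euclidean_space \<Rightarrow> 'b::real_normed_vector"
  assumes "open U" "Ck_on (Suc k) U F" "bounded_linear A"
  shows "Ck_on k U (\<lambda>x. frechet_derivative F (at x) (A x))"
proof -
  have "Ck_on k U (\<lambda>x. \<Sum>b\<in>Basis. (A x \<bullet> b) *\<^sub>R frechet_derivative F (at x) b)"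
  proof (intro Ck_on_sum[OF assms(1)] Ck_on_bilinear[OF assms(1) bounded_bilinear_scaleR])
    fix b :: 'a
    show "Ck_on k U (\<lambda>x. A x \<bullet> b)"
      by (intro Ck_on_bounded_linear[OF assms(1)] bounded_linear_compose[OF bounded_linear_inner_left] assms(3))
    show "Ck_on k U (\<lambda>x. frechet_derivative F (at x) b)"
      using assms(2) by simp
  qed
  moreover have "frechet_derivative F (at x) (A x) = (\<Sum>b\<in>Basis. (A x \<bullet> b) *\<^sub>R frechet_derivative F (at x) b)"
    if "x \<in> U" for x
    using that assms by (intro frechet_derivative_euclidean_sum) simp
  ultimately show ?thesis
    using Ck_on_cong[OF assms(1)] by (metis (no_types, lifting))
qed

section \<open>Smoothness of matrix inversion\<close>

lemma open_invertible: "open {A :: real^'n^'n. invertible A}"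
proof -
  have "continuous_on UNIV (det :: real^'n^'n \<Rightarrow> real)"
    unfolding det_def by (intro continuous_intros)
  then have "open (det -` (- {0}) :: (real^'n^'n) set)"
    by (intro open_vimage) auto
  moreover have "{A :: real^'n^'n. invertible A} = det -` (- {0})"
    by (auto simp: invertible_det_nz)
  ultimately show ?thesis by simp
qed

text \<open>Column l of the inverse solves A x = e_l, so Cramer's rule applies to each column.
  Continuity of inversion follows from this formula.\<close>

lemma matrix_inv_cramer:
  fixes A :: "real^'n^'n"
  assumes "invertible A"
  shows "matrix_inv A = (\<chi> k l. det (\<chi> i j. if j = k then mat 1 $ i $ l else A $ i $ j) / det A)"
proof -
  have "matrix_inv A $ k $ l = det (\<chi> i j. if j = k then mat 1 $ i $ l else A $ i $ j) / det A" for k l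
  proof -
    have "A *v (\<chi> k. matrix_inv A $ k $ l) = (\<chi> i. mat 1 $ i $ l)"
      using matrix_inv_mult_self(1)[OF assms]
      by (simp add: vec_eq_iff matrix_vector_mult_def matrix_matrix_mult_def)
    then have "(\<chi> k. matrix_inv A $ k $ l) =
        (\<chi> k. det(\<chi> i j. if j=k then (\<chi> i. mat 1 $ i $ l) $ i else A$i$j) / det A)"
      using cramer[of A] assms by (simp add: invertible_det_nz)
    then have "matrix_inv A $ k $ l =
        det(\<chi> i j. if j=k then (\<chi> i. mat 1 $ i $ l) $ i else A$i$j) / det A"
      unfolding vec_eq_iff by simp
    then show ?thesis by (simp only: vec_lambda_beta)
  qed
  then show ?thesis by (simp add: vec_eq_iff)
qed

lemma continuous_on_matrix_inv: "continuous_on {A :: real^'n^'n. invertible A} matrix_inv"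
proof -
  have "continuous_on {A :: real^'n^'n. invertible A}
      (\<lambda>A. (\<chi> k l. det (\<chi> i j. if j = k then mat 1 $ i $ l else A $ i $ j) / det A) :: real^'n^'n)"
  proof (intro continuous_on_vec_lambda continuous_on_divide)
    fix k l :: 'n
    have c: "continuous_on S (\<lambda>A :: real^'n^'n. if p = k then mat 1 $ i $ l else A $ i $ p)" for S i p
      by (cases "p = k") (auto intro!: continuous_intros)
    show "continuous_on {A :: real^'n^'n. invertible A}
        (\<lambda>A. det (\<chi> i j. if j = k then mat 1 $ i $ l else A $ i $ j))"
      unfolding det_def
      by (intro continuous_on_sum continuous_on_mult continuous_on_prod continuous_on_const) (simp add: c)
    show "continuous_on {A :: real^'n^'n. invertible A} det"
      unfolding det_def
      by (intro continuous_on_sum continuous_on_mult continuous_on_prod continuous_on_const continuous_on_component continuous_on_id)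
  qed (auto simp: invertible_det_nz)
  then show ?thesis
    by (rule continuous_on_eq) (simp add: matrix_inv_cramer)
qed

text \<open>From B^-1 - A^-1 = - B^-1 (B - A) A^-1 the remainder is (A^-1 - B^-1) (B - A) A^-1,
  which is o(norm (B - A)) by continuity of inversion.\<close>

lemma matrix_inv_has_derivative:
  fixes A :: "real^'n^'n"
  assumes A: "invertible A"
  shows "(matrix_inv has_derivative (\<lambda>H. - (matrix_inv A ** H ** matrix_inv A))) (at A)"
proof -
  interpret bounded_bilinear "(**) :: real^'n^'n \<Rightarrow> real^'n^'n \<Rightarrow> real^'n^'n"
    by (rule bounded_bilinear_matrix_mult)
  have lin: "bounded_linear (\<lambda>H. - (matrix_inv A ** H ** matrix_inv A))"
    by (intro bounded_linear_minus bounded_linear_compose[OF bounded_linear_left bounded_linear_right])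
  have "isCont matrix_inv A"
    using continuous_on_matrix_inv[where 'n='n] A by (simp add: continuous_on_eq_continuous_at[OF open_invertible])
  then have "(\<lambda>B. matrix_inv A - matrix_inv B) \<midarrow>A\<rightarrow> matrix_inv A - matrix_inv A"
    unfolding isCont_def by (intro tendsto_diff tendsto_const)
  then have lim: "(\<lambda>B. norm (matrix_inv A - matrix_inv B)) \<midarrow>A\<rightarrow> 0"
    by (intro tendsto_norm_zero) simp
  obtain K where K: "K > 0" "\<And>(a :: real^'n^'n) (b :: real^'n^'n). norm (a ** b) \<le> norm a * norm b * K"
    using pos_bounded by blast
  let ?r = "\<lambda>B. norm (matrix_inv B - matrix_inv A - (- (matrix_inv A ** (B - A) ** matrix_inv A))) / norm (B - A)"
  have "(?r \<longlongrightarrow> 0) (at A)"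
  proof (rule Lim_null_comparison)
    have "((\<lambda>B. norm (matrix_inv A - matrix_inv B) * (K * norm (matrix_inv A) * K)) \<longlongrightarrow> 0 * (K * norm (matrix_inv A) * K)) (at A)"
      by (intro tendsto_mult tendsto_const lim)
    then show "((\<lambda>B. norm (matrix_inv A - matrix_inv B) * (K * norm (matrix_inv A) * K)) \<longlongrightarrow> 0) (at A)"
      by simp
    have "norm (?r B) \<le> norm (matrix_inv A - matrix_inv B) * (K * norm (matrix_inv A) * K)"
      if B: "invertible B" "B \<noteq> A" for B
    proof -
      have "matrix_inv B - matrix_inv A = - (matrix_inv B ** (B - A) ** matrix_inv A)"
        by (simp add: diff_left diff_right matrix_inv_mult_self B A)
          (simp add: matrix_inv_mult_self A flip: matrix_mul_assoc)
      then have "matrix_inv B - matrix_inv A - (- (matrix_inv A ** (B - A) ** matrix_inv A)) =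
          (matrix_inv A - matrix_inv B) ** (B - A) ** matrix_inv A"
        by (simp add: diff_left)
      then have "norm (matrix_inv B - matrix_inv A - (- (matrix_inv A ** (B - A) ** matrix_inv A))) \<le>
         norm ((matrix_inv A - matrix_inv B) ** (B - A)) * norm (matrix_inv A) * K"
        by (simp only: K(2))
      also have "\<dots> \<le> norm (matrix_inv A - matrix_inv B) * norm (B - A) * K * norm (matrix_inv A) * K"
        using K by (intro mult_right_mono) auto
      finally show ?thesis
        using B by (simp add: field_simps)
    qed
    moreover have "\<forall>\<^sub>F B in at A. invertible B \<and> B \<noteq> A"
      unfolding eventually_at_topological
      by (intro exI[of _ "{B. invertible B}"]) (use open_invertible A in auto)
    ultimately show "\<forall>\<^sub>F B in at A. norm (?r B) \<le> norm (matrix_inv A - matrix_inv B) * (K * norm (matrix_inv A) * K)"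
      by (auto elim: eventually_mono)
  qed
  then show ?thesis
    using lin by (simp add: has_derivative_iff_norm)
qed

text \<open>Bootstrapping: up to sign the derivative of inversion is a product of two inversions and
  a constant matrix, so each order of differentiability yields the next.\<close>

lemma Ck_on_matrix_inv: "Ck_on k {A :: real^'n^'n. invertible A} matrix_inv"
proof (induction k)
  case 0
  then show ?case by (simp add: continuous_on_matrix_inv)
next
  case (Suc k)
  show ?case
  proof (rule Ck_on_SucI[OF open_invertible, where D="\<lambda>A H. - (matrix_inv A ** H ** matrix_inv A)"])
    fix v :: "real^'n^'n"
    show "Ck_on k {A. invertible A} (\<lambda>A. - (matrix_inv A ** v ** matrix_inv A))"
      by (intro Ck_on_compose_linear[OF open_invertible bounded_linear_minus[OF bounded_linear_ident]]
        Ck_on_bilinear[OF open_invertible bounded_bilinear_matrix_mult] Suc Ck_on_const open_invertible)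
  qed (simp add: matrix_inv_has_derivative)
qed

section \<open>Symmetry of the second derivative\<close>

lemma has_vector_derivative_line:
  assumes "F differentiable (at (p + s *\<^sub>R v))"
  shows "((\<lambda>s. F (p + s *\<^sub>R v)) has_vector_derivative frechet_derivative F (at (p + s *\<^sub>R v)) v) (at s within S)"
proof -
  have "((\<lambda>s. p + s *\<^sub>R v) has_derivative (\<lambda>h. h *\<^sub>R v)) (at s within S)"
    by (auto intro!: derivative_eq_intros)
  then have "((\<lambda>s. F (p + s *\<^sub>R v)) has_derivative (\<lambda>h. frechet_derivative F (at (p + s *\<^sub>R v)) (h *\<^sub>R v))) (at s within S)"
    by (rule has_derivative_compose) (rule has_derivative_frechet[OF assms])
  then show ?thesis
    using linear_frechet_derivative[OF assms] by (simp add: has_vector_derivative_def linear_scale)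
qed

text \<open>Integrate along v: F(x + sv + tw) - F(x + tw) is the integral of the v-derivative over
  [0, s]. Differentiating in t at 0, under the integral on one side and directly on the other, gives
  \<open>int_eq\<close>; differentiating that in s at 0 gives the claim.\<close>

lemma second_derivative_symmetric:
  fixes F :: "'a::euclidean_space \<Rightarrow> 'b::banach"
  assumes U: "open U" "x \<in> U" and F: "Ck_on 2 U F"
  shows "frechet_derivative (\<lambda>y. frechet_derivative F (at y) v) (at x) w =
    frechet_derivative (\<lambda>y. frechet_derivative F (at y) w) (at x) v"
proof -
  let ?D = "\<lambda>v y. frechet_derivative F (at y) v"
  have F2: "Ck_on (Suc (Suc 0)) U F" using F by (simp add: numeral_2_eq_2)
  have dF: "F differentiable (at y)" if "y \<in> U" for y using F2 that by simp
  have dD: "?D v differentiable (at y)" if "y \<in> U" for y v using F2 that by simp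
  have cD: "continuous_on U (?D v)" for v using Ck_on_continuous[of "Suc 0" U "?D v"] F2 by (metis Ck_on.simps(2))
  have cDD: "continuous_on U (\<lambda>y. frechet_derivative (?D v) (at y) w)" for v w using F2 by simp
  obtain e where e: "e > 0" "ball x e \<subseteq> U" using U open_contains_ball by blast
  \<comment> \<open>Keeps both increments together within e/2 of x; the summand 1 prevents a
    division by 0 when v = w = 0.\<close>
  define d where "d = e / (2 * (norm v + norm w + 1))"
  have d: "d > 0" using e by (simp add: d_def add_nonneg_pos)
  have inU: "x + s *\<^sub>R v + t *\<^sub>R w \<in> U" if "\<bar>s\<bar> \<le> d" "\<bar>t\<bar> \<le> d" for s t
  proof -
    have "norm (s *\<^sub>R v + t *\<^sub>R w) \<le> \<bar>s\<bar> * norm v + \<bar>t\<bar> * norm w"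
      by (metis norm_scaleR norm_triangle_ineq)
    also have "\<dots> \<le> d * norm v + d * norm w"
      using that by (intro add_mono mult_right_mono) auto
    also have "\<dots> \<le> d * (norm v + norm w + 1)"
      using d by (simp add: algebra_simps)
    also have "\<dots> = e / 2"
    proof -
      have "norm v + norm w + 1 \<noteq> 0" by (metis add_nonneg_pos add_nonneg_nonneg norm_ge_zero less_numeral_extra(1) less_irrefl)
      then show ?thesis
        unfolding d_def by (simp only: times_divide_eq_left mult.commute[of 2] mult_divide_mult_cancel_left divide_divide_eq_left[symmetric]) (simp add: field_simps)
    qed
    also have "\<dots> < e" using e by simp
    finally have "dist x (x + s *\<^sub>R v + t *\<^sub>R w) < e"
      by (metis add.assoc add_diff_cancel_left' dist_commute dist_norm)
    then show ?thesis using e by (metis mem_ball subsetD)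
  qed
  have comm: "x + s *\<^sub>R v + t *\<^sub>R w = x + t *\<^sub>R w + s *\<^sub>R v" for s t
    by (simp add: ac_simps)
  have int_eq: "integral {0..s} (\<lambda>\<sigma>. frechet_derivative (?D v) (at (x + \<sigma> *\<^sub>R v)) w) = ?D w (x + s *\<^sub>R v) - ?D w x"
    if s: "s \<in> {0..d}" for s
  proof -
    have ftc: "((\<lambda>\<sigma>. ?D v (x + \<sigma> *\<^sub>R v + t *\<^sub>R w)) has_integral
        (F (x + s *\<^sub>R v + t *\<^sub>R w) - F (x + t *\<^sub>R w))) {0..s}" if t: "t \<in> {-d..d}" for t
    proof -
      have "((\<lambda>\<sigma>. ?D v (x + t *\<^sub>R w + \<sigma> *\<^sub>R v)) has_integral
        (F (x + t *\<^sub>R w + s *\<^sub>R v) - F (x + t *\<^sub>R w + 0 *\<^sub>R v))) {0..s}"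
      proof (rule fundamental_theorem_of_calculus)
        fix \<sigma> assume "\<sigma> \<in> {0..s}"
        then have "x + t *\<^sub>R w + \<sigma> *\<^sub>R v \<in> U" using inU[of \<sigma> t] t s by (simp add: comm abs_le_iff)
        then show "((\<lambda>\<sigma>. F (x + t *\<^sub>R w + \<sigma> *\<^sub>R v)) has_vector_derivative ?D v (x + t *\<^sub>R w + \<sigma> *\<^sub>R v)) (at \<sigma> within {0..s})"
          by (rule has_vector_derivative_line[OF dF])
      qed (use s in simp)
      then show ?thesis by (simp add: comm)
    qed
    \<comment> \<open>The parameter t runs over a two-sided interval, so that the derivative at 0 is
      an ordinary one and \<open>vector_derivative_unique_at\<close> applies.\<close>
    have "((\<lambda>t. integral (cbox 0 s) (\<lambda>\<sigma>. ?D v (x + \<sigma> *\<^sub>R v + t *\<^sub>R w))) has_vector_derivative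
       integral (cbox 0 s) (\<lambda>\<sigma>. frechet_derivative (?D v) (at (x + \<sigma> *\<^sub>R v + 0 *\<^sub>R w)) w)) (at 0 within {-d..d})"
    proof (rule leibniz_rule_vector_derivative)
      fix t \<sigma> :: real assume "t \<in> {-d..d}" "\<sigma> \<in> cbox 0 s"
      then have "x + \<sigma> *\<^sub>R v + t *\<^sub>R w \<in> U" using inU s by auto
      then show "((\<lambda>t. ?D v (x + \<sigma> *\<^sub>R v + t *\<^sub>R w)) has_vector_derivative
         frechet_derivative (?D v) (at (x + \<sigma> *\<^sub>R v + t *\<^sub>R w)) w) (at t within {-d..d})"
        by (rule has_vector_derivative_line[OF dD])
    next
      fix t assume "t \<in> {-d..d}"
      then show "(\<lambda>\<sigma>. ?D v (x + \<sigma> *\<^sub>R v + t *\<^sub>R w)) integrable_on cbox 0 s"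
        using ftc by (auto simp: integrable_on_def)
    next
      show "continuous_on ({-d..d} \<times> cbox 0 s) (\<lambda>(t, \<sigma>). frechet_derivative (?D v) (at (x + \<sigma> *\<^sub>R v + t *\<^sub>R w)) w)"
        unfolding case_prod_beta
        by (rule continuous_on_compose2[OF cDD]) (use inU s in \<open>auto intro!: continuous_intros\<close>)
    qed (use d in auto)
    then have "((\<lambda>t. integral {0..s} (\<lambda>\<sigma>. ?D v (x + \<sigma> *\<^sub>R v + t *\<^sub>R w))) has_vector_derivative
       integral {0..s} (\<lambda>\<sigma>. frechet_derivative (?D v) (at (x + \<sigma> *\<^sub>R v)) w)) (at 0 within {-d..d})"
      by (simp only: scaleR_zero_left add_0_right cbox_interval)
    then have A: "((\<lambda>t. F (x + s *\<^sub>R v + t *\<^sub>R w) - F (x + t *\<^sub>R w)) has_vector_derivative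
       integral {0..s} (\<lambda>\<sigma>. frechet_derivative (?D v) (at (x + \<sigma> *\<^sub>R v)) w)) (at 0 within {-d..d})"
      by (rule has_vector_derivative_transform[rotated 2])
        (use d integral_unique[OF ftc] in auto)
    have B: "((\<lambda>t. F (x + s *\<^sub>R v + t *\<^sub>R w) - F (x + t *\<^sub>R w)) has_vector_derivative
       ?D w (x + s *\<^sub>R v + 0 *\<^sub>R w) - ?D w (x + 0 *\<^sub>R w)) (at 0 within {-d..d})"
      using inU[of s 0] U(2) d s
      by (intro has_vector_derivative_diff has_vector_derivative_line[OF dF]) simp_all
    have C: "at 0 within {-d..d} = at 0"
      using d by (intro at_within_Icc_at) auto
    have "integral {0..s} (\<lambda>\<sigma>. frechet_derivative (?D v) (at (x + \<sigma> *\<^sub>R v)) w) =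
        ?D w (x + s *\<^sub>R v + 0 *\<^sub>R w) - ?D w (x + 0 *\<^sub>R w)"
      by (rule vector_derivative_unique_at[OF A[unfolded C] B[unfolded C]])
    then show ?thesis by simp
  qed
  \<comment> \<open>Here s takes only nonnegative values, as the integrals start at 0; a one-sided
    derivative still determines its value.\<close>
  have "((\<lambda>s. integral {0..s} (\<lambda>\<sigma>. frechet_derivative (?D v) (at (x + \<sigma> *\<^sub>R v)) w)) has_vector_derivative
     frechet_derivative (?D v) (at (x + 0 *\<^sub>R v)) w) (at 0 within {0..d})"
  proof (rule integral_has_vector_derivative)
    show "continuous_on {0..d} (\<lambda>\<sigma>. frechet_derivative (?D v) (at (x + \<sigma> *\<^sub>R v)) w)"
      by (rule continuous_on_compose2[OF cDD])
        (use inU[of _ 0] d in \<open>auto intro!: continuous_intros\<close>)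
  qed (use d in auto)
  then have "((\<lambda>s. ?D w (x + s *\<^sub>R v) - ?D w x) has_vector_derivative
     frechet_derivative (?D v) (at (x + 0 *\<^sub>R v)) w) (at 0 within {0..d})"
    by (rule has_vector_derivative_transform[rotated 2]) (use d int_eq in auto)
  moreover have "((\<lambda>s. ?D w (x + s *\<^sub>R v) - ?D w x) has_vector_derivative
     frechet_derivative (?D w) (at (x + 0 *\<^sub>R v)) v - 0) (at 0 within {0..d})"
    using U(2)
    by (intro has_vector_derivative_diff has_vector_derivative_line[OF dD] has_vector_derivative_const) auto
  ultimately have "frechet_derivative (?D v) (at (x + 0 *\<^sub>R v)) w = frechet_derivative (?D w) (at (x + 0 *\<^sub>R v)) v - 0"
    by (rule vector_derivative_unique_within[rotated])
      (use d in \<open>simp add: at_within_Icc_at_right trivial_limit_at_right_real\<close>)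
  then show ?thesis by simp
qed

section \<open>Lie algebra representations on function spaces\<close>

text \<open>Common frame for the differential operators on smooth functions and for
  \<open>tensor_op\<close> on functionals. All laws are relative to \<open>V\<close>: derivatives
  obey them on smooth functions, not on arbitrary ones.\<close>

locale lie_rep =
  fixes L :: "(complex^'n^'n) set"
    and D :: "complex^'n^'n \<Rightarrow> ('g \<Rightarrow> complex) \<Rightarrow> 'g \<Rightarrow> complex"
    and V :: "('g \<Rightarrow> complex) set"
  assumes V_add: "f \<in> V \<Longrightarrow> g \<in> V \<Longrightarrow> f + g \<in> V"
    and V_scale: "f \<in> V \<Longrightarrow> fscale c f \<in> V"
    and D_closed: "X \<in> L \<Longrightarrow> f \<in> V \<Longrightarrow> D X f \<in> V"
    and D_add: "X \<in> L \<Longrightarrow> f \<in> V \<Longrightarrow> g \<in> V \<Longrightarrow> D X (f + g) = D X f + D X g"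
    and D_scale: "X \<in> L \<Longrightarrow> f \<in> V \<Longrightarrow> D X (fscale c f) = fscale c (D X f)"
    and D_linear: "X \<in> L \<Longrightarrow> Y \<in> L \<Longrightarrow> f \<in> V \<Longrightarrow>
      D (msmult a X + msmult b Y) f = fscale a (D X f) + fscale b (D Y f)"
    and D_bracket: "X \<in> L \<Longrightarrow> Y \<in> L \<Longrightarrow> f \<in> V \<Longrightarrow>
      D (bracket X Y) f = D X (D Y f) - D Y (D X f)"

lemma map_matrix_Re_Im_linear:
  "map_matrix Re (msmult a X + msmult b Y) =
     Re a *\<^sub>R map_matrix Re X + (- Im a) *\<^sub>R map_matrix Im X + (Re b *\<^sub>R map_matrix Re Y + (- Im b) *\<^sub>R map_matrix Im Y)"
  "map_matrix Im (msmult a X + msmult b Y) =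
     Re a *\<^sub>R map_matrix Im X + Im a *\<^sub>R map_matrix Re X + (Re b *\<^sub>R map_matrix Im Y + Im b *\<^sub>R map_matrix Re Y)"
  by (simp_all add: vec_eq_iff map_matrix_def msmult_def)

lemma map_matrix_Re_Im_bracket:
  "map_matrix Re (bracket X Y) =
     bracket (map_matrix Re X) (map_matrix Re Y) + (- 1) *\<^sub>R bracket (map_matrix Im X) (map_matrix Im Y)"
  "map_matrix Im (bracket X Y) =
     bracket (map_matrix Re X) (map_matrix Im Y) + bracket (map_matrix Im X) (map_matrix Re Y)"
  by (simp_all add: vec_eq_iff map_matrix_def bracket_def matrix_matrix_mult_def sum_subtractf sum.distrib)

text \<open>A real action is extended by D_(X + iY) = D_X + i D_Y. Both sides of the bracket law are
  then complex bilinear, so it reduces to the real law on real and imaginary parts.\<close>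

lemma complexify_rep:
  fixes \<gg> :: "(real^'n^'n) set" and D :: "real^'n^'n \<Rightarrow> ('g \<Rightarrow> complex) \<Rightarrow> 'g \<Rightarrow> complex"
  assumes sub: "subspace \<gg>" and br: "\<And>X Y. X \<in> \<gg> \<Longrightarrow> Y \<in> \<gg> \<Longrightarrow> bracket X Y \<in> \<gg>"
    and V_add: "\<And>f g. f \<in> V \<Longrightarrow> g \<in> V \<Longrightarrow> f + g \<in> V"
    and V_scale: "\<And>c f. f \<in> V \<Longrightarrow> fscale c f \<in> V"
    and D_closed: "\<And>X f. X \<in> \<gg> \<Longrightarrow> f \<in> V \<Longrightarrow> D X f \<in> V"
    and D_add: "\<And>X f g. X \<in> \<gg> \<Longrightarrow> f \<in> V \<Longrightarrow> g \<in> V \<Longrightarrow> D X (f + g) = D X f + D X g"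
    and D_scale: "\<And>X f c. X \<in> \<gg> \<Longrightarrow> f \<in> V \<Longrightarrow> D X (fscale c f) = fscale c (D X f)"
    and D_add_left: "\<And>X Y f. X \<in> \<gg> \<Longrightarrow> Y \<in> \<gg> \<Longrightarrow> f \<in> V \<Longrightarrow> D (X + Y) f = D X f + D Y f"
    and D_scale_left: "\<And>X f r. X \<in> \<gg> \<Longrightarrow> f \<in> V \<Longrightarrow> D (r *\<^sub>R X) f = fscale (of_real r) (D X f)"
    and D_bracket: "\<And>X Y f. X \<in> \<gg> \<Longrightarrow> Y \<in> \<gg> \<Longrightarrow> f \<in> V \<Longrightarrow>
      D (bracket X Y) f = D X (D Y f) - D Y (D X f)"
  shows "lie_rep (complexification \<gg>)
    (\<lambda>Z f. D (map_matrix Re Z) f + fscale \<i> (D (map_matrix Im Z) f)) V"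
proof
  fix X Y :: "complex^'n^'n" and f :: "'g \<Rightarrow> complex" and a b :: complex
  assume "X \<in> complexification \<gg>"
  then have X: "map_matrix Re X \<in> \<gg>" "map_matrix Im X \<in> \<gg>"
    by (auto simp: complexification_def)
  assume f: "f \<in> V"
  show "D (map_matrix Re X) f + fscale \<i> (D (map_matrix Im X) f) \<in> V"
    using X f by (intro V_add V_scale D_closed)
  show "D (map_matrix Re X) (fscale a f) + fscale \<i> (D (map_matrix Im X) (fscale a f)) =
      fscale a (D (map_matrix Re X) f + fscale \<i> (D (map_matrix Im X) f))"
    using X f by (simp add: D_scale) (simp add: fscale_def fun_eq_iff algebra_simps)
  assume "Y \<in> complexification \<gg>"
  then have Y: "map_matrix Re Y \<in> \<gg>" "map_matrix Im Y \<in> \<gg>"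
    by (auto simp: complexification_def)
  note sub_rules = subspace_add[OF sub] subspace_mul[OF sub] br
  have re: "D (map_matrix Re (msmult a X + msmult b Y)) f =
     fscale (of_real (Re a)) (D (map_matrix Re X) f) + fscale (of_real (- Im a)) (D (map_matrix Im X) f)
    + (fscale (of_real (Re b)) (D (map_matrix Re Y) f) + fscale (of_real (- Im b)) (D (map_matrix Im Y) f))"
    unfolding map_matrix_Re_Im_linear using X Y f
    by (simp add: D_add_left D_scale_left sub_rules del: scaleR_minus_left)
  have im: "D (map_matrix Im (msmult a X + msmult b Y)) f =
     fscale (of_real (Re a)) (D (map_matrix Im X) f) + fscale (of_real (Im a)) (D (map_matrix Re X) f)
    + (fscale (of_real (Re b)) (D (map_matrix Im Y) f) + fscale (of_real (Im b)) (D (map_matrix Re Y) f))"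
    unfolding map_matrix_Re_Im_linear using X Y f
    by (simp add: D_add_left D_scale_left sub_rules)
  show "D (map_matrix Re (msmult a X + msmult b Y)) f + fscale \<i> (D (map_matrix Im (msmult a X + msmult b Y)) f) =
      fscale a (D (map_matrix Re X) f + fscale \<i> (D (map_matrix Im X) f)) +
      fscale b (D (map_matrix Re Y) f + fscale \<i> (D (map_matrix Im Y) f))"
    unfolding re im by (simp add: fun_eq_iff fscale_def complex_eq_iff algebra_simps)
  have bre: "D (map_matrix Re (bracket X Y)) f =
     (D (map_matrix Re X) (D (map_matrix Re Y) f) - D (map_matrix Re Y) (D (map_matrix Re X) f)) +
     fscale (-1) (D (map_matrix Im X) (D (map_matrix Im Y) f) - D (map_matrix Im Y) (D (map_matrix Im X) f))"
    unfolding map_matrix_Re_Im_bracket using X Y f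
    by (simp add: D_add_left D_scale_left D_bracket sub_rules del: scaleR_minus_left scaleR_minus1_left)
  have bim: "D (map_matrix Im (bracket X Y)) f =
     (D (map_matrix Re X) (D (map_matrix Im Y) f) - D (map_matrix Im Y) (D (map_matrix Re X) f)) +
     (D (map_matrix Im X) (D (map_matrix Re Y) f) - D (map_matrix Re Y) (D (map_matrix Im X) f))"
    unfolding map_matrix_Re_Im_bracket using X Y f
    by (simp add: D_add_left D_scale_left D_bracket sub_rules)
  show "D (map_matrix Re (bracket X Y)) f + fscale \<i> (D (map_matrix Im (bracket X Y)) f) =
      D (map_matrix Re X) (D (map_matrix Re Y) f + fscale \<i> (D (map_matrix Im Y) f)) +
      fscale \<i> (D (map_matrix Im X) (D (map_matrix Re Y) f + fscale \<i> (D (map_matrix Im Y) f))) -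
      (D (map_matrix Re Y) (D (map_matrix Re X) f + fscale \<i> (D (map_matrix Im X) f)) +
       fscale \<i> (D (map_matrix Im Y) (D (map_matrix Re X) f + fscale \<i> (D (map_matrix Im X) f))))"
    unfolding bre bim using X Y f
    by (simp add: D_add D_scale V_scale D_closed) (simp add: fun_eq_iff fscale_def algebra_simps)
next
  fix X :: "complex^'n^'n" and f g :: "'g \<Rightarrow> complex"
  assume "X \<in> complexification \<gg>" "f \<in> V" "g \<in> V"
  then show "D (map_matrix Re X) (f + g) + fscale \<i> (D (map_matrix Im X) (f + g)) =
      D (map_matrix Re X) f + fscale \<i> (D (map_matrix Im X) f) + (D (map_matrix Re X) g + fscale \<i> (D (map_matrix Im X) g))"
    by (simp add: complexification_def D_add) (simp add: fun_eq_iff fscale_def algebra_simps)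
qed (use V_add V_scale in auto)

section \<open>Invariant vector fields on smooth functions\<close>

definition local_extension ::
  "(real^'n^'n) set \<Rightarrow> (real^'n^'n \<Rightarrow> complex) \<Rightarrow> real^'n^'n \<Rightarrow> (real^'n^'n) set \<Rightarrow> (real^'n^'n \<Rightarrow> complex) \<Rightarrow> bool"
  where "local_extension G f g U F \<longleftrightarrow>
    open U \<and> g \<in> U \<and> (\<forall>k. Ck_on k U F) \<and> (\<forall>x\<in>U \<inter> G. f x = F x)"

lemma smooth_functions_iff:
  "f \<in> smooth_functions G \<longleftrightarrow>
    (\<forall>x. x \<notin> G \<longrightarrow> f x = 0) \<and> (\<forall>g\<in>G. \<exists>U F. local_extension G f g U F)"
  by (simp add: smooth_functions_def local_extension_def)

lemma smooth_functions_add: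
  assumes "f \<in> smooth_functions G" "f' \<in> smooth_functions G"
  shows "f + f' \<in> smooth_functions G"
  unfolding smooth_functions_iff
proof (intro conjI allI impI ballI)
  fix g assume "g \<in> G"
  then obtain U F U' F' where ext: "local_extension G f g U F" "local_extension G f' g U' F'"
    using assms unfolding smooth_functions_iff by blast
  have "Ck_on k (U \<inter> U') (\<lambda>x. F x + F' x)" for k
    using ext unfolding local_extension_def by (intro Ck_on_add) (auto intro: Ck_on_subset)
  then have "local_extension G (f + f') g (U \<inter> U') (\<lambda>x. F x + F' x)"
    using ext by (auto simp: local_extension_def)
  then show "\<exists>U F. local_extension G (f + f') g U F" by blast
qed (use assms in \<open>auto simp: smooth_functions_iff\<close>)

lemma local_extension_scale:
  assumes "local_extension G f g U F"
  shows "local_extension G (fscale c f) g U (\<lambda>x. c * F x)"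
  using assms unfolding local_extension_def fscale_def
  by (auto intro!: Ck_on_compose_linear[OF _ bounded_linear_mult_right])

lemma smooth_functions_scale:
  assumes "f \<in> smooth_functions G"
  shows "fscale c f \<in> smooth_functions G"
  using assms local_extension_scale unfolding smooth_functions_iff
  by (fastforce simp: fscale_def)

lemma smooth_functions_zero: "0 \<in> smooth_functions G"
  unfolding smooth_functions_iff local_extension_def
  by (auto intro!: exI[of _ UNIV] exI[of _ "\<lambda>x. 0"] Ck_on_const)

definition flow_derivative :: "('a \<Rightarrow> real \<Rightarrow> 'a) \<Rightarrow> ('a \<Rightarrow> complex) \<Rightarrow> 'a \<Rightarrow> complex" where
  "flow_derivative \<gamma> f x = vector_derivative (\<lambda>t. f (\<gamma> x t)) (at 0)"

text \<open>Of each curve only the velocity at t = 0 is prescribed. Membership in \<open>G\<close>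
  is preserved in both directions because functions vanish off \<open>G\<close> and their
  derivatives have to vanish there too.\<close>

locale flow_field =
  fixes G :: "(real^'n^'n) set" and A :: "real^'n^'n \<Rightarrow> real^'n^'n"
    and \<gamma> :: "real^'n^'n \<Rightarrow> real \<Rightarrow> real^'n^'n"
  assumes linear: "bounded_linear A"
    and flow_mem: "\<gamma> x t \<in> G \<longleftrightarrow> x \<in> G"
    and flow_0: "\<gamma> x 0 = x"
    and flow_deriv: "(\<gamma> x has_vector_derivative A x) (at 0)"
begin

text \<open>The curve remains in \<open>G\<close> and, for small t, in \<open>U\<close>, where f and
  F agree. So the derivative can be read off any local extension and depends on the curve through
  its velocity only.\<close>

lemma flow_derivative_eq:
  assumes "x \<in> G" and ext: "local_extension G f x U F"
  shows "flow_derivative \<gamma> f x = frechet_derivative F (at x) (A x)"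
proof -
  have U: "open U" "x \<in> U" and F: "F differentiable (at x)" and fF: "\<And>y. y \<in> U \<Longrightarrow> y \<in> G \<Longrightarrow> f y = F y"
    using ext unfolding local_extension_def by (auto dest: spec[of _ "Suc 0"])
  have "(F has_derivative frechet_derivative F (at x)) (at (\<gamma> x 0))"
    using has_derivative_frechet[OF F] by (simp add: flow_0)
  then have "((\<lambda>t. F (\<gamma> x t)) has_derivative (\<lambda>t. frechet_derivative F (at x) (t *\<^sub>R A x))) (at 0)"
    by (rule has_derivative_compose[OF flow_deriv[of x, unfolded has_vector_derivative_def]])
  moreover have "\<forall>\<^sub>F t in at 0. F (\<gamma> x t) = f (\<gamma> x t)"
  proof -
    have "isCont (\<gamma> x) 0"
      by (rule has_vector_derivative_continuous[OF flow_deriv])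
    then have "\<forall>\<^sub>F t in at 0. \<gamma> x t \<in> U"
      using U topological_tendstoD[of "\<gamma> x" "\<gamma> x 0" "at 0" U] by (simp add: isCont_def flow_0)
    then show ?thesis
      by eventually_elim (use fF flow_mem assms in auto)
  qed
  ultimately have "((\<lambda>t. f (\<gamma> x t)) has_derivative (\<lambda>t. frechet_derivative F (at x) (t *\<^sub>R A x))) (at 0)"
    by (rule has_derivative_transform_eventually) (use fF U assms flow_0 in auto)
  then have "((\<lambda>t. f (\<gamma> x t)) has_vector_derivative frechet_derivative F (at x) (A x)) (at 0)"
    using linear_frechet_derivative[OF F] by (simp add: has_vector_derivative_def linear_scale)
  then show ?thesis
    unfolding flow_derivative_def by (rule vector_derivative_at)
qed

lemma flow_derivative_off:
  assumes "x \<notin> G" "\<And>y. y \<notin> G \<Longrightarrow> f y = 0"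
  shows "flow_derivative \<gamma> f x = 0"
proof -
  have "(\<lambda>t. f (\<gamma> x t)) = (\<lambda>t. 0)"
    using assms flow_mem by auto
  then show ?thesis
    by (simp add: flow_derivative_def)
qed

lemma local_extension_flow:
  assumes "local_extension G f g U F"
  shows "local_extension G (flow_derivative \<gamma> f) g U (\<lambda>x. frechet_derivative F (at x) (A x))"
  unfolding local_extension_def
proof (intro conjI allI ballI)
  fix k
  show "Ck_on k U (\<lambda>x. frechet_derivative F (at x) (A x))"
    using assms linear unfolding local_extension_def by (intro Ck_on_vector_field_derivative) auto
next
  fix x assume x: "x \<in> U \<inter> G"
  then have "local_extension G f x U F"
    using assms by (auto simp: local_extension_def)
  then show "flow_derivative \<gamma> f x = frechet_derivative F (at x) (A x)"
    using x by (intro flow_derivative_eq) auto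
qed (use assms in \<open>auto simp: local_extension_def\<close>)

lemma flow_derivative_smooth:
  assumes "f \<in> smooth_functions G"
  shows "flow_derivative \<gamma> f \<in> smooth_functions G"
  using assms local_extension_flow flow_derivative_off unfolding smooth_functions_iff by blast

lemma flow_derivative_scale:
  assumes f: "f \<in> smooth_functions G"
  shows "flow_derivative \<gamma> (fscale c f) = fscale c (flow_derivative \<gamma> f)"
proof
  fix x
  show "flow_derivative \<gamma> (fscale c f) x = fscale c (flow_derivative \<gamma> f) x"
  proof (cases "x \<in> G")
    case True
    then obtain U F where ext: "local_extension G f x U F"
      using f smooth_functions_iff by blast
    then have F: "(F has_derivative frechet_derivative F (at x)) (at x)"
      unfolding local_extension_def using Ck_on_derivative by blast
    have "frechet_derivative (\<lambda>x. c * F x) (at x) = (\<lambda>v. c * frechet_derivative F (at x) v)"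
      by (rule frechet_derivative_eq) (intro has_derivative_mult_right F)
    then show ?thesis
      using flow_derivative_eq[OF True local_extension_scale[OF ext]] flow_derivative_eq[OF True ext]
      by (simp add: fscale_def)
  next
    case False
    then show ?thesis
      using f flow_derivative_off[OF False] by (simp add: smooth_functions_iff fscale_def)
  qed
qed

lemma flow_derivative_add:
  assumes f: "f \<in> smooth_functions G" and f': "f' \<in> smooth_functions G"
  shows "flow_derivative \<gamma> (f + f') = flow_derivative \<gamma> f + flow_derivative \<gamma> f'"
proof
  fix x
  show "flow_derivative \<gamma> (f + f') x = (flow_derivative \<gamma> f + flow_derivative \<gamma> f') x"
  proof (cases "x \<in> G")
    case True
    then obtain U F where "local_extension G f x U F"
      using f smooth_functions_iff by blast
    moreover from True obtain U' F' where "local_extension G f' x U' F'"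
      using f' smooth_functions_iff by blast
    ultimately have ext: "local_extension G f x U F" "local_extension G f' x U' F'"
      by simp_all
    then have F: "(F has_derivative frechet_derivative F (at x)) (at x)"
       "(F' has_derivative frechet_derivative F' (at x)) (at x)"
      unfolding local_extension_def using Ck_on_derivative by blast+
    have "frechet_derivative (\<lambda>x. F x + F' x) (at x) =
        (\<lambda>v. frechet_derivative F (at x) v + frechet_derivative F' (at x) v)"
      by (rule frechet_derivative_eq) (intro has_derivative_add F)
    moreover have "Ck_on k (U \<inter> U') (\<lambda>x. F x + F' x)" for k
      using ext unfolding local_extension_def by (intro Ck_on_add) (auto intro: Ck_on_subset)
    then have "local_extension G (f + f') x (U \<inter> U') (\<lambda>x. F x + F' x)"
      using ext by (auto simp: local_extension_def)
    ultimately show ?thesis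
      using flow_derivative_eq[OF True] ext by (simp add: plus_fun_def)
  next
    case False
    then show ?thesis
      using f f' flow_derivative_off[OF False] by (simp add: smooth_functions_iff)
  qed
qed

end

text \<open>At a point of \<open>G\<close> a flow derivative is linear in the velocity, so a linear
  relation between the fields carries over; off \<open>G\<close> both sides are 0.\<close>

lemma flow_derivative_linear:
  assumes "flow_field G A \<alpha>" "flow_field G B \<beta>" "flow_field G C \<gamma>"
    and C: "\<And>x. x \<in> G \<Longrightarrow> C x = r *\<^sub>R A x + s *\<^sub>R B x" and f: "f \<in> smooth_functions G"
  shows "flow_derivative \<gamma> f = fscale (of_real r) (flow_derivative \<alpha> f) + fscale (of_real s) (flow_derivative \<beta> f)"
proof
  interpret A: flow_field G A \<alpha> by fact
  interpret B: flow_field G B \<beta> by fact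
  interpret C: flow_field G C \<gamma> by fact
  fix x
  show "flow_derivative \<gamma> f x =
      (fscale (of_real r) (flow_derivative \<alpha> f) + fscale (of_real s) (flow_derivative \<beta> f)) x"
  proof (cases "x \<in> G")
    case True
    then obtain U F where ext: "local_extension G f x U F"
      using f smooth_functions_iff by blast
    then have "F differentiable (at x)"
      unfolding local_extension_def by (auto dest: spec[of _ "Suc 0"])
    then have lin: "linear (frechet_derivative F (at x))"
      by (rule linear_frechet_derivative)
    have "flow_derivative \<gamma> f x =
        r *\<^sub>R frechet_derivative F (at x) (A x) + s *\<^sub>R frechet_derivative F (at x) (B x)"
      by (simp add: C.flow_derivative_eq[OF True ext] C[OF True] linear_add[OF lin] linear_scale[OF lin])
    then show ?thesis
      by (simp add: A.flow_derivative_eq[OF True ext] B.flow_derivative_eq[OF True ext] fscale_def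
          scaleR_conv_of_real)
  next
    case False
    then show ?thesis
      using f by (simp add: A.flow_derivative_off B.flow_derivative_off C.flow_derivative_off
          smooth_functions_iff fscale_def)
  qed
qed

text \<open>Product rule for a derivative whose direction varies linearly. Symmetry moves
  \<open>B x\<close> to the outer direction, so that in a commutator the second-order terms match
  up.\<close>

lemma frechet_derivative_vector_field:
  fixes F :: "'a::euclidean_space \<Rightarrow> 'b::banach"
  assumes U: "open U" "x \<in> U" and F: "Ck_on 2 U F" and B: "bounded_linear B"
  shows "frechet_derivative (\<lambda>y. frechet_derivative F (at y) (B y)) (at x) w =
    frechet_derivative F (at x) (B w) + frechet_derivative (\<lambda>y. frechet_derivative F (at y) w) (at x) (B x)"
proof -
  have F2: "Ck_on (Suc (Suc 0)) U F" using F by (simp add: numeral_2_eq_2)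
  have dF: "F differentiable (at y)" if "y \<in> U" for y using F2 that by simp
  have dD: "(\<lambda>y. frechet_derivative F (at y) b) differentiable (at x)" for b using F2 U by simp
  let ?H = "\<lambda>y. \<Sum>b\<in>Basis. (B y \<bullet> b) *\<^sub>R frechet_derivative F (at y) b"
  have "frechet_derivative (\<lambda>y. frechet_derivative F (at y) (B y)) (at x) = frechet_derivative ?H (at x)"
    by (rule frechet_derivative_cong_open[OF U]) (rule frechet_derivative_euclidean_sum[OF dF])
  also have "\<dots> = (\<lambda>w. \<Sum>b\<in>Basis. (B x \<bullet> b) *\<^sub>R frechet_derivative (\<lambda>y. frechet_derivative F (at y) b) (at x) w
        + (B w \<bullet> b) *\<^sub>R frechet_derivative F (at x) b)"
  proof (rule frechet_derivative_eq, intro has_derivative_sum has_derivative_scaleR)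
    fix b
    show "((\<lambda>y. frechet_derivative F (at y) b) has_derivative
        frechet_derivative (\<lambda>y. frechet_derivative F (at y) b) (at x)) (at x)"
      by (rule has_derivative_frechet[OF dD])
    show "((\<lambda>y. B y \<bullet> b) has_derivative (\<lambda>w. B w \<bullet> b)) (at x)"
      by (intro has_derivative_inner_left bounded_linear_imp_has_derivative B)
  qed
  finally have "frechet_derivative (\<lambda>y. frechet_derivative F (at y) (B y)) (at x) w =
      (\<Sum>b\<in>Basis. (B x \<bullet> b) *\<^sub>R frechet_derivative (\<lambda>y. frechet_derivative F (at y) w) (at x) b)
        + (\<Sum>b\<in>Basis. (B w \<bullet> b) *\<^sub>R frechet_derivative F (at x) b)"
    using second_derivative_symmetric[OF U F] by (simp add: sum.distrib)
  then show ?thesis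
    using frechet_derivative_euclidean_sum[OF dF[OF U(2)], of "B w"]
      frechet_derivative_euclidean_sum[OF dD, of w "B x"] by simp
qed

text \<open>The second-order terms cancel by symmetry and the first-order terms leave F'(B A x - A B
  x). The order of A and B is that of derivations along linear fields: for x |-> xX and x |-> xY it
  gives x [X, Y].\<close>

lemma flow_derivative_commutator:
  assumes "flow_field G A \<alpha>" "flow_field G B \<beta>" "flow_field G C \<gamma>"
    and C: "\<And>x. x \<in> G \<Longrightarrow> C x = B (A x) - A (B x)" and f: "f \<in> smooth_functions G"
  shows "flow_derivative \<gamma> f =
    flow_derivative \<alpha> (flow_derivative \<beta> f) - flow_derivative \<beta> (flow_derivative \<alpha> f)"
proof
  interpret A: flow_field G A \<alpha> by fact
  interpret B: flow_field G B \<beta> by fact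
  interpret C: flow_field G C \<gamma> by fact
  fix x
  show "flow_derivative \<gamma> f x =
      (flow_derivative \<alpha> (flow_derivative \<beta> f) - flow_derivative \<beta> (flow_derivative \<alpha> f)) x"
  proof (cases "x \<in> G")
    case True
    then obtain U F where ext: "local_extension G f x U F"
      using f smooth_functions_iff by blast
    then have U: "open U" "x \<in> U" and F: "\<And>k. Ck_on k U F"
      by (auto simp: local_extension_def)
    have "F differentiable (at x)"
      using F[of "Suc 0"] U by simp
    then have lin: "linear (frechet_derivative F (at x))"
      by (rule linear_frechet_derivative)
    have 1: "flow_derivative \<alpha> (flow_derivative \<beta> f) x = frechet_derivative F (at x) (B (A x)) +
         frechet_derivative (\<lambda>y. frechet_derivative F (at y) (A x)) (at x) (B x)"
      using A.flow_derivative_eq[OF True B.local_extension_flow[OF ext]]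
        frechet_derivative_vector_field[OF U F B.linear] by simp
    have 2: "flow_derivative \<beta> (flow_derivative \<alpha> f) x = frechet_derivative F (at x) (A (B x)) +
         frechet_derivative (\<lambda>y. frechet_derivative F (at y) (B x)) (at x) (A x)"
      using B.flow_derivative_eq[OF True A.local_extension_flow[OF ext]]
        frechet_derivative_vector_field[OF U F A.linear] by simp
    have 3: "frechet_derivative (\<lambda>y. frechet_derivative F (at y) (A x)) (at x) (B x) =
        frechet_derivative (\<lambda>y. frechet_derivative F (at y) (B x)) (at x) (A x)"
      by (rule second_derivative_symmetric[OF U F])
    show ?thesis
      using 1 2 3 C.flow_derivative_eq[OF True ext] by (simp add: C[OF True] linear_diff[OF lin])
  next
    case False
    then show ?thesis
      using f A.flow_derivative_off[OF False, of "flow_derivative \<beta> f"] C.flow_derivative_off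
        B.flow_derivative_off[OF False, of "flow_derivative \<alpha> f"]
        A.flow_derivative_off B.flow_derivative_off by (simp add: smooth_functions_iff)
  qed
qed

section \<open>Differential operators of left and right translation\<close>

context closed_linear_group
begin

lemma flow_field_right:
  assumes X: "X \<in> lie_algebra G"
  shows "flow_field G (\<lambda>x. x ** X) (\<lambda>x t. x ** mexp (t *\<^sub>R X))"
proof (rule flow_field.intro)
  show "bounded_linear (\<lambda>x :: real^'n^'n. x ** X)"
    by (rule bounded_bilinear.bounded_linear_left[OF bounded_bilinear_matrix_mult])
  fix x :: "real^'n^'n" and t :: real
  show "x ** mexp (t *\<^sub>R X) \<in> G \<longleftrightarrow> x \<in> G"
    by (rule mult_mem_cancel_right[OF mexp_mem[OF X]])
  show "((\<lambda>t. x ** mexp (t *\<^sub>R X)) has_vector_derivative x ** X) (at 0)"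
    by (rule bounded_linear.has_vector_derivative[OF
          bounded_bilinear.bounded_linear_right[OF bounded_bilinear_matrix_mult]
          mexp_has_vector_derivative])
qed simp

lemma flow_field_left:
  assumes X: "X \<in> lie_algebra G"
  shows "flow_field G (\<lambda>x. (- X) ** x) (\<lambda>x t. mexp ((- t) *\<^sub>R X) ** x)"
proof (rule flow_field.intro)
  show "bounded_linear (\<lambda>x :: real^'n^'n. (- X) ** x)"
    by (rule bounded_bilinear.bounded_linear_right[OF bounded_bilinear_matrix_mult])
  fix x :: "real^'n^'n" and t :: real
  show "mexp ((- t) *\<^sub>R X) ** x \<in> G \<longleftrightarrow> x \<in> G"
    by (rule mult_mem_cancel_left[OF mexp_mem[OF X]])
  have "((\<lambda>t. mexp (t *\<^sub>R (- X)) ** x) has_vector_derivative (- X) ** x) (at 0)"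
    by (rule bounded_linear.has_vector_derivative[OF
          bounded_bilinear.bounded_linear_left[OF bounded_bilinear_matrix_mult]
          mexp_has_vector_derivative])
  then show "((\<lambda>t. mexp ((- t) *\<^sub>R X) ** x) has_vector_derivative (- X) ** x) (at 0)"
    by simp
qed simp

lemma R_real_flow: "R_real X = flow_derivative (\<lambda>x t. x ** mexp (t *\<^sub>R X))"
  by (intro ext) (simp add: R_real_def flow_derivative_def)

lemma L_real_flow: "L_real X = flow_derivative (\<lambda>x t. mexp ((- t) *\<^sub>R X) ** x)"
  by (intro ext) (simp add: L_real_def flow_derivative_def)

lemma complexify_flow_rep:
  fixes A :: "real^'n^'n \<Rightarrow> real^'n^'n \<Rightarrow> real^'n^'n"
  assumes sub: "subspace \<gg>" and br: "\<And>X Y. X \<in> \<gg> \<Longrightarrow> Y \<in> \<gg> \<Longrightarrow> bracket X Y \<in> \<gg>"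
    and field: "\<And>X. X \<in> \<gg> \<Longrightarrow> flow_field G (A X) (\<gamma> X)"
    and lin: "\<And>X Y r s x. A (r *\<^sub>R X + s *\<^sub>R Y) x = r *\<^sub>R A X x + s *\<^sub>R A Y x"
    and comm: "\<And>X Y x. A (bracket X Y) x = A Y (A X x) - A X (A Y x)"
  shows "lie_rep (complexification \<gg>)
    (\<lambda>Z f. flow_derivative (\<gamma> (map_matrix Re Z)) f + fscale \<i> (flow_derivative (\<gamma> (map_matrix Im Z)) f))
    (smooth_functions G)"
proof (rule complexify_rep)
  fix X Y f r
  assume X: "X \<in> \<gg>" and f: "f \<in> smooth_functions G"
  have rX: "r *\<^sub>R X \<in> \<gg>" using X sub subspace_mul by blast
  have "flow_derivative (\<gamma> (r *\<^sub>R X)) f =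
     fscale (of_real r) (flow_derivative (\<gamma> X) f) + fscale (of_real 0) (flow_derivative (\<gamma> X) f)"
    by (rule flow_derivative_linear[OF field[OF X] field[OF X] field[OF rX] _ f])
      (use lin[of r X 0 X] in simp)
  then show "flow_derivative (\<gamma> (r *\<^sub>R X)) f = fscale (of_real r) (flow_derivative (\<gamma> X) f)"
    by (simp add: fun_eq_iff fscale_def)
  assume Y: "Y \<in> \<gg>"
  have XY: "X + Y \<in> \<gg>" using X Y sub subspace_add by blast
  have "flow_derivative (\<gamma> (X + Y)) f =
     fscale (of_real 1) (flow_derivative (\<gamma> X) f) + fscale (of_real 1) (flow_derivative (\<gamma> Y) f)"
    by (rule flow_derivative_linear[OF field[OF X] field[OF Y] field[OF XY] _ f])
      (use lin[of 1 X 1 Y] in simp)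
  then show "flow_derivative (\<gamma> (X + Y)) f = flow_derivative (\<gamma> X) f + flow_derivative (\<gamma> Y) f"
    by (simp add: fun_eq_iff fscale_def)
  show "flow_derivative (\<gamma> (bracket X Y)) f =
     flow_derivative (\<gamma> X) (flow_derivative (\<gamma> Y) f) - flow_derivative (\<gamma> Y) (flow_derivative (\<gamma> X) f)"
    by (rule flow_derivative_commutator[OF field[OF X] field[OF Y] field[OF br[OF X Y]] _ f]) (rule comm)
next
  fix X f g and c :: complex
  assume X: "X \<in> \<gg>" and f: "f \<in> smooth_functions G"
  show "flow_derivative (\<gamma> X) f \<in> smooth_functions G"
    by (rule flow_field.flow_derivative_smooth[OF field[OF X] f])
  show "flow_derivative (\<gamma> X) (fscale c f) = fscale c (flow_derivative (\<gamma> X) f)"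
    by (rule flow_field.flow_derivative_scale[OF field[OF X] f])
  assume g: "g \<in> smooth_functions G"
  show "flow_derivative (\<gamma> X) (f + g) = flow_derivative (\<gamma> X) f + flow_derivative (\<gamma> X) g"
    by (rule flow_field.flow_derivative_add[OF field[OF X] f g])
next
  show "subspace \<gg>" by fact
next
  fix X Y assume "X \<in> \<gg>" "Y \<in> \<gg>" then show "bracket X Y \<in> \<gg>" by (rule br)
next
  fix f g :: "real^'n^'n \<Rightarrow> complex" and c :: complex
  assume f: "f \<in> smooth_functions G"
  then show "fscale c f \<in> smooth_functions G"
    by (rule smooth_functions_scale)
  assume "g \<in> smooth_functions G"
  with f show "f + g \<in> smooth_functions G"
    by (rule smooth_functions_add)
qed

lemma lie_rep_R:
  assumes "subspace \<gg>" "\<And>X Y. X \<in> \<gg> \<Longrightarrow> Y \<in> \<gg> \<Longrightarrow> bracket X Y \<in> \<gg>" "\<gg> \<subseteq> lie_algebra G"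
  shows "lie_rep (complexification \<gg>) R_lie (smooth_functions G)"
proof -
  have R: "R_lie = (\<lambda>Z f. flow_derivative (\<lambda>x t. x ** mexp (t *\<^sub>R map_matrix Re Z)) f +
      fscale \<i> (flow_derivative (\<lambda>x t. x ** mexp (t *\<^sub>R map_matrix Im Z)) f))"
    by (intro ext) (simp add: R_lie_def fscale_def R_real_flow)
  show ?thesis
    unfolding R
  proof (rule complexify_flow_rep[where A="\<lambda>X x. x ** X" and \<gamma>="\<lambda>X x t. x ** mexp (t *\<^sub>R X)"])
    fix X Y x :: "real^'n^'n" and r s :: real
    show "x ** (r *\<^sub>R X + s *\<^sub>R Y) = r *\<^sub>R (x ** X) + s *\<^sub>R (x ** Y)"
      by (simp add: matrix_add_ldistrib matrix_scalar_ac scalar_matrix_assoc)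
    show "x ** bracket X Y = x ** X ** Y - x ** Y ** X"
      by (simp add: bracket_def matrix_mul_assoc bounded_bilinear.diff_right[OF bounded_bilinear_matrix_mult])
    next
    fix X assume "X \<in> \<gg>"
    then show "flow_field G (\<lambda>x. x ** X) (\<lambda>x t. x ** mexp (t *\<^sub>R X))"
      using assms(3) by (intro flow_field_right) blast
  qed (use assms(1,2) in simp_all)
qed

text \<open>The subalgebra is a parameter, so that the Lie algebra of the smaller group can act on
  functions on the larger one.\<close>

lemma lie_rep_L:
  assumes "subspace \<gg>" "\<And>X Y. X \<in> \<gg> \<Longrightarrow> Y \<in> \<gg> \<Longrightarrow> bracket X Y \<in> \<gg>" "\<gg> \<subseteq> lie_algebra G"
  shows "lie_rep (complexification \<gg>) L_lie (smooth_functions G)"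
proof -
  have L: "L_lie = (\<lambda>Z f. flow_derivative (\<lambda>x t. mexp ((- t) *\<^sub>R map_matrix Re Z) ** x) f +
      fscale \<i> (flow_derivative (\<lambda>x t. mexp ((- t) *\<^sub>R map_matrix Im Z) ** x) f))"
    by (intro ext) (simp add: L_lie_def fscale_def L_real_flow)
  have neg: "(- X) ** x = - (X ** x)" for X x :: "real^'n^'n"
    by (rule bounded_bilinear.minus_left[OF bounded_bilinear_matrix_mult])
  have neg': "X ** (- x) = - (X ** x)" for X x :: "real^'n^'n"
    by (rule bounded_bilinear.minus_right[OF bounded_bilinear_matrix_mult])
  show ?thesis
    unfolding L
  proof (rule complexify_flow_rep[where A="\<lambda>X x. (- X) ** x" and \<gamma>="\<lambda>X x t. mexp ((- t) *\<^sub>R X) ** x"])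
    fix X Y x :: "real^'n^'n" and r s :: real
    show "- (r *\<^sub>R X + s *\<^sub>R Y) ** x = r *\<^sub>R ((- X) ** x) + s *\<^sub>R ((- Y) ** x)"
      by (simp only: neg matrix_mult_add_left scalar_matrix_assoc[symmetric] scaleR_minus_right minus_add_distrib)
    show "- bracket X Y ** x = - Y ** (- X ** x) - - X ** (- Y ** x)"
      by (simp add: neg neg' bracket_def matrix_mul_assoc bounded_bilinear.diff_left[OF bounded_bilinear_matrix_mult])
    next
    fix X assume "X \<in> \<gg>"
    then show "flow_field G (\<lambda>x. (- X) ** x) (\<lambda>x t. mexp ((- t) *\<^sub>R X) ** x)"
      using assms(3) by (intro flow_field_left) blast
  qed (use assms(1,2) in simp_all)
qed

end

section \<open>The free algebra\<close>

text \<open>The product of \<open>free_alg\<close>, which is the same for every alphabet; as a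
  constant of its own it can be used across different alphabets.\<close>

definition fmul :: "('a list \<Rightarrow> complex) \<Rightarrow> ('a list \<Rightarrow> complex) \<Rightarrow> 'a list \<Rightarrow> complex" where
  "fmul u v w = (\<Sum>k\<le>length w. u (take k w) * v (drop k w))"

text \<open>A linear functional on the free algebra is the same as an arbitrary function \<open>\<alpha>\<close> on words.\<close>
definition pairing :: "('a \<Rightarrow> complex) \<Rightarrow> ('a \<Rightarrow> complex) \<Rightarrow> complex" where
  "pairing u \<alpha> = (\<Sum>w | u w \<noteq> 0. u w * \<alpha> w)"

abbreviation finsupp :: "('a \<Rightarrow> complex) \<Rightarrow> bool" where
  "finsupp u \<equiv> finite {w. u w \<noteq> 0}"

lemma sum_fun_apply: "(\<Sum>i\<in>I. f i) x = (\<Sum>i\<in>I. f i x)" for f :: "'i \<Rightarrow> 'a \<Rightarrow> complex"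
  by (induction I rule: infinite_finite_induct) auto

lemma pairing_superset: "finite A \<Longrightarrow> {w. u w \<noteq> 0} \<subseteq> A \<Longrightarrow> pairing u \<alpha> = (\<Sum>w\<in>A. u w * \<alpha> w)"
  unfolding pairing_def by (rule sum.mono_neutral_left) auto

lemma finsupp_add: "finsupp u \<Longrightarrow> finsupp v \<Longrightarrow> finsupp (u + v)"
  by (rule finite_subset[of _ "{w. u w \<noteq> 0} \<union> {w. v w \<noteq> 0}"]) auto

lemma finsupp_diff: "finsupp u \<Longrightarrow> finsupp v \<Longrightarrow> finsupp (u - v)"
  by (rule finite_subset[of _ "{w. u w \<noteq> 0} \<union> {w. v w \<noteq> 0}"]) auto

lemma finsupp_scale: "finsupp u \<Longrightarrow> finsupp (fscale c u)"
  by (rule finite_subset[of _ "{w. u w \<noteq> 0}"]) (auto simp: fscale_def)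

lemma finsupp_word: "finsupp (word_ind v)"
  by (rule finite_subset[of _ "{v}"]) (auto simp: word_ind_def)

lemma pairing_zero [simp]: "pairing 0 \<alpha> = 0"
  by (simp add: pairing_def)

lemma pairing_add:
  assumes "finsupp u" "finsupp v"
  shows "pairing (u + v) \<alpha> = pairing u \<alpha> + pairing v \<alpha>"
proof -
  let ?A = "{w. u w \<noteq> 0} \<union> {w. v w \<noteq> 0}"
  have "pairing (u + v) \<alpha> = (\<Sum>w\<in>?A. (u + v) w * \<alpha> w)"
    by (rule pairing_superset) (use assms in auto)
  also have "\<dots> = (\<Sum>w\<in>?A. u w * \<alpha> w) + (\<Sum>w\<in>?A. v w * \<alpha> w)"
    by (simp add: distrib_right sum.distrib)
  also have "(\<Sum>w\<in>?A. u w * \<alpha> w) = pairing u \<alpha>"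
    by (rule pairing_superset[symmetric]) (use assms in auto)
  also have "(\<Sum>w\<in>?A. v w * \<alpha> w) = pairing v \<alpha>"
    by (rule pairing_superset[symmetric]) (use assms in auto)
  finally show ?thesis .
qed

lemma pairing_scale: "pairing (fscale c u) \<alpha> = c * pairing u \<alpha>"
  by (cases "c = 0") (auto simp: pairing_def fscale_def sum_distrib_left mult.assoc)

lemma pairing_diff:
  assumes "finsupp u" "finsupp v"
  shows "pairing (u - v) \<alpha> = pairing u \<alpha> - pairing v \<alpha>"
proof -
  have eq: "u - v = u + fscale (-1) v"
    by (auto simp: fscale_def)
  show ?thesis
    unfolding eq using pairing_add[OF assms(1) finsupp_scale[OF assms(2)]] by (simp add: pairing_scale)
qed

lemma pairing_word [simp]: "pairing (word_ind v) \<alpha> = \<alpha> v"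
  by (subst pairing_superset[of "{v}"]) (auto simp: word_ind_def)

lemma pairing_delta: "finsupp u \<Longrightarrow> pairing u (\<lambda>v. if v = w then 1 else 0) = u w"
  by (auto simp: pairing_def if_distrib cong: if_cong)

text \<open>Identities between finitely supported elements are proved by duality: pairing with a
  functional turns products and letter substitutions into changes of the argument
  (\<open>pairing_fmul\<close>, \<open>pairing_push\<close>), so convolution sums need not be
  rearranged again.\<close>

lemma pairing_ext:
  "finsupp u \<Longrightarrow> finsupp v \<Longrightarrow> (\<And>\<alpha>. pairing u \<alpha> = pairing v \<alpha>) \<Longrightarrow> u = v"
  using pairing_delta by (metis ext)

lemma pairing_mult_right: "pairing u (\<lambda>w. c * \<alpha> w) = c * pairing u \<alpha>"
  by (simp add: pairing_def sum_distrib_left mult_ac)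

lemma pairing_add_right: "pairing u (\<lambda>w. \<alpha> w + \<beta> w) = pairing u \<alpha> + pairing u \<beta>"
  by (simp add: pairing_def distrib_left sum.distrib)

lemma pairing_cong: "(\<And>w. u w \<noteq> 0 \<Longrightarrow> \<alpha> w = \<beta> w) \<Longrightarrow> pairing u \<alpha> = pairing u \<beta>"
  by (auto simp: pairing_def intro: sum.cong)

lemma finsupp_sum: "(\<And>i. i \<in> I \<Longrightarrow> finsupp (u i)) \<Longrightarrow> finsupp (\<Sum>i\<in>I. u i)"
  by (induction I rule: infinite_finite_induct) (auto intro: finsupp_add simp del: plus_fun_apply)

lemma pairing_sum:
  "(\<And>i. i \<in> I \<Longrightarrow> finsupp (u i)) \<Longrightarrow> pairing (\<Sum>i\<in>I. u i) \<alpha> = (\<Sum>i\<in>I. pairing (u i) \<alpha>)"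
  by (induction I rule: infinite_finite_induct) (auto simp: pairing_add finsupp_sum simp del: plus_fun_apply)

lemma word_expansion:
  assumes "finsupp u"
  shows "u = (\<Sum>w | u w \<noteq> 0. fscale (u w) (word_ind w))"
proof
  fix v
  have "(\<Sum>w | u w \<noteq> 0. fscale (u w) (word_ind w)) v = (\<Sum>w | u w \<noteq> 0. if v = w then u w else 0)"
    unfolding sum_fun_apply by (rule sum.cong) (auto simp: fscale_def word_ind_def)
  then show "u v = (\<Sum>w | u w \<noteq> 0. fscale (u w) (word_ind w)) v"
    using assms by simp
qed

lemma fmul_nonzero:
  assumes "fmul u v w \<noteq> 0"
  obtains a b where "u a \<noteq> 0" "v b \<noteq> 0" "w = a @ b"
proof -
  obtain k where "u (take k w) * v (drop k w) \<noteq> 0"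
    using assms sum.not_neutral_contains_not_neutral unfolding fmul_def by blast
  then show thesis
    using that[of "take k w" "drop k w"] by auto
qed

lemma finsupp_fmul: "finsupp u \<Longrightarrow> finsupp v \<Longrightarrow> finsupp (fmul u v)"
  by (rule finite_subset[of _ "(\<lambda>(a, b). a @ b) ` ({w. u w \<noteq> 0} \<times> {w. v w \<noteq> 0})"])
    (auto elim!: fmul_nonzero)

text \<open>Cutting w at the positions 0 to \<open>length w\<close> enumerates the pairs (a, b) with
  a @ b = w. Collecting all pairs by their concatenation turns the sum over w into a sum over
  pairs.\<close>

lemma pairing_fmul:
  assumes u: "finsupp u" and v: "finsupp v"
  shows "pairing (fmul u v) \<alpha> = pairing u (\<lambda>a. pairing v (\<lambda>b. \<alpha> (a @ b)))"
proof -
  let ?S = "{w. u w \<noteq> 0} \<times> {w. v w \<noteq> 0}"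
  let ?h = "\<lambda>p. u (fst p) * v (snd p) * \<alpha> (fst p @ snd p)"
  let ?T = "(\<lambda>p. fst p @ snd p) ` ?S"
  have fin: "finite ?S" using u v by simp
  have inner: "fmul u v w * \<alpha> w = (\<Sum>p | p \<in> ?S \<and> fst p @ snd p = w. ?h p)" for w
  proof -
    have bij: "bij_betw (\<lambda>k. (take k w, drop k w)) {..length w} {p. fst p @ snd p = w}"
    proof (rule bij_betwI')
      fix x y assume "x \<in> {..length w}" "y \<in> {..length w}"
      then show "((take x w, drop x w) = (take y w, drop y w)) = (x = y)"
        by (metis atMost_iff length_take min.absorb2 prod.inject)
    next
      fix p assume "p \<in> {p. fst p @ snd p = w}"
      then show "\<exists>x\<in>{..length w}. p = (take x w, drop x w)"
        by (intro bexI[of _ "length (fst p)"]) (auto simp: prod_eq_iff)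
    qed auto
    have "fmul u v w * \<alpha> w = (\<Sum>k\<le>length w. ?h (take k w, drop k w))"
      by (simp add: fmul_def sum_distrib_right)
    also have "\<dots> = (\<Sum>p | fst p @ snd p = w. ?h p)"
      by (rule sum.reindex_bij_betw[OF bij])
    also have "\<dots> = (\<Sum>p | p \<in> ?S \<and> fst p @ snd p = w. ?h p)"
      by (rule sum.mono_neutral_right) (use bij_betw_finite[OF bij] in auto)
    finally show ?thesis .
  qed
  have "w \<in> ?T" if nz: "fmul u v w \<noteq> 0" for w
  proof -
    obtain a b where "u a \<noteq> 0" "v b \<noteq> 0" "w = a @ b"
      using fmul_nonzero[OF nz] .
    then show ?thesis by (intro image_eqI[of _ _ "(a, b)"]) auto
  qed
  then have "pairing (fmul u v) \<alpha> = (\<Sum>w\<in>?T. fmul u v w * \<alpha> w)"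
    by (intro pairing_superset) (use fin in auto)
  also have "\<dots> = (\<Sum>w\<in>?T. \<Sum>p | p \<in> ?S \<and> fst p @ snd p = w. ?h p)"
    by (simp only: inner)
  also have "\<dots> = (\<Sum>p\<in>?S. ?h p)"
    by (rule sum.group) (use fin in auto)
  also have "\<dots> = pairing u (\<lambda>a. pairing v (\<lambda>b. \<alpha> (a @ b)))"
    unfolding pairing_def by (simp add: sum.cartesian_product sum_distrib_left case_prod_beta mult.assoc)
  finally show ?thesis .
qed

lemma fmul_word: "fmul (word_ind a) (word_ind b) = word_ind (a @ b)"
  by (rule pairing_ext) (simp_all add: pairing_fmul finsupp_fmul finsupp_word)

lemma fmul_assoc:
  assumes "finsupp u" "finsupp v" "finsupp x"
  shows "fmul (fmul u v) x = fmul u (fmul v x)"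
  by (rule pairing_ext) (use assms in \<open>simp_all add: pairing_fmul finsupp_fmul\<close>)

lemma fmul_one: "fmul (word_ind []) u = u" "fmul u (word_ind []) = u"
proof -
  have "(\<Sum>k\<le>length w. (if take k w = [] then 1 else 0) * u (drop k w)) = u w" for w
  proof -
    have "(\<Sum>k\<le>length w. (if take k w = [] then 1 else 0) * u (drop k w)) =
        (\<Sum>k\<in>{0}. (if take k w = [] then 1 else 0) * u (drop k w))"
      by (rule sum.mono_neutral_right) auto
    then show ?thesis by simp
  qed
  then show "fmul (word_ind []) u = u"
    by (simp add: fmul_def word_ind_def fun_eq_iff)
  have "(\<Sum>k\<le>length w. u (take k w) * (if drop k w = [] then 1 else 0)) = u w" for w
  proof -
    have "(\<Sum>k\<le>length w. u (take k w) * (if drop k w = [] then 1 else 0)) =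
        (\<Sum>k\<in>{length w}. u (take k w) * (if drop k w = [] then 1 else 0))"
      by (rule sum.mono_neutral_right) auto
    then show ?thesis by simp
  qed
  then show "fmul u (word_ind []) = u"
    by (simp add: fmul_def word_ind_def fun_eq_iff)
qed

lemma fmul_add_left: "fmul (u + v) x = fmul u x + fmul v x"
  by (simp add: fmul_def fun_eq_iff distrib_right sum.distrib)

lemma fmul_add_right: "fmul x (u + v) = fmul x u + fmul x v"
  by (simp add: fmul_def fun_eq_iff distrib_left sum.distrib)

lemma fmul_diff_left: "fmul (u - v) x = fmul u x - fmul v x"
  by (simp add: fmul_def fun_eq_iff left_diff_distrib sum_subtractf)

lemma fmul_diff_right: "fmul x (u - v) = fmul x u - fmul x v"
  by (simp add: fmul_def fun_eq_iff right_diff_distrib sum_subtractf)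

lemma fmul_scale_left: "fmul (fscale c u) x = fscale c (fmul u x)"
  by (simp add: fmul_def fun_eq_iff fscale_def sum_distrib_left mult.assoc)

lemma fmul_scale_right: "fmul x (fscale c u) = fscale c (fmul x u)"
  by (simp add: fmul_def fun_eq_iff fscale_def sum_distrib_left mult_ac)

lemma fmul_zero [simp]: "fmul 0 x = 0" "fmul x 0 = 0" "fmul (\<lambda>w. 0) x = (\<lambda>w. 0)" "fmul x (\<lambda>w. 0) = (\<lambda>w. 0)"
  by (simp_all add: fmul_def fun_eq_iff)

lemma fmul_sum_left: "fmul (\<Sum>i\<in>I. u i) x = (\<Sum>i\<in>I. fmul (u i) x)"
  by (induction I rule: infinite_finite_induct) (auto simp: fmul_add_left simp del: plus_fun_apply)

lemma fmul_sum_right: "fmul x (\<Sum>i\<in>I. u i) = (\<Sum>i\<in>I. fmul x (u i))"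
  by (induction I rule: infinite_finite_induct) (auto simp: fmul_add_right simp del: plus_fun_apply)

section \<open>The free algebra as a ring\<close>

abbreviation FA :: "'a set \<Rightarrow> ('a list \<Rightarrow> complex) set" where
  "FA S \<equiv> carrier (free_alg S)"

lemma FA_iff: "u \<in> FA S \<longleftrightarrow> finsupp u \<and> (\<forall>w. u w \<noteq> 0 \<longrightarrow> set w \<subseteq> S)"
  by (simp add: free_alg_def)

lemma free_alg_simps [simp]:
  "mult (free_alg S) = fmul" "one (free_alg S) = word_ind []"
  "zero (free_alg S) = 0" "add (free_alg S) = (+)"
  by (auto simp: free_alg_def fmul_def word_ind_def fun_eq_iff)

lemma FA_finsupp: "u \<in> FA S \<Longrightarrow> finsupp u"
  by (simp add: FA_iff)

lemma FA_zero: "0 \<in> FA S"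
  by (simp add: FA_iff)

lemma FA_add: "u \<in> FA S \<Longrightarrow> v \<in> FA S \<Longrightarrow> u + v \<in> FA S"
  by (auto simp: FA_iff finsupp_add simp del: plus_fun_apply) (metis add_cancel_left_left plus_fun_apply subsetD)

lemma FA_scale: "u \<in> FA S \<Longrightarrow> fscale c u \<in> FA S"
  using finsupp_scale[of u c] by (auto simp: FA_iff fscale_def)

lemma FA_diff: "u \<in> FA S \<Longrightarrow> v \<in> FA S \<Longrightarrow> u - v \<in> FA S"
  using FA_add[of u S "fscale (-1) v"] FA_scale[of v S "-1"]
  by (simp add: fscale_def fun_diff_def plus_fun_def)

lemma FA_fmul: "u \<in> FA S \<Longrightarrow> v \<in> FA S \<Longrightarrow> fmul u v \<in> FA S"
  unfolding FA_iff using finsupp_fmul fmul_nonzero by (metis Un_least set_append)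

lemma FA_word: "set w \<subseteq> S \<Longrightarrow> word_ind w \<in> FA S"
  by (auto simp: FA_iff finsupp_word) (auto simp: word_ind_def split: if_splits)

lemma FA_sum: "(\<And>i. i \<in> I \<Longrightarrow> u i \<in> FA S) \<Longrightarrow> (\<Sum>i\<in>I. u i) \<in> FA S"
  by (induction I rule: infinite_finite_induct) (auto simp: FA_zero FA_add)

lemma ring_free_alg: "ring (free_alg S)"
proof (rule ringI)
  show "abelian_group (free_alg S)"
  proof (rule abelian_groupI)
    fix u assume u: "u \<in> FA S"
    then have "fscale (-1) u \<in> FA S" by (rule FA_scale)
    then show "\<exists>v\<in>FA S. v \<oplus>\<^bsub>free_alg S\<^esub> u = \<zero>\<^bsub>free_alg S\<^esub>"
      by (intro bexI[of _ "fscale (-1) u"]) (auto simp: fscale_def fun_eq_iff)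
  qed (auto simp: FA_zero FA_add ac_simps)
  show "Group.monoid (free_alg S)"
    by (rule monoidI) (auto simp: FA_fmul FA_word fmul_assoc FA_finsupp fmul_one)
qed (auto simp: fmul_add_left fmul_add_right)

lemma free_alg_minus: "u \<in> FA S \<Longrightarrow> v \<in> FA S \<Longrightarrow> u \<ominus>\<^bsub>free_alg S\<^esub> v = u - v"
proof -
  interpret ring "free_alg S" by (rule ring_free_alg)
  assume u: "u \<in> FA S" and v: "v \<in> FA S"
  have "\<ominus>\<^bsub>free_alg S\<^esub> v = fscale (-1) v"
    by (rule minus_equality) (use v FA_scale[OF v, of "-1"] in \<open>auto simp: fscale_def fun_eq_iff\<close>)
  then show ?thesis
    unfolding a_minus_def by (auto simp: fscale_def fun_eq_iff)
qed

text \<open>Closure under negatives follows from absorption: -u is the product of -1 times the empty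
  word with u.\<close>

lemma free_alg_idealI:
  assumes "J \<subseteq> FA S" "0 \<in> J" "\<And>u v. u \<in> J \<Longrightarrow> v \<in> J \<Longrightarrow> u + v \<in> J"
    and "\<And>u x. u \<in> J \<Longrightarrow> x \<in> FA S \<Longrightarrow> fmul x u \<in> J" "\<And>u x. u \<in> J \<Longrightarrow> x \<in> FA S \<Longrightarrow> fmul u x \<in> J"
  shows "ideal J (free_alg S)"
proof (rule idealI[OF ring_free_alg])
  interpret ring "free_alg S" by (rule ring_free_alg)
  show "subgroup J (add_monoid (free_alg S))"
  proof (rule group.subgroupI[OF a_group])
    fix u assume u: "u \<in> J"
    then have "fmul (fscale (-1) (word_ind [])) u \<in> J"
      by (intro assms FA_scale FA_word) auto
    then have "fscale (-1) u \<in> J"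
      by (simp add: fmul_scale_left fmul_one)
    moreover have "\<ominus>\<^bsub>free_alg S\<^esub> u = fscale (-1) u"
      by (rule minus_equality)
        (use u assms(1) FA_scale[of u S "-1"] in \<open>auto simp: fscale_def fun_eq_iff\<close>)
    ultimately show "inv\<^bsub>add_monoid (free_alg S)\<^esub> u \<in> J"
      by (simp add: a_inv_def)
  qed (use assms in auto)
qed (use assms in auto)

lemma free_alg_ideal_closed:
  assumes "ideal J (free_alg S)"
  shows "u \<in> J \<Longrightarrow> u \<in> FA S" "0 \<in> J" "u \<in> J \<Longrightarrow> v \<in> J \<Longrightarrow> u + v \<in> J"
    and "u \<in> J \<Longrightarrow> x \<in> FA S \<Longrightarrow> fmul x u \<in> J" "u \<in> J \<Longrightarrow> x \<in> FA S \<Longrightarrow> fmul u x \<in> J"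
    and "u \<in> J \<Longrightarrow> fscale c u \<in> J" "u \<in> J \<Longrightarrow> v \<in> J \<Longrightarrow> u - v \<in> J"
proof -
  interpret ideal J "free_alg S" by fact
  show 1: "u \<in> J \<Longrightarrow> u \<in> FA S" and "0 \<in> J" and add: "u \<in> J \<Longrightarrow> v \<in> J \<Longrightarrow> u + v \<in> J" for u v
    using a_subset additive_subgroup.zero_closed[OF additive_subgroup_axioms]
      additive_subgroup.a_closed[OF additive_subgroup_axioms] by auto
  show l: "u \<in> J \<Longrightarrow> x \<in> FA S \<Longrightarrow> fmul x u \<in> J" "u \<in> J \<Longrightarrow> x \<in> FA S \<Longrightarrow> fmul u x \<in> J" for u x
    using I_l_closed I_r_closed by auto
  show sc: "u \<in> J \<Longrightarrow> fscale c u \<in> J" for u c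
    using l(1)[of u "fscale c (word_ind [])"] FA_scale[OF FA_word[of "[]" S], of c]
    by (simp add: fmul_scale_left fmul_one)
  show "u \<in> J \<Longrightarrow> v \<in> J \<Longrightarrow> u - v \<in> J"
    using add[of u "fscale (-1) v"] sc[of v "-1"] by (simp add: fscale_def fun_diff_def plus_fun_def)
qed

subsection \<open>Functoriality\<close>

lemma push_words_nonzero:
  assumes "push_words h u w \<noteq> 0"
  obtains v where "u v \<noteq> 0" "w = map h v"
proof -
  have "{v. u v \<noteq> 0 \<and> map h v = w} \<noteq> {}"
    using assms unfolding push_words_def by (metis sum.empty)
  then show thesis using that by blast
qed

lemma finsupp_push: "finsupp u \<Longrightarrow> finsupp (push_words h u)"
  by (rule finite_subset[of _ "map h ` {w. u w \<noteq> 0}"]) (auto elim!: push_words_nonzero)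

text \<open>\<open>map h\<close> may identify words, so a coefficient of the image is a sum over a
  fibre; regrouping the fibres makes the dual map plain precomposition.\<close>

lemma pairing_push:
  assumes "finsupp u"
  shows "pairing (push_words h u) \<alpha> = pairing u (\<lambda>w. \<alpha> (map h w))"
proof -
  let ?S = "{w. u w \<noteq> 0}"
  have "pairing (push_words h u) \<alpha> = (\<Sum>w\<in>map h ` ?S. push_words h u w * \<alpha> w)"
    by (rule pairing_superset) (use assms in \<open>auto elim!: push_words_nonzero\<close>)
  also have "\<dots> = (\<Sum>w\<in>map h ` ?S. \<Sum>v | v \<in> ?S \<and> map h v = w. u v * \<alpha> (map h v))"
    unfolding push_words_def sum_distrib_right by (intro sum.cong) auto
  also have "\<dots> = (\<Sum>v\<in>?S. u v * \<alpha> (map h v))"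
    by (rule sum.group) (use assms in auto)
  finally show ?thesis by (simp add: pairing_def)
qed

lemma FA_push: "u \<in> FA S \<Longrightarrow> (\<And>X. X \<in> S \<Longrightarrow> h X \<in> T) \<Longrightarrow> push_words h u \<in> FA T"
  unfolding FA_iff by (auto simp: finsupp_push elim!: push_words_nonzero) blast

lemma push_fmul:
  "finsupp u \<Longrightarrow> finsupp v \<Longrightarrow> push_words h (fmul u v) = fmul (push_words h u) (push_words h v)"
  by (rule pairing_ext) (simp_all add: finsupp_fmul finsupp_push pairing_push pairing_fmul)

lemma push_add: "finsupp u \<Longrightarrow> finsupp v \<Longrightarrow> push_words h (u + v) = push_words h u + push_words h v"
  by (rule pairing_ext) (simp_all add: finsupp_add finsupp_push pairing_push pairing_add del: plus_fun_apply)

lemma push_diff: "finsupp u \<Longrightarrow> finsupp v \<Longrightarrow> push_words h (u - v) = push_words h u - push_words h v"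
  by (rule pairing_ext) (simp_all add: finsupp_diff finsupp_push pairing_push pairing_diff del: minus_apply)

lemma push_scale: "finsupp u \<Longrightarrow> push_words h (fscale c u) = fscale c (push_words h u)"
  by (rule pairing_ext) (simp_all add: finsupp_scale finsupp_push pairing_push pairing_scale)

lemma push_word: "push_words h (word_ind w) = word_ind (map h w)"
  by (rule pairing_ext) (simp_all add: finsupp_word finsupp_push pairing_push)

lemma push_push: "finsupp u \<Longrightarrow> push_words h (push_words k u) = push_words (h \<circ> k) u"
  by (rule pairing_ext) (simp_all add: finsupp_push pairing_push)

lemma push_zero [simp]: "push_words h 0 = 0"
  by (auto simp: push_words_def)

lemma push_sum:
  "(\<And>i. i \<in> I \<Longrightarrow> finsupp (u i)) \<Longrightarrow> push_words h (\<Sum>i\<in>I. u i) = (\<Sum>i\<in>I. push_words h (u i))"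
  by (induction I rule: infinite_finite_induct) (auto simp: push_add finsupp_sum simp del: plus_fun_apply)

subsection \<open>Separation of subspaces by functionals\<close>

interpretation fun_vs: vector_space "fscale :: complex \<Rightarrow> ('a \<Rightarrow> complex) \<Rightarrow> 'a \<Rightarrow> complex"
  by unfold_locales (auto simp: fscale_def fun_eq_iff algebra_simps)

interpretation fun_vsp: vector_space_pair "fscale :: complex \<Rightarrow> ('a \<Rightarrow> complex) \<Rightarrow> 'a \<Rightarrow> complex"
    "(*) :: complex \<Rightarrow> complex \<Rightarrow> complex"
  by unfold_locales (auto simp: algebra_simps)

lemma linear_functional_pairing:
  assumes "Vector_Spaces.linear fscale (*) \<phi>" "finsupp u"
  shows "pairing u (\<lambda>w. \<phi> (word_ind w)) = \<phi> u"
proof -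
  have "\<phi> u = \<phi> (\<Sum>w | u w \<noteq> 0. fscale (u w) (word_ind w))"
    by (rule arg_cong[OF word_expansion[OF assms(2)]])
  also have "\<dots> = (\<Sum>w | u w \<noteq> 0. u w * \<phi> (word_ind w))"
    by (simp add: fun_vsp.linear_sum[OF assms(1)] fun_vsp.linear_scale[OF assms(1)])
  finally show ?thesis by (simp add: pairing_def)
qed

text \<open>A functional that is linear on the subspace \<open>W\<close> is extended through a basis
  of \<open>W\<close>. On finitely supported elements a linear functional is determined by its
  values on single words, which yields \<alpha>. Used to extend a character from the invariants to
  the whole algebra.\<close>

lemma extend_functional:
  assumes W: "fun_vs.subspace W"
    and add: "\<And>u v. u \<in> W \<Longrightarrow> v \<in> W \<Longrightarrow> \<phi> (u + v) = \<phi> u + \<phi> v"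
    and scale: "\<And>c u. u \<in> W \<Longrightarrow> \<phi> (fscale c u) = c * \<phi> u"
  obtains \<alpha> :: "'a list \<Rightarrow> complex" where "\<And>u. u \<in> W \<Longrightarrow> finsupp u \<Longrightarrow> pairing u \<alpha> = \<phi> u"
proof -
  obtain B where B: "B \<subseteq> W" "fun_vs.independent B" "W \<subseteq> fun_vs.span B"
    using fun_vs.maximal_independent_subset[of W] by blast
  obtain \<psi> where \<psi>: "Vector_Spaces.linear fscale (*) \<psi>" "\<And>u. u \<in> B \<Longrightarrow> \<psi> u = \<phi> u"
    using fun_vsp.linear_independent_extend[OF B(2), of \<phi>] by blast
  have "u \<in> W \<and> \<psi> u = \<phi> u" if "u \<in> fun_vs.span B" for u
    using that
  proof (induction rule: fun_vs.span_induct_alt)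
    case base
    have "\<phi> 0 = 0"
      using scale[of 0 0] fun_vs.subspace_0[OF W] by (simp add: fscale_def zero_fun_def)
    then show ?case
      using fun_vs.subspace_0[OF W] fun_vsp.linear_0[OF \<psi>(1)] unfolding zero_fun_def by simp
  next
    case (step c x y)
    then have "x \<in> W" "fscale c x \<in> W" using B(1) fun_vs.subspace_scale[OF W] by auto
    moreover have "(\<lambda>a. fscale c x a + y a) = fscale c x + y"
      by auto
    ultimately show ?case
      using step \<psi> B(1) add scale
      by (auto simp: fun_vsp.linear_add[OF \<psi>(1)] fun_vsp.linear_scale[OF \<psi>(1)] fun_vs.subspace_add[OF W])
  qed
  then have "pairing u (\<lambda>w. \<psi> (word_ind w)) = \<phi> u" if "u \<in> W" "finsupp u" for u
    using linear_functional_pairing[OF \<psi>(1) that(2)] that(1) B(3) by auto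
  then show thesis using that by blast
qed

text \<open>Adding x to a basis of \<open>W\<close> keeps it independent, so the values 0 on the
  basis and 1 on x may be prescribed.\<close>

lemma separating_functional:
  assumes W: "fun_vs.subspace W" and x: "x \<notin> W" "finsupp x"
  obtains \<alpha> :: "'a list \<Rightarrow> complex" where
    "\<And>u. u \<in> W \<Longrightarrow> finsupp u \<Longrightarrow> pairing u \<alpha> = 0" "pairing x \<alpha> = 1"
proof -
  obtain B where B: "B \<subseteq> W" "fun_vs.independent B" "W \<subseteq> fun_vs.span B"
    using fun_vs.maximal_independent_subset[of W] by blast
  have "fun_vs.span B \<subseteq> W"
    using B(1) W fun_vs.span_minimal by blast
  then have "x \<notin> fun_vs.span B" using x(1) by blast
  then have ind: "fun_vs.independent (insert x B)"
    using B(2) by (simp add: fun_vs.independent_insert)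
  obtain \<psi> where \<psi>: "Vector_Spaces.linear fscale (*) \<psi>"
      "\<And>u. u \<in> insert x B \<Longrightarrow> \<psi> u = (if u = x then 1 else 0)"
    using fun_vsp.linear_independent_extend[OF ind, of "\<lambda>u. if u = x then 1 else 0"] by blast
  have "\<psi> u = 0" if "u \<in> fun_vs.span B" for u
    by (rule fun_vsp.linear_eq_0_on_span[OF \<psi>(1) _ that]) (use \<psi>(2) B(1) x(1) in auto)
  then have "pairing u (\<lambda>w. \<psi> (word_ind w)) = 0" if "u \<in> W" "finsupp u" for u
    using linear_functional_pairing[OF \<psi>(1) that(2)] that(1) B(3) by auto
  moreover have "pairing x (\<lambda>w. \<psi> (word_ind w)) = 1"
    using linear_functional_pairing[OF \<psi>(1) x(2)] \<psi>(2) by auto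
  ultimately show thesis using that by blast
qed

lemma subspace_ideal: "ideal J (free_alg S) \<Longrightarrow> fun_vs.subspace J"
  by (rule fun_vs.subspaceI) (auto intro: free_alg_ideal_closed)

section \<open>Enveloping algebras\<close>

locale lie_subalg =
  fixes L :: "(complex^'n^'n) set"
  assumes zero_mem: "0 \<in> L"
    and lin_mem: "X \<in> L \<Longrightarrow> Y \<in> L \<Longrightarrow> msmult a X + msmult b Y \<in> L"
    and bracket_mem: "X \<in> L \<Longrightarrow> Y \<in> L \<Longrightarrow> bracket X Y \<in> L"
begin

lemma relations_iff:
  "r \<in> uea_relations L \<longleftrightarrow>
    (\<exists>a b X Y. X \<in> L \<and> Y \<in> L \<and> r = word_ind [msmult a X + msmult b Y] - fscale a (word_ind [X]) - fscale b (word_ind [Y])) \<or>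
    (\<exists>X Y. X \<in> L \<and> Y \<in> L \<and> r = word_ind [X, Y] - word_ind [Y, X] - word_ind [bracket X Y])"
  unfolding uea_relations_def fscale_def fun_diff_def by auto

lemma relations_cases:
  assumes "r \<in> uea_relations L"
  obtains (lin) a b X Y where "X \<in> L" "Y \<in> L"
      "r = word_ind [msmult a X + msmult b Y] - fscale a (word_ind [X]) - fscale b (word_ind [Y])"
    | (br) X Y where "X \<in> L" "Y \<in> L" "r = word_ind [X, Y] - word_ind [Y, X] - word_ind [bracket X Y]"
  using assms[unfolded relations_iff]
proof (elim disjE exE conjE)
  fix a b X Y
  assume "X \<in> L" "Y \<in> L"
    "r = word_ind [msmult a X + msmult b Y] - fscale a (word_ind [X]) - fscale b (word_ind [Y])"
  then show thesis by (rule that(1))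
next
  fix X Y
  assume "X \<in> L" "Y \<in> L" "r = word_ind [X, Y] - word_ind [Y, X] - word_ind [bracket X Y]"
  then show thesis by (rule that(2))
qed

lemma relations_subset: "uea_relations L \<subseteq> FA L"
  by (auto simp: relations_iff intro!: FA_diff FA_scale FA_word lin_mem bracket_mem)

lemma ideal_uea: "ideal (uea_ideal L) (free_alg L)"
  unfolding uea_ideal_def using relations_subset by (rule ring.genideal_ideal[OF ring_free_alg])

lemma relations_in_ideal: "uea_relations L \<subseteq> uea_ideal L"
  unfolding uea_ideal_def using relations_subset by (rule ring.genideal_self[OF ring_free_alg])

lemma uea_ideal_minimal:
  "ideal J (free_alg L) \<Longrightarrow> uea_relations L \<subseteq> J \<Longrightarrow> uea_ideal L \<subseteq> J"
  unfolding uea_ideal_def by (rule ring.genideal_minimal[OF ring_free_alg])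

lemmas I_closed = free_alg_ideal_closed[OF ideal_uea]

lemma I_sum: "(\<And>i. i \<in> S \<Longrightarrow> u i \<in> uea_ideal L) \<Longrightarrow> (\<Sum>i\<in>S. u i) \<in> uea_ideal L"
  by (induction S rule: infinite_finite_induct) (auto intro: I_closed)

lemma linear_relation:
  "X \<in> L \<Longrightarrow> Y \<in> L \<Longrightarrow>
    word_ind [msmult a X + msmult b Y] - fscale a (word_ind [X]) - fscale b (word_ind [Y]) \<in> uea_ideal L"
  by (rule subsetD[OF relations_in_ideal], unfold relations_iff, intro disjI1 exI conjI) (assumption+, rule refl)

lemma bracket_relation:
  "X \<in> L \<Longrightarrow> Y \<in> L \<Longrightarrow> word_ind [X, Y] - word_ind [Y, X] - word_ind [bracket X Y] \<in> uea_ideal L"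
  by (rule subsetD[OF relations_in_ideal], unfold relations_iff, intro disjI2 exI conjI) (assumption+, rule refl)

text \<open>The linear relation with all coefficients 0. The letter 0 is not the zero of the free
  algebra, so it has to be removed explicitly wherever a bracket vanishes.\<close>

lemma zero_letter: "word_ind [0] \<in> uea_ideal L"
proof -
  have "msmult 0 0 + msmult 0 0 = (0 :: complex^'n^'n)"
    by (simp add: msmult_def map_matrix_def vec_eq_iff)
  moreover have "fscale 0 (word_ind [0 :: complex^'n^'n]) = 0"
    by (auto simp: fscale_def)
  ultimately show ?thesis
    using linear_relation[OF zero_mem zero_mem, of 0 0] by simp
qed

lemma class_eq_iff:
  assumes "u \<in> FA L" "v \<in> FA L"
  shows "uea_class L u = uea_class L v \<longleftrightarrow> u - v \<in> uea_ideal L"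
  using ring.quotient_eq_iff_same_a_r_cos[OF ring_free_alg ideal_uea assms] free_alg_minus[OF assms]
  by (simp add: uea_class_def)

lemma carrier_uea: "carrier (uea L) = uea_class L ` FA L"
  by (auto simp: uea_def FactRing_def A_RCOSETS_def' uea_class_def)

lemma class_mem: "u \<in> FA L \<Longrightarrow> uea_class L u \<in> carrier (uea L)"
  by (simp add: carrier_uea)

lemma mem_class_iff: "u \<in> FA L \<Longrightarrow> v \<in> uea_class L u \<longleftrightarrow> v \<in> FA L \<and> v - u \<in> uea_ideal L"
proof -
  assume u: "u \<in> FA L"
  have "v \<in> uea_class L u \<longleftrightarrow> (\<exists>i\<in>uea_ideal L. v = i + u)"
    by (auto simp: uea_class_def a_r_coset_def')
  also have "\<dots> \<longleftrightarrow> v \<in> FA L \<and> v - u \<in> uea_ideal L"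
    using u I_closed(1) FA_add by (force simp: algebra_simps intro: bexI[of _ "v - u"])
  finally show ?thesis .
qed

lemma rep_props:
  assumes "c \<in> carrier (uea L)"
  shows "rep c \<in> FA L" "uea_class L (rep c) = c"
proof -
  obtain u where u: "u \<in> FA L" "c = uea_class L u"
    using assms by (auto simp: carrier_uea)
  have "u \<in> c"
    using u I_closed(2) by (simp add: mem_class_iff)
  then have "rep c \<in> c"
    unfolding rep_def using some_in_eq by fast
  then have r: "rep c \<in> FA L" "rep c - u \<in> uea_ideal L"
    using u by (auto simp: mem_class_iff)
  show "rep c \<in> FA L" by fact
  show "uea_class L (rep c) = c"
    using r u class_eq_iff by simp
qed

lemma rep_class: "u \<in> FA L \<Longrightarrow> rep (uea_class L u) \<in> FA L \<and> rep (uea_class L u) - u \<in> uea_ideal L"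
  using rep_props[OF class_mem, of u] class_eq_iff by simp

lemma class_mult:
  "u \<in> FA L \<Longrightarrow> v \<in> FA L \<Longrightarrow> uea_class L u \<otimes>\<^bsub>uea L\<^esub> uea_class L v = uea_class L (fmul u v)"
  using ideal.rcoset_mult_add[OF ideal_uea, of u v] by (simp add: uea_def FactRing_def uea_class_def)

lemma class_add:
  "u \<in> FA L \<Longrightarrow> v \<in> FA L \<Longrightarrow> uea_class L u \<oplus>\<^bsub>uea L\<^esub> uea_class L v = uea_class L (u + v)"
  using ideal.a_rcos_sum[OF ideal_uea, of u v] by (simp add: uea_def FactRing_def uea_class_def)

lemma class_one: "\<one>\<^bsub>uea L\<^esub> = uea_class L (word_ind [])"
  by (simp add: uea_def FactRing_def uea_class_def)

end

lemma subspace_imp_lie_subalg: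
  fixes \<gg> :: "(real^'n^'n) set"
  assumes sub: "subspace \<gg>" and br: "\<And>X Y. X \<in> \<gg> \<Longrightarrow> Y \<in> \<gg> \<Longrightarrow> bracket X Y \<in> \<gg>"
  shows "lie_subalg (complexification \<gg>)"
proof
  have "map_matrix Re (0 :: complex^'n^'n) = 0" "map_matrix Im (0 :: complex^'n^'n) = 0"
    by (simp_all add: map_matrix_def vec_eq_iff)
  then show "0 \<in> complexification \<gg>"
    using subspace_0[OF sub] by (simp add: complexification_def)
  fix X Y :: "complex^'n^'n" and a b
  assume "X \<in> complexification \<gg>" "Y \<in> complexification \<gg>"
  then have XY: "map_matrix Re X \<in> \<gg>" "map_matrix Im X \<in> \<gg>" "map_matrix Re Y \<in> \<gg>" "map_matrix Im Y \<in> \<gg>"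
    by (simp_all add: complexification_def)
  show "msmult a X + msmult b Y \<in> complexification \<gg>"
    unfolding complexification_def mem_Collect_eq map_matrix_Re_Im_linear
    by (intro conjI subspace_add[OF sub] subspace_mul[OF sub] XY)
  show "bracket X Y \<in> complexification \<gg>"
    unfolding complexification_def mem_Collect_eq map_matrix_Re_Im_bracket
    by (intro conjI subspace_add[OF sub] subspace_mul[OF sub] br XY)
qed

lemma (in closed_linear_group) lie_subalg_lie_algebra_C: "lie_subalg (lie_algebra_C G)"
  by (rule subspace_imp_lie_subalg[OF subspace_lie_algebra bracket_in_lie_algebra])

section \<open>Word actions and their descent to the enveloping algebra\<close>

lemma word_action_pairing: "word_action D u f g = pairing u (\<lambda>w. foldr D w f g)"
  by (simp add: word_action_def pairing_def)

lemma word_action_eq_sum: "word_action D u f = (\<Sum>w | u w \<noteq> 0. fscale (u w) (foldr D w f))"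
  by (auto simp: word_action_def sum_fun_apply fscale_def)

lemma word_action_add: "finsupp u \<Longrightarrow> finsupp v \<Longrightarrow> word_action D (u + v) f = word_action D u f + word_action D v f"
  by (rule ext) (simp add: word_action_pairing pairing_add)

lemma word_action_diff: "finsupp u \<Longrightarrow> finsupp v \<Longrightarrow> word_action D (u - v) f = word_action D u f - word_action D v f"
  by (rule ext) (simp add: word_action_pairing pairing_diff)

lemma word_action_scale: "word_action D (fscale c u) f = fscale c (word_action D u f)"
  by (rule ext) (simp add: word_action_pairing pairing_scale fscale_def[of c "word_action D u f"])

lemma word_action_word [simp]: "word_action D (word_ind w) f = foldr D w f"
  by (rule ext) (simp add: word_action_pairing)

lemma word_action_zero [simp]: "word_action D 0 f = 0"
  by (rule ext) (simp add: word_action_pairing)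

lemma word_action_sum:
  "(\<And>i. i \<in> I \<Longrightarrow> finsupp (u i)) \<Longrightarrow> word_action D (\<Sum>i\<in>I. u i) f = (\<Sum>i\<in>I. word_action D (u i) f)"
  by (rule ext) (simp add: word_action_pairing pairing_sum sum_fun_apply)

lemma word_action_push: "finsupp u \<Longrightarrow> word_action D (push_words h u) f = word_action (D \<circ> h) u f"
  by (rule ext) (simp add: word_action_pairing pairing_push foldr_map)

context lie_rep
begin

lemma foldr_closed: "set w \<subseteq> L \<Longrightarrow> f \<in> V \<Longrightarrow> foldr D w f \<in> V"
  by (induction w) (auto intro: D_closed)

lemma foldr_add: "set w \<subseteq> L \<Longrightarrow> f \<in> V \<Longrightarrow> g \<in> V \<Longrightarrow> foldr D w (f + g) = foldr D w f + foldr D w g"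
  by (induction w) (auto simp: D_add foldr_closed simp del: plus_fun_apply)

lemma foldr_scale: "set w \<subseteq> L \<Longrightarrow> f \<in> V \<Longrightarrow> foldr D w (fscale c f) = fscale c (foldr D w f)"
  by (induction w) (auto simp: D_scale foldr_closed)

text \<open>The element \<open>f0\<close> witnesses that \<open>V\<close> is nonempty and hence
  contains 0, the value of an empty sum.\<close>

lemma V_sum:
  assumes "f0 \<in> V" "\<And>i. i \<in> I \<Longrightarrow> f i \<in> V"
  shows "(\<Sum>i\<in>I. f i) \<in> V"
proof -
  have "fscale 0 f0 = 0" by (auto simp: fscale_def)
  then have "0 \<in> V" using V_scale[OF assms(1), of 0] by simp
  then show ?thesis
    using assms(2) by (induction I rule: infinite_finite_induct) (auto intro: V_add)
qed

lemma foldr_sum: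
  assumes "set w \<subseteq> L" "f0 \<in> V" "finite I" "\<And>i. i \<in> I \<Longrightarrow> f i \<in> V"
  shows "foldr D w (\<Sum>i\<in>I. f i) = (\<Sum>i\<in>I. foldr D w (f i))"
  using assms(3,4)
proof (induction I rule: finite_induct)
  case empty
  have z: "fscale 0 f = 0" for f :: "'b \<Rightarrow> complex" by (auto simp: fscale_def)
  have "foldr D w 0 = 0"
    using foldr_scale[OF assms(1,2), of 0] unfolding z .
  then show ?case unfolding sum.empty .
next
  case (insert i I)
  have "(\<Sum>i\<in>I. f i) \<in> V" by (rule V_sum[OF assms(2)]) (use insert in auto)
  then show ?case
    using insert by (simp add: foldr_add[OF assms(1)] del: plus_fun_apply)
qed

lemma word_action_closed: "u \<in> FA L \<Longrightarrow> f \<in> V \<Longrightarrow> word_action D u f \<in> V"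
  unfolding word_action_eq_sum by (rule V_sum) (auto simp: FA_iff intro: V_scale foldr_closed)

text \<open>The folds along a concatenated word compose; linearity of the fold over the finite sum
  for v gives the rest.\<close>

lemma word_action_fmul:
  assumes "u \<in> FA L" "v \<in> FA L" "f \<in> V"
  shows "word_action D (fmul u v) f = word_action D u (word_action D v f)"
proof
  fix g
  have fold: "foldr D a (word_action D v f) g = pairing v (\<lambda>b. foldr D (a @ b) f g)" if a: "set a \<subseteq> L" for a
  proof -
    have "foldr D a (word_action D v f) = (\<Sum>w | v w \<noteq> 0. foldr D a (fscale (v w) (foldr D w f)))"
      unfolding word_action_eq_sum
      by (rule foldr_sum[OF a assms(3)]) (use assms in \<open>auto simp: FA_iff intro!: V_scale foldr_closed\<close>)
    also have "\<dots> = (\<Sum>w | v w \<noteq> 0. fscale (v w) (foldr D (a @ w) f))"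
      by (rule sum.cong) (use assms a in \<open>auto simp: FA_iff foldr_scale foldr_closed\<close>)
    finally show ?thesis
      by (simp add: sum_fun_apply pairing_def fscale_def)
  qed
  have "word_action D (fmul u v) f g = pairing u (\<lambda>a. pairing v (\<lambda>b. foldr D (a @ b) f g))"
    using assms by (simp only: word_action_pairing pairing_fmul FA_finsupp)
  also have "\<dots> = pairing u (\<lambda>a. foldr D a (word_action D v f) g)"
    by (rule pairing_cong) (use assms(1) fold in \<open>auto simp: FA_iff\<close>)
  finally show "word_action D (fmul u v) f g = word_action D u (word_action D v f) g"
    by (simp add: word_action_pairing)
qed

lemma word_action_fun_add:
  "u \<in> FA L \<Longrightarrow> f \<in> V \<Longrightarrow> g \<in> V \<Longrightarrow> word_action D u (f + g) = word_action D u f + word_action D u g"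
  unfolding word_action_eq_sum sum.distrib[symmetric]
  by (rule sum.cong) (auto simp: FA_iff foldr_add fscale_def fun_eq_iff algebra_simps)

lemma word_action_fun_scale:
  "u \<in> FA L \<Longrightarrow> f \<in> V \<Longrightarrow> word_action D u (fscale c f) = fscale c (word_action D u f)"
  unfolding word_action_eq_sum fun_vs.scale_sum_right
  by (rule sum.cong[OF refl], subst foldr_scale) (auto simp: FA_iff fscale_def mult.left_commute)

text \<open>The elements that annihilate all of \<open>V\<close> form a two-sided ideal, since
  \<open>V\<close> is stable under the action. It contains the relations by \<open>D_linear\<close>
  and \<open>D_bracket\<close>, hence the ideal they generate. This is why the choice made by
  \<open>rep\<close> does not matter.\<close>

lemma word_action_ideal:
  assumes "lie_subalg L" "u \<in> uea_ideal L" "f \<in> V"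
  shows "word_action D u f = 0"
proof -
  interpret lie_subalg L by fact
  have zero: "word_action D x 0 = 0" if "f \<in> V" "x \<in> FA L" for x f
  proof -
    have z: "fscale 0 f = 0" for f :: "'b \<Rightarrow> complex" by (auto simp: fscale_def)
    show ?thesis using word_action_fun_scale[OF that(2,1), of 0] unfolding z .
  qed
  let ?J = "{u \<in> FA L. \<forall>f\<in>V. word_action D u f = 0}"
  have "ideal ?J (free_alg L)"
  proof (rule free_alg_idealI)
    fix u x assume "u \<in> ?J" "x \<in> FA L"
    then show "fmul x u \<in> ?J" "fmul u x \<in> ?J"
      using zero by (auto simp: FA_fmul word_action_fmul word_action_closed)
  qed (auto simp: FA_zero FA_add word_action_add FA_finsupp)
  moreover have "uea_relations L \<subseteq> ?J"
  proof
    fix r assume r: "r \<in> uea_relations L"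
    have "word_action D r f = 0" if "f \<in> V" for f
      using r
    proof (cases rule: relations_cases)
      case lin
      then show ?thesis
        using that by (simp only: word_action_diff finsupp_word finsupp_diff finsupp_scale word_action_scale
            word_action_word) (simp add: D_linear)
    next
      case br
      then show ?thesis
        using that by (simp only: word_action_diff finsupp_word finsupp_diff
            word_action_word) (simp add: D_bracket)
    qed
    then show "r \<in> ?J" using r relations_subset by auto
  qed
  ultimately have "uea_ideal L \<subseteq> ?J"
    by (rule uea_ideal_minimal)
  then show ?thesis using assms by auto
qed

lemma word_action_cong_ideal:
  assumes "lie_subalg L" "u \<in> FA L" "v \<in> FA L" "u - v \<in> uea_ideal L" "f \<in> V"
  shows "word_action D u f = word_action D v f"
proof -
  have "word_action D u f - word_action D v f = 0"
    using word_action_ideal[OF assms(1,4,5)]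
    unfolding word_action_diff[OF assms(2,3)[THEN FA_finsupp]] .
  then show ?thesis
    by (rule eq_iff_diff_eq_0[THEN iffD2])
qed

end

section \<open>Homomorphisms of Lie algebras\<close>

definition lie_hom :: "(complex^'n^'n) set \<Rightarrow> (complex^'m^'m) set \<Rightarrow> (complex^'n^'n \<Rightarrow> complex^'m^'m) \<Rightarrow> bool" where
  "lie_hom L M h \<longleftrightarrow> (\<forall>X\<in>L. h X \<in> M) \<and>
     (\<forall>X\<in>L. \<forall>Y\<in>L. \<forall>a b. h (msmult a X + msmult b Y) = msmult a (h X) + msmult b (h Y)) \<and>
     (\<forall>X\<in>L. \<forall>Y\<in>L. h (bracket X Y) = bracket (h X) (h Y))"

text \<open>The preimage of \<open>uea_ideal M\<close> is an ideal and contains the relations of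
  \<open>L\<close>, so it contains \<open>uea_ideal L\<close>.\<close>

lemma push_ideal:
  assumes L: "lie_subalg L" and M: "lie_subalg M" and h: "lie_hom L M h" and u: "u \<in> uea_ideal L"
  shows "push_words h u \<in> uea_ideal M"
proof -
  interpret L: lie_subalg L by fact
  interpret M: lie_subalg M by fact
  have hM: "\<And>X. X \<in> L \<Longrightarrow> h X \<in> M" using h by (simp add: lie_hom_def)
  let ?J = "{u \<in> FA L. push_words h u \<in> uea_ideal M}"
  have "ideal ?J (free_alg L)"
  proof (rule free_alg_idealI)
    fix u x assume "u \<in> ?J" "x \<in> FA L"
    then show "fmul x u \<in> ?J" "fmul u x \<in> ?J"
      using FA_push[of x L h M] hM by (auto simp: FA_fmul push_fmul FA_finsupp M.I_closed)
  qed (auto simp: FA_zero FA_add push_add FA_finsupp M.I_closed)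
  moreover have "uea_relations L \<subseteq> ?J"
  proof
    fix r assume r: "r \<in> uea_relations L"
    have "push_words h r \<in> uea_ideal M"
      using r
    proof (cases rule: L.relations_cases)
      case (lin a b X Y)
      then have "push_words h r = word_ind [msmult a (h X) + msmult b (h Y)] - fscale a (word_ind [h X]) - fscale b (word_ind [h Y])"
        using h by (simp only: push_diff finsupp_word finsupp_diff finsupp_scale push_scale push_word)
          (simp add: lie_hom_def)
      then show ?thesis using M.linear_relation[OF hM hM] lin by simp
    next
      case (br X Y)
      then have "push_words h r = word_ind [h X, h Y] - word_ind [h Y, h X] - word_ind [bracket (h X) (h Y)]"
        using h by (simp only: push_diff finsupp_word finsupp_diff push_word) (simp add: lie_hom_def)
      then show ?thesis using M.bracket_relation[OF hM hM] br by simp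
    qed
    then show "r \<in> ?J" using r L.relations_subset by auto
  qed
  ultimately have "uea_ideal L \<subseteq> ?J"
    by (rule L.uea_ideal_minimal)
  then show ?thesis using u by auto
qed

text \<open>\<open>uea_map\<close> uses an arbitrary representative; by \<open>push_ideal\<close>
  the image class does not depend on it.\<close>

lemma uea_map_class:
  assumes L: "lie_subalg L" and M: "lie_subalg M" and h: "lie_hom L M h" and u: "u \<in> FA L"
  shows "uea_map M h (uea_class L u) = uea_class M (push_words h u)"
proof -
  interpret L: lie_subalg L by fact
  interpret M: lie_subalg M by fact
  have hM: "\<And>X. X \<in> L \<Longrightarrow> h X \<in> M" using h by (simp add: lie_hom_def)
  have r: "rep (uea_class L u) \<in> FA L" "rep (uea_class L u) - u \<in> uea_ideal L"
    using L.rep_class[OF u] by auto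
  then have "push_words h (rep (uea_class L u)) - push_words h u \<in> uea_ideal M"
    using push_ideal[OF L M h r(2)] u by (simp add: push_diff FA_finsupp)
  then show ?thesis
    unfolding uea_map_def using M.class_eq_iff[OF FA_push[OF r(1) hM] FA_push[OF u hM]] by simp
qed

lemma matrix_mult_msmult:
  fixes X :: "complex^'n^'n"
  shows "A ** msmult a X = msmult a (A ** X)" "msmult a X ** B = msmult a (X ** B)"
  by (simp_all add: msmult_def map_matrix_def matrix_matrix_mult_def vec_eq_iff sum_distrib_left mult_ac)

lemma map_matrix_of_real_mult:
  "map_matrix complex_of_real (A ** B) = map_matrix complex_of_real A ** map_matrix complex_of_real B"
  by (simp add: map_matrix_def matrix_matrix_mult_def vec_eq_iff)

lemma map_matrix_of_real_one: "map_matrix complex_of_real (mat 1) = mat 1"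
  by (simp add: map_matrix_def mat_def vec_eq_iff)

lemma matrix_mult_diff:
  fixes A B C :: "'a::ring_1^'n^'n"
  shows "(A - B) ** C = A ** C - B ** C" "C ** (A - B) = C ** A - C ** B"
  by (simp_all add: matrix_matrix_mult_def vec_eq_iff algebra_simps sum_subtractf)

lemma map_matrix_Re_Im_conj:
  "map_matrix Re (map_matrix complex_of_real g ** X ** map_matrix complex_of_real h) = g ** map_matrix Re X ** h"
  "map_matrix Im (map_matrix complex_of_real g ** X ** map_matrix complex_of_real h) = g ** map_matrix Im X ** h"
  by (simp_all add: map_matrix_def matrix_matrix_mult_def vec_eq_iff)

lemma (in closed_linear_group) lie_hom_Ad:
  assumes "g \<in> G"
  shows "lie_hom (lie_algebra_C G) (lie_algebra_C G) (Ad g)"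
proof -
  let ?g = "map_matrix complex_of_real g" and ?h = "map_matrix complex_of_real (matrix_inv g)"
  have inv: "?h ** ?g = mat 1"
    using assms by (simp add: matrix_inv_mult_self map_matrix_of_real_one flip: map_matrix_of_real_mult)
  have prod: "?g ** X ** ?h ** (?g ** Y ** ?h) = ?g ** (X ** Y) ** ?h" for X Y
  proof -
    have "?g ** X ** ?h ** (?g ** Y ** ?h) = ?g ** X ** (?h ** ?g) ** Y ** ?h"
      by (simp only: matrix_mul_assoc)
    then show ?thesis by (simp only: inv matrix_mul_rid matrix_mul_assoc)
  qed
  have "Ad g (bracket X Y) = bracket (Ad g X) (Ad g Y)" for X Y
    unfolding Ad_def bracket_def prod by (simp only: matrix_mult_diff)
  moreover have "Ad g (msmult a X + msmult b Y) = msmult a (Ad g X) + msmult b (Ad g Y)" for a b X Y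
    unfolding Ad_def by (simp only: matrix_add_ldistrib matrix_mult_add_left matrix_mult_msmult)
  moreover have "Ad g X \<in> lie_algebra_C G" if "X \<in> lie_algebra_C G" for X
    using that assms conj_in_lie_algebra unfolding complexification_def Ad_def mem_Collect_eq map_matrix_Re_Im_conj
    by simp
  ultimately show ?thesis by (simp add: lie_hom_def)
qed

text \<open>Turns invariance of a coset into a congruence for one representative, the form in which
  invariance is handled below.\<close>

lemma (in closed_linear_group) class_in_Z_iff:
  assumes "u \<in> FA (lie_algebra_C G)"
  shows "uea_class (lie_algebra_C G) u \<in> carrier (Z_alg G) \<longleftrightarrow>
    (\<forall>g\<in>G. push_words (Ad g) u - u \<in> uea_ideal (lie_algebra_C G))"
proof -
  interpret L: lie_subalg "lie_algebra_C G" by (rule lie_subalg_lie_algebra_C)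
  have "uea_map (lie_algebra_C G) (Ad g) (uea_class (lie_algebra_C G) u) = uea_class (lie_algebra_C G) u
      \<longleftrightarrow> push_words (Ad g) u - u \<in> uea_ideal (lie_algebra_C G)" if "g \<in> G" for g
  proof -
    have hom: "lie_hom (lie_algebra_C G) (lie_algebra_C G) (Ad g)" by (rule lie_hom_Ad[OF that])
    then have "push_words (Ad g) u \<in> FA (lie_algebra_C G)"
      by (intro FA_push[OF assms]) (simp add: lie_hom_def)
    then show ?thesis
      using uea_map_class[OF L.lie_subalg_axioms L.lie_subalg_axioms hom assms] L.class_eq_iff assms by simp
  qed
  then show ?thesis
    using L.class_mem[OF assms] by (simp add: Z_alg_def)
qed

lemma (in closed_linear_group) Z_cases:
  assumes "c \<in> carrier (Z_alg G)"
  obtains u where "u \<in> FA (lie_algebra_C G)" "c = uea_class (lie_algebra_C G) u"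
    "rep c \<in> FA (lie_algebra_C G)" "uea_class (lie_algebra_C G) (rep c) = c"
proof -
  interpret L: lie_subalg "lie_algebra_C G" by (rule lie_subalg_lie_algebra_C)
  have "c \<in> carrier (U_alg G)" using assms by (simp add: Z_alg_def)
  then show thesis using L.rep_props[of c] that[of "rep c"] by auto
qed

section \<open>Block matrices and product groups\<close>

definition ul :: "'a^('n::finite + 'm::finite)^('n + 'm) \<Rightarrow> 'a^'n^'n" where
  "ul Z = (\<chi> i j. Z $ Inl i $ Inl j)"

definition lr :: "'a^('n::finite + 'm::finite)^('n + 'm) \<Rightarrow> 'a^'m^'m" where
  "lr Z = (\<chi> i j. Z $ Inr i $ Inr j)"

lemma blk_nth [simp]:
  "blk A B $ Inl i $ Inl j = A $ i $ j" "blk A B $ Inr k $ Inr l = B $ k $ l"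
  "blk A B $ Inl i $ Inr l = 0" "blk A B $ Inr k $ Inl j = 0"
  by (simp_all add: blk_def)

lemma ul_lr_nth [simp]: "ul Z $ i $ j = Z $ Inl i $ Inl j" "lr Z $ k $ l = Z $ Inr k $ Inr l"
  by (simp_all add: ul_def lr_def)

lemma all_sum_iff: "(\<forall>x :: 'a + 'b. P x) \<longleftrightarrow> (\<forall>x. P (Inl x)) \<and> (\<forall>x. P (Inr x))"
  by (metis sum.exhaust)

lemma sum_UNIV_Plus:
  "(\<Sum>i\<in>(UNIV :: ('n::finite + 'm::finite) set). f i) = (\<Sum>i\<in>UNIV. f (Inl i)) + (\<Sum>i\<in>UNIV. f (Inr i))"
proof -
  have "(\<Sum>i\<in>UNIV <+> UNIV. f i) = (\<Sum>i\<in>UNIV. f (Inl i)) + (\<Sum>i\<in>UNIV. f (Inr i))"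
    by (subst sum.Plus) (simp_all add: o_def)
  then show ?thesis by simp
qed

lemmas blk_eq_simps = vec_eq_iff all_sum_iff

lemma ul_blk [simp]: "ul (blk A B) = A" and lr_blk [simp]: "lr (blk A B) = B"
  by (simp_all add: vec_eq_iff)

lemma blk_eq_iff [simp]: "blk A B = blk C D \<longleftrightarrow> A = C \<and> B = D"
  by (metis ul_blk lr_blk)

lemma blk_mult: "blk A B ** blk C D = blk (A ** C) (B ** D)"
  for A C :: "'a::semiring_1^'n^'n" and B D :: "'a^'m^'m"
  by (simp add: blk_eq_simps matrix_matrix_mult_def sum_UNIV_Plus)

lemma ul_blk_mult: "ul (blk A B ** C) = A ** ul C" and lr_blk_mult: "lr (blk A B ** C) = B ** lr C"
  for A :: "'a::semiring_1^'n^'n" and B :: "'a^'m^'m"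
  by (simp_all add: vec_eq_iff matrix_matrix_mult_def sum_UNIV_Plus)

lemma blk_one [simp]: "blk (mat 1) (mat 1) = mat 1"
  by (simp add: blk_eq_simps mat_def)

lemma ul_one [simp]: "ul (mat 1) = mat 1" and lr_one [simp]: "lr (mat 1) = mat 1"
  by (simp_all add: vec_eq_iff mat_def)

lemma blk_zero [simp]: "blk 0 0 = 0"
  by (simp add: blk_eq_simps)

lemma blk_add: "blk A B + blk C D = blk (A + C) (B + D)"
  for A C :: "'a::monoid_add^'n^'n" and B D :: "'a^'m^'m"
  by (simp add: blk_eq_simps)

lemma blk_scaleR: "c *\<^sub>R blk A B = blk (c *\<^sub>R A) (c *\<^sub>R B)"
  for A :: "real^'n^'n" and B :: "real^'m^'m"
  by (simp add: blk_eq_simps)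

lemma blk_msmult: "msmult c (blk A B) = blk (msmult c A) (msmult c B)"
  by (simp add: blk_eq_simps msmult_def map_matrix_def)

lemma blk_bracket: "bracket (blk A B) (blk C D) = blk (bracket A C) (bracket B D)"
  for A C :: "'a::ring_1^'n^'n" and B D :: "'a^'m^'m"
  unfolding bracket_def blk_mult by (simp add: blk_eq_simps)

lemma map_matrix_blk: "f 0 = 0 \<Longrightarrow> map_matrix f (blk A B) = blk (map_matrix f A) (map_matrix f B)"
  by (simp add: blk_eq_simps map_matrix_def)

lemma invertible_blk:
  fixes A :: "real^'n^'n" and B :: "real^'m^'m"
  shows "invertible (blk A B) \<longleftrightarrow> invertible A \<and> invertible B"
proof
  assume "invertible (blk A B)"
  then obtain C where "blk A B ** C = mat 1"
    using invertible_right_inverse by blast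
  then have "A ** ul C = mat 1" "B ** lr C = mat 1"
    using ul_blk_mult[of A B C] lr_blk_mult[of A B C] by simp_all
  then show "invertible A \<and> invertible B"
    unfolding invertible_right_inverse by auto
next
  assume "invertible A \<and> invertible B"
  then have "blk A B ** blk (matrix_inv A) (matrix_inv B) = mat 1"
    by (simp add: blk_mult matrix_inv_mult_self)
  then show "invertible (blk A B)"
    unfolding invertible_right_inverse by (rule exI)
qed

lemma matrix_inv_blk:
  fixes A :: "real^'n^'n" and B :: "real^'m^'m"
  assumes "invertible A" "invertible B"
  shows "matrix_inv (blk A B) = blk (matrix_inv A) (matrix_inv B)"
  by (rule matrix_inv_unique) (simp add: blk_mult matrix_inv_mult_self assms)

lemma mpow_blk: "mpow (blk A B) k = blk (mpow A k) (mpow B k)"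
  by (induction k) (simp_all add: blk_mult)

lemma bounded_linear_blk_left: "bounded_linear (\<lambda>A :: real^'n^'n. blk A (0 :: real^'m^'m))"
  by (rule linear_conv_bounded_linear[THEN iffD1], rule linearI) (simp_all add: blk_add blk_scaleR)

lemma bounded_linear_blk_right: "bounded_linear (\<lambda>B :: real^'m^'m. blk (0 :: real^'n^'n) B)"
  by (rule linear_conv_bounded_linear[THEN iffD1], rule linearI) (simp_all add: blk_add blk_scaleR)

lemma bounded_linear_ul: "bounded_linear (ul :: real^('n::finite + 'm::finite)^('n + 'm) \<Rightarrow> real^'n^'n)"
  by (rule linear_conv_bounded_linear[THEN iffD1], rule linearI) (simp_all add: vec_eq_iff)

lemma bounded_linear_lr: "bounded_linear (lr :: real^('n::finite + 'm::finite)^('n + 'm) \<Rightarrow> real^'m^'m)"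
  by (rule linear_conv_bounded_linear[THEN iffD1], rule linearI) (simp_all add: vec_eq_iff)

lemma mexp_blk:
  fixes X :: "real^'n^'n" and Y :: "real^'m^'m"
  shows "mexp (blk X Y) = blk (mexp X) (mexp Y)"
proof -
  have "(\<lambda>k. blk (mpow X k /\<^sub>R fact k) (0 :: real^'m^'m) + blk (0 :: real^'n^'n) (mpow Y k /\<^sub>R fact k)) sums
      (blk (mexp X) 0 + blk 0 (mexp Y))"
    by (intro sums_add bounded_linear.sums[OF bounded_linear_blk_left]
        bounded_linear.sums[OF bounded_linear_blk_right] mexp_sums)
  moreover have "blk (mpow X k /\<^sub>R fact k) (0 :: real^'m^'m) + blk (0 :: real^'n^'n) (mpow Y k /\<^sub>R fact k) =
      mpow (blk X Y) k /\<^sub>R fact k" for k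
    by (simp add: blk_add blk_scaleR mpow_blk)
  ultimately have "(\<lambda>k. mpow (blk X Y) k /\<^sub>R fact k) sums blk (mexp X) (mexp Y)"
    by (simp add: blk_add)
  then show ?thesis
    by (rule sums_unique2[OF mexp_sums])
qed

lemma blk_in_prod_group [simp]: "blk g h \<in> prod_group G H \<longleftrightarrow> g \<in> G \<and> h \<in> H"
  by (auto simp: prod_group_def)

locale group_pair =
  G: closed_linear_group G + H: closed_linear_group H
  for G :: "(real^'n^'n) set" and H :: "(real^'m^'m) set"
begin

abbreviation "P \<equiv> prod_group G H"

lemma prod_group_fixed: "Z \<in> P \<Longrightarrow> blk (ul Z) (lr Z) = Z"
  by (auto simp: prod_group_def)

sublocale P: closed_linear_group P
proof
  show "P \<subseteq> carrier GL"
    by (auto simp: prod_group_def invertible_blk)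
  fix x y assume "x \<in> P" "y \<in> P"
  then show "x \<otimes>\<^bsub>GL\<^esub> y \<in> P"
    by (auto simp: prod_group_def blk_mult)
next
  have "blk (mat 1 :: real^'n^'n) (mat 1 :: real^'m^'m) \<in> P" unfolding blk_in_prod_group by simp
  then show "\<one>\<^bsub>GL\<^esub> \<in> P" by simp
next
  fix x assume "x \<in> P"
  then show "inv\<^bsub>GL\<^esub> x \<in> P"
    by (auto simp: prod_group_def inv_GL invertible_blk matrix_inv_blk)
next
  fix x l assume x: "\<And>n. x n \<in> P" and lim: "x \<longlonglongrightarrow> l" and l: "invertible l"
  have ul: "(\<lambda>n. ul (x n)) \<longlonglongrightarrow> ul l" and lr: "(\<lambda>n. lr (x n)) \<longlonglongrightarrow> lr l"
    using lim by (rule bounded_linear.tendsto[OF bounded_linear_ul] bounded_linear.tendsto[OF bounded_linear_lr])+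
  have "(\<lambda>n. blk (ul (x n)) (0 :: real^'m^'m) + blk (0 :: real^'n^'n) (lr (x n))) \<longlonglongrightarrow> blk (ul l) 0 + blk 0 (lr l)"
    by (intro tendsto_add bounded_linear.tendsto[OF bounded_linear_blk_left]
        bounded_linear.tendsto[OF bounded_linear_blk_right] ul lr)
  \<comment> \<open>The sequence also converges to the block-diagonal part of its limit, so by
    uniqueness the limit is block diagonal.\<close>
  then have "x \<longlonglongrightarrow> blk (ul l) (lr l)"
    by (simp add: blk_add prod_group_fixed x)
  then have eq: "l = blk (ul l) (lr l)"
    using lim LIMSEQ_unique by blast
  then have inv: "invertible (ul l)" "invertible (lr l)"
    using l invertible_blk by metis+
  have "ul (x n) \<in> G" "lr (x n) \<in> H" for n
    using x[of n] by (auto simp: prod_group_def)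
  then have "ul l \<in> G" "lr l \<in> H"
    using G.closed[OF _ ul inv(1)] H.closed[OF _ lr inv(2)] by blast+
  then show "l \<in> P"
    by (subst eq) simp
qed

text \<open>exp(tZ) is block diagonal for all t, hence so is its derivative Z at 0; the exponential
  then acts block by block.\<close>

lemma lie_algebra_prod: "Z \<in> lie_algebra P \<longleftrightarrow> (\<exists>X\<in>lie_algebra G. \<exists>Y\<in>lie_algebra H. Z = blk X Y)"
proof
  assume Z: "Z \<in> lie_algebra P"
  have d: "((\<lambda>t. mexp (t *\<^sub>R Z)) has_vector_derivative Z) (at 0)"
    by (rule mexp_has_vector_derivative)
  have "((\<lambda>t. blk (ul (mexp (t *\<^sub>R Z))) (0 :: real^'m^'m) + blk (0 :: real^'n^'n) (lr (mexp (t *\<^sub>R Z)))) has_vector_derivative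
      blk (ul Z) 0 + blk 0 (lr Z)) (at 0)"
    by (intro has_vector_derivative_add d
        bounded_linear.has_vector_derivative[OF bounded_linear_compose[OF bounded_linear_blk_left bounded_linear_ul]]
        bounded_linear.has_vector_derivative[OF bounded_linear_compose[OF bounded_linear_blk_right bounded_linear_lr]])
  then have "((\<lambda>t. mexp (t *\<^sub>R Z)) has_vector_derivative blk (ul Z) (lr Z)) (at 0)"
    using Z by (simp add: blk_add prod_group_fixed P.mexp_mem)
  then have eq: "Z = blk (ul Z) (lr Z)"
    by (rule vector_derivative_unique_at[OF d])
  have "blk (mexp (t *\<^sub>R ul Z)) (mexp (t *\<^sub>R lr Z)) \<in> P" for t
  proof -
    have "mexp (t *\<^sub>R blk (ul Z) (lr Z)) \<in> P"
      using P.mexp_mem[OF Z, of t] eq by simp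
    then show ?thesis by (simp only: blk_scaleR mexp_blk)
  qed
  then have "ul Z \<in> lie_algebra G" "lr Z \<in> lie_algebra H"
    by (auto simp: lie_algebra_def)
  then show "\<exists>X\<in>lie_algebra G. \<exists>Y\<in>lie_algebra H. Z = blk X Y"
    using eq by blast
qed (auto simp: lie_algebra_def blk_scaleR mexp_blk)

abbreviation "L \<equiv> lie_algebra_C G"
abbreviation "M \<equiv> lie_algebra_C H"
abbreviation "N \<equiv> lie_algebra_C P"

sublocale L: lie_subalg L by (rule G.lie_subalg_lie_algebra_C)
sublocale M: lie_subalg M by (rule H.lie_subalg_lie_algebra_C)
sublocale N: lie_subalg N by (rule P.lie_subalg_lie_algebra_C)

lemma blk_in_N_iff: "blk X Y \<in> N \<longleftrightarrow> X \<in> L \<and> Y \<in> M"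
  by (auto simp: complexification_def map_matrix_blk lie_algebra_prod)

lemma N_iff: "Z \<in> N \<longleftrightarrow> (\<exists>X\<in>L. \<exists>Y\<in>M. Z = blk X Y)"
proof
  assume Z: "Z \<in> N"
  then obtain X1 Y1 X2 Y2 where re: "map_matrix Re Z = blk X1 Y1" and im: "map_matrix Im Z = blk X2 Y2"
    unfolding complexification_def lie_algebra_prod by blast
  have "Z = blk (ul Z) (lr Z)"
    unfolding blk_eq_simps
  proof (intro conjI allI)
    fix i :: 'n and k :: 'm
    have "map_matrix Re Z $ Inl i $ Inr k = 0" "map_matrix Im Z $ Inl i $ Inr k = 0"
      unfolding re im by simp_all
    then show "Z $ Inl i $ Inr k = blk (ul Z) (lr Z) $ Inl i $ Inr k"
      by (simp add: map_matrix_def complex_eq_iff)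
    have "map_matrix Re Z $ Inr k $ Inl i = 0" "map_matrix Im Z $ Inr k $ Inl i = 0"
      unfolding re im by simp_all
    then show "Z $ Inr k $ Inl i = blk (ul Z) (lr Z) $ Inr k $ Inl i"
      by (simp add: map_matrix_def complex_eq_iff)
  qed simp_all
  then show "\<exists>X\<in>L. \<exists>Y\<in>M. Z = blk X Y"
    using Z blk_in_N_iff by metis
qed (auto simp: blk_in_N_iff)

lemma lie_hom_left: "lie_hom L N (\<lambda>X. blk X 0)"
  by (auto simp: lie_hom_def blk_in_N_iff M.zero_mem blk_msmult blk_add blk_bracket)
    (simp_all add: msmult_def map_matrix_def bracket_def vec_eq_iff matrix_matrix_mult_def)

lemma lie_hom_right: "lie_hom M N (\<lambda>Y. blk 0 Y)"
  by (auto simp: lie_hom_def blk_in_N_iff L.zero_mem blk_msmult blk_add blk_bracket)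
    (simp_all add: msmult_def map_matrix_def bracket_def vec_eq_iff matrix_matrix_mult_def)

lemma Ad_blk:
  assumes "g \<in> G" "h \<in> H"
  shows "Ad (blk g h) (blk X Y) = blk (Ad g X) (Ad h Y)"
  using assms by (simp add: Ad_def matrix_inv_blk map_matrix_blk blk_mult)

end

section \<open>The centre of the enveloping algebra of a product\<close>

lemma FA_induct [consumes 1, case_names zero word add scale]:
  assumes u: "u \<in> FA S" and "P 0" and word: "\<And>w. set w \<subseteq> S \<Longrightarrow> P (word_ind w)"
    and add: "\<And>u v. u \<in> FA S \<Longrightarrow> v \<in> FA S \<Longrightarrow> P u \<Longrightarrow> P v \<Longrightarrow> P (u + v)"
    and scale: "\<And>c u. u \<in> FA S \<Longrightarrow> P u \<Longrightarrow> P (fscale c u)"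
  shows "P u"
proof -
  have "P (\<Sum>w\<in>A. fscale (c w) (word_ind w))" if "finite A" "\<And>w. w \<in> A \<Longrightarrow> set w \<subseteq> S" for A c
    using that
  proof (induction A rule: finite_induct)
    case empty
    show ?case unfolding sum.empty by fact
  next
    case (insert w A)
    have "(\<Sum>w\<in>A. fscale (c w) (word_ind w)) \<in> FA S"
      by (rule FA_sum) (use insert in \<open>auto intro!: FA_scale FA_word\<close>)
    moreover have "word_ind w \<in> FA S"
      using insert by (intro FA_word) auto
    moreover have "P (\<Sum>w\<in>A. fscale (c w) (word_ind w))" "P (word_ind w)"
      using insert word by auto
    ultimately show ?case
      unfolding sum.insert[OF insert.hyps] by (intro add scale FA_scale)
  qed
  then have "P (\<Sum>w | u w \<noteq> 0. fscale (u w) (word_ind w))"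
    using u by (auto simp: FA_iff)
  then show ?thesis
    using word_expansion[OF FA_finsupp[OF u]] by metis
qed

lemma sum_lessThan_add: "(\<Sum>i<n + m. f i) = (\<Sum>i<n. f i) + (\<Sum>i<m. f (n + i))"
  for f :: "nat \<Rightarrow> 'a::comm_monoid_add"
  by (induction m) (simp_all add: add.assoc)

text \<open>Minimality is about families indexed by initial segments, so the family left after
  removing index j has to be renumbered.\<close>

lemma bij_betw_skip:
  assumes "j < n"
  shows "bij_betw (\<lambda>i. if i < j then i else Suc i) {..<n - 1} ({..<n} - {j})"
proof (rule bij_betwI[where g="\<lambda>i. if i < j then i else i - 1"])
qed (use assms in \<open>auto split: if_splits\<close>)

text \<open>Otherwise \<open>b j\<close> could be substituted into its own term:
  \<open>B (a j) (b j)\<close> spreads over the other terms, up to \<open>B (a j) y\<close> in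
  \<open>I\<close>, and a decomposition with n - 1 terms results. \<open>B\<close> is left abstract
  so that both families of factors are covered by exchanging the arguments.\<close>

lemma minimal_sum_independent:
  fixes B :: "('a \<Rightarrow> complex) \<Rightarrow> ('b \<Rightarrow> complex) \<Rightarrow> 'c \<Rightarrow> complex" and n :: nat
  assumes A1: "fun_vs.subspace A1" and A2: "fun_vs.subspace A2" and I: "fun_vs.subspace I"
    and addl: "\<And>x x' y. x \<in> A1 \<Longrightarrow> x' \<in> A1 \<Longrightarrow> y \<in> A2 \<Longrightarrow> B (x + x') y = B x y + B x' y"
    and scalel: "\<And>c x y. x \<in> A1 \<Longrightarrow> y \<in> A2 \<Longrightarrow> B (fscale c x) y = fscale c (B x y)"
    and addr: "\<And>x y y'. x \<in> A1 \<Longrightarrow> y \<in> A2 \<Longrightarrow> y' \<in> A2 \<Longrightarrow> B x (y + y') = B x y + B x y'"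
    and scaler: "\<And>c x y. x \<in> A1 \<Longrightarrow> y \<in> A2 \<Longrightarrow> B x (fscale c y) = fscale c (B x y)"
    and ab: "\<And>i. i < n \<Longrightarrow> a i \<in> A1" "\<And>i. i < n \<Longrightarrow> b i \<in> A2"
    and z: "z - (\<Sum>i<n. B (a i) (b i)) \<in> I"
    and min: "\<And>m a b. m < n \<Longrightarrow> (\<And>i. i < m \<Longrightarrow> a i \<in> A1) \<Longrightarrow> (\<And>i. i < m \<Longrightarrow> b i \<in> A2) \<Longrightarrow>
        z - (\<Sum>i<m. B (a i) (b i)) \<notin> I"
    and j: "j < n" and y: "y \<in> A2" "\<And>x. x \<in> A1 \<Longrightarrow> B x y \<in> I"
  shows "b j \<noteq> (\<Sum>i\<in>{..<n} - {j}. fscale (c i) (b i)) + y"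
proof
  assume bj: "b j = (\<Sum>i\<in>{..<n} - {j}. fscale (c i) (b i)) + y"
  let ?S = "{..<n} - {j}"
  have sumA2: "(\<Sum>i\<in>T. fscale (c i) (b i)) \<in> A2" if "T \<subseteq> {..<n}" for T
    by (rule fun_vs.subspace_sum[OF A2]) (use that ab(2) fun_vs.subspace_scale[OF A2] in auto)
  have Bsum: "B (a j) (\<Sum>i\<in>T. fscale (c i) (b i)) = (\<Sum>i\<in>T. fscale (c i) (B (a j) (b i)))"
    if "finite T" "T \<subseteq> {..<n}" for T
    using that
  proof (induction T rule: finite_induct)
    case empty
    have "B (a j) 0 = 0"
      using scaler[OF ab(1)[OF j] y(1), of 0] unfolding fun_vs.scale_zero_left .
    then show ?case unfolding sum.empty .
  next
    case (insert i T)
    then have "b i \<in> A2" using ab(2) by auto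
    then have "B (a j) (fscale (c i) (b i) + (\<Sum>i\<in>T. fscale (c i) (b i))) =
        fscale (c i) (B (a j) (b i)) + B (a j) (\<Sum>i\<in>T. fscale (c i) (b i))"
      using insert addr[OF ab(1)[OF j] fun_vs.subspace_scale[OF A2] sumA2] scaler[OF ab(1)[OF j]]
      by auto
    moreover have "B (a j) (\<Sum>i\<in>T. fscale (c i) (b i)) = (\<Sum>i\<in>T. fscale (c i) (B (a j) (b i)))"
      using insert by auto
    ultimately show ?case
      unfolding sum.insert[OF insert.hyps(1,2)] by (simp only:)
  qed
  have "B (a j) (b j) = (\<Sum>i\<in>?S. fscale (c i) (B (a j) (b i))) + B (a j) y"
    unfolding bj addr[OF ab(1)[OF j] sumA2[OF Diff_subset] y(1)] Bsum[OF finite_Diff[OF finite_lessThan] Diff_subset] ..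
  moreover have "(\<Sum>i<n. B (a i) (b i)) = B (a j) (b j) + (\<Sum>i\<in>?S. B (a i) (b i))"
    using j by (intro sum.remove) auto
  \<comment> \<open>The multiple \<open>c i\<close> of \<open>b i\<close> contributed by
    \<open>b j\<close> is moved into the left factor of term i.\<close>
  moreover have "(\<Sum>i\<in>?S. B (a i + fscale (c i) (a j)) (b i)) =
      (\<Sum>i\<in>?S. B (a i) (b i)) + (\<Sum>i\<in>?S. fscale (c i) (B (a j) (b i)))"
    unfolding sum.distrib[symmetric]
    by (rule sum.cong) (use ab j addl scalel fun_vs.subspace_scale[OF A1] in auto)
  ultimately have eq: "z - (\<Sum>i\<in>?S. B (a i + fscale (c i) (a j)) (b i)) =
      (z - (\<Sum>i<n. B (a i) (b i))) + B (a j) y"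
    by (simp only: algebra_simps)
  have "z - (\<Sum>i\<in>?S. B (a i + fscale (c i) (a j)) (b i)) \<in> I"
    unfolding eq by (intro fun_vs.subspace_add[OF I] z y ab j)
  moreover have "(\<Sum>i\<in>?S. B (a i + fscale (c i) (a j)) (b i)) =
     (\<Sum>i<n - 1. B (a (if i < j then i else Suc i) + fscale (c (if i < j then i else Suc i)) (a j)) (b (if i < j then i else Suc i)))"
    by (rule sum.reindex_bij_betw[OF bij_betw_skip[OF j], symmetric])
  moreover have "z - (\<Sum>i<n - 1. B (a (if i < j then i else Suc i) + fscale (c (if i < j then i else Suc i)) (a j)) (b (if i < j then i else Suc i))) \<notin> I"
  proof (rule min)
    fix i assume "i < n - 1"
    then have "(if i < j then i else Suc i) < n" by auto
    then show "a (if i < j then i else Suc i) + fscale (c (if i < j then i else Suc i)) (a j) \<in> A1"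
      and "b (if i < j then i else Suc i) \<in> A2"
      by (rule fun_vs.subspace_add[OF A1 ab(1) fun_vs.subspace_scale[OF A1 ab(1)[OF j]]]) (rule ab(2), fact)
  qed (use j in simp)
  ultimately show False
    by (simp only: not_True_eq_False)
qed

lemma subspace_FA: "fun_vs.subspace (FA S)"
  by (rule fun_vs.subspaceI) (auto intro: FA_zero FA_add FA_scale)

text \<open>Separates \<open>b j\<close> from the subspace spanned by \<open>I\<close> and the other
  members of the family.\<close>

lemma dual_functional:
  fixes I :: "('a list \<Rightarrow> complex) set" and b :: "nat \<Rightarrow> 'a list \<Rightarrow> complex"
  assumes I: "fun_vs.subspace I" and fs: "finsupp (b j)" "\<And>i. i < n \<Longrightarrow> finsupp (b i)"
    and ind: "\<And>c y. y \<in> I \<Longrightarrow> b j \<noteq> (\<Sum>i\<in>{..<n} - {j}. fscale (c i) (b i)) + y"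
  obtains \<beta> where "\<And>u. u \<in> I \<Longrightarrow> finsupp u \<Longrightarrow> pairing u \<beta> = 0" "pairing (b j) \<beta> = 1"
    "\<And>i. i < n \<Longrightarrow> i \<noteq> j \<Longrightarrow> pairing (b i) \<beta> = 0"
proof -
  let ?S = "{..<n} - {j}"
  let ?W = "{(\<Sum>i\<in>?S. fscale (c i) (b i)) + y | c y. y \<in> I}"
  have W: "fun_vs.subspace ?W"
  proof (rule fun_vs.subspaceI)
    have "0 = (\<Sum>i\<in>?S. fscale 0 (b i)) + 0" by (auto simp: fscale_def sum_fun_apply)
    then show "0 \<in> ?W" using fun_vs.subspace_0[OF I] by (intro CollectI exI conjI)
  next
    fix u v assume "u \<in> ?W" "v \<in> ?W"
    then obtain c y c' y' where uv: "u = (\<Sum>i\<in>?S. fscale (c i) (b i)) + y" "y \<in> I"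
       "v = (\<Sum>i\<in>?S. fscale (c' i) (b i)) + y'" "y' \<in> I" by blast
    have "u + v = (\<Sum>i\<in>?S. fscale (c i + c' i) (b i)) + (y + y')"
      unfolding uv by (auto simp: sum_fun_apply fscale_def distrib_right sum.distrib)
    moreover have "y + y' \<in> I" using uv fun_vs.subspace_add[OF I] by blast
    ultimately show "u + v \<in> ?W" by (intro CollectI exI conjI)
  next
    fix k u assume "u \<in> ?W"
    then obtain c y where u: "u = (\<Sum>i\<in>?S. fscale (c i) (b i)) + y" "y \<in> I" by blast
    have "fscale k u = (\<Sum>i\<in>?S. fscale (k * c i) (b i)) + fscale k y"
      unfolding u by (auto simp: sum_fun_apply fscale_def distrib_left sum_distrib_left mult.assoc)
    moreover have "fscale k y \<in> I" using u fun_vs.subspace_scale[OF I] by blast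
    ultimately show "fscale k u \<in> ?W" by (intro CollectI exI conjI)
  qed
  have "b j \<notin> ?W" using ind by blast
  then obtain \<beta> where \<beta>: "\<And>u. u \<in> ?W \<Longrightarrow> finsupp u \<Longrightarrow> pairing u \<beta> = 0" "pairing (b j) \<beta> = 1"
    using separating_functional[OF W _ fs(1)] by blast
  show thesis
  proof (rule that[OF _ \<beta>(2)])
    fix u assume u: "u \<in> I" "finsupp u"
    have "u = (\<Sum>i\<in>?S. fscale 0 (b i)) + u" by (auto simp: fscale_def sum_fun_apply)
    then have "u \<in> ?W" using u(1) by (intro CollectI exI conjI)
    then show "pairing u \<beta> = 0" using \<beta>(1) u by blast
  next
    fix i assume i: "i < n" "i \<noteq> j"
    have "(\<Sum>k\<in>?S. fscale (if k = i then 1 else 0) (b k)) = (\<Sum>k\<in>?S. if k = i then b k else 0)"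
      by (rule sum.cong) (auto simp: fscale_def)
    then have "b i = (\<Sum>k\<in>?S. fscale (if k = i then 1 else 0) (b k)) + 0"
      using i by simp
    then have "b i \<in> ?W" using fun_vs.subspace_0[OF I] by (intro CollectI exI conjI)
    then show "pairing (b i) \<beta> = 0" using \<beta>(1) fs(2)[OF i(1)] by blast
  qed
qed

section \<open>Decompositions into products of the two factors\<close>

context group_pair
begin

abbreviation "inL \<equiv> push_words (\<lambda>X. blk X (0 :: complex^'m^'m))"
abbreviation "inR \<equiv> push_words (\<lambda>Y. blk (0 :: complex^'n^'n) Y)"

lemma inL_FA: "u \<in> FA L \<Longrightarrow> inL u \<in> FA N"
  by (rule FA_push) (auto simp: blk_in_N_iff M.zero_mem)

lemma inR_FA: "u \<in> FA M \<Longrightarrow> inR u \<in> FA N"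
  by (rule FA_push) (auto simp: blk_in_N_iff L.zero_mem)

text \<open>The bracket of the two letters is the matrix 0, so the bracket relation leaves behind
  the letter 0, which \<open>zero_letter\<close> removes.\<close>

lemma letters_commute:
  assumes "X \<in> L" "Y \<in> M"
  shows "fmul (word_ind [blk 0 Y]) (word_ind [blk X 0]) - fmul (word_ind [blk X 0]) (word_ind [blk 0 Y]) \<in> uea_ideal N"
proof -
  have "bracket (blk 0 Y) (blk X 0) = 0"
    by (simp add: blk_bracket) (simp add: bracket_def vec_eq_iff matrix_matrix_mult_def flip: blk_zero)
  then have "word_ind [blk 0 Y, blk X 0] - word_ind [blk X 0, blk 0 Y] - word_ind [0] \<in> uea_ideal N"
    using N.bracket_relation[of "blk 0 Y" "blk X 0"] assms by (simp add: blk_in_N_iff L.zero_mem M.zero_mem)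
  from N.I_closed(3)[OF this N.zero_letter] show ?thesis
    by (simp add: fmul_word)
qed

text \<open>The commutator with a letter y is a derivation: y x i - x i y = (y x - x y) i + x (y i -
  i y), so induction along the words of u reduces the claim to single letters.\<close>

lemma commute_letter:
  assumes Y: "Y \<in> M" and u: "u \<in> FA L"
  shows "fmul (word_ind [blk 0 Y]) (inL u) - fmul (inL u) (word_ind [blk 0 Y]) \<in> uea_ideal N"
  using u
proof (induction rule: FA_induct)
  case zero
  have "fmul (word_ind [blk 0 Y]) (inL 0) - fmul (inL 0) (word_ind [blk 0 Y]) \<in> uea_ideal N"
    using N.I_closed(2) by simp
  then show ?case .
next
  case (word w)
  let ?y = "word_ind [blk 0 Y]"
  have y: "?y \<in> FA N" using Y by (intro FA_word) (simp add: blk_in_N_iff L.zero_mem)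
  show ?case
    using word
  proof (induction w)
    case Nil
    show ?case using N.I_closed(2) by (simp add: push_word fmul_one del: zero_fun_apply minus_apply)
  next
    case (Cons X w)
    let ?x = "word_ind [blk X 0]" and ?i = "inL (word_ind w)"
    have x: "?x \<in> FA N" using Cons by (intro FA_word) (simp add: blk_in_N_iff M.zero_mem)
    have i: "?i \<in> FA N" using Cons by (intro inL_FA FA_word) simp
    have "inL (word_ind (X # w)) = fmul ?x ?i"
      by (simp add: push_word fmul_word)
    then have "fmul ?y (inL (word_ind (X # w))) - fmul (inL (word_ind (X # w))) ?y =
        fmul (fmul ?y ?x - fmul ?x ?y) ?i + fmul ?x (fmul ?y ?i - fmul ?i ?y)"
      using x y i by (simp add: fmul_diff_left fmul_diff_right fmul_assoc FA_finsupp)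
    also have "\<dots> \<in> uea_ideal N"
    proof (rule N.I_closed(3)[OF N.I_closed(5)[OF _ i] N.I_closed(4)[OF _ x]])
      show "fmul ?y ?x - fmul ?x ?y \<in> uea_ideal N" using Cons.prems by (intro letters_commute Y) simp
      show "fmul ?y ?i - fmul ?i ?y \<in> uea_ideal N" using Cons by (simp del: minus_apply)
    qed
    finally show ?case .
  qed
next
  case (add x y)
  from N.I_closed(3)[OF add.IH] show ?case
    by (simp only: push_add[OF add.hyps[THEN FA_finsupp]] fmul_add_left fmul_add_right algebra_simps)
next
  case (scale c x)
  from N.I_closed(6)[OF scale.IH, of c] show ?case
    by (simp only: push_scale[OF scale.hyps[THEN FA_finsupp]] fmul_scale_left fmul_scale_right fun_vs.scale_right_diff_distrib)
qed

text \<open>The same derivation argument, now along the words of v.\<close>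

lemma inR_inL_commute:
  assumes v: "v \<in> FA M" and u: "u \<in> FA L"
  shows "fmul (inR v) (inL u) - fmul (inL u) (inR v) \<in> uea_ideal N"
  using v
proof (induction rule: FA_induct)
  case zero
  have "fmul (inR 0) (inL u) - fmul (inL u) (inR 0) \<in> uea_ideal N"
    using N.I_closed(2) by simp
  then show ?case .
next
  case (word w)
  have i: "inL u \<in> FA N" using u by (rule inL_FA)
  show ?case
    using word
  proof (induction w)
    case Nil
    show ?case using N.I_closed(2) by (simp add: push_word fmul_one del: zero_fun_apply minus_apply)
  next
    case (Cons Y w)
    let ?y = "word_ind [blk 0 Y]" and ?j = "inR (word_ind w)"
    have y: "?y \<in> FA N" using Cons by (intro FA_word) (simp add: blk_in_N_iff L.zero_mem)
    have j: "?j \<in> FA N" using Cons by (intro inR_FA FA_word) simp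
    have "inR (word_ind (Y # w)) = fmul ?y ?j"
      by (simp add: push_word fmul_word)
    then have "fmul (inR (word_ind (Y # w))) (inL u) - fmul (inL u) (inR (word_ind (Y # w))) =
        fmul ?y (fmul ?j (inL u) - fmul (inL u) ?j) + fmul (fmul ?y (inL u) - fmul (inL u) ?y) ?j"
      using j y i by (simp add: fmul_diff_left fmul_diff_right fmul_assoc FA_finsupp)
    also have "\<dots> \<in> uea_ideal N"
    proof (rule N.I_closed(3)[OF N.I_closed(4)[OF _ y] N.I_closed(5)[OF _ j]])
      show "fmul ?j (inL u) - fmul (inL u) ?j \<in> uea_ideal N" using Cons by (simp del: minus_apply)
      show "fmul ?y (inL u) - fmul (inL u) ?y \<in> uea_ideal N" using Cons.prems by (intro commute_letter u) simp
    qed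
    finally show ?case .
  qed
next
  case (add x y)
  from N.I_closed(3)[OF add.IH] show ?case
    by (simp only: push_add[OF add.hyps[THEN FA_finsupp]] fmul_add_left fmul_add_right algebra_simps)
next
  case (scale c x)
  from N.I_closed(6)[OF scale.IH, of c] show ?case
    by (simp only: push_scale[OF scale.hyps[THEN FA_finsupp]] fmul_scale_left fmul_scale_right fun_vs.scale_right_diff_distrib)
qed

text \<open>The factors are indexed by the natural numbers below n so that the number of terms can
  be minimised.\<close>

definition decomposition :: "nat \<Rightarrow> (nat \<Rightarrow> (complex^'n^'n) list \<Rightarrow> complex) \<Rightarrow> (nat \<Rightarrow> (complex^'m^'m) list \<Rightarrow> complex)
    \<Rightarrow> ((complex^('n + 'm)^('n + 'm)) list \<Rightarrow> complex) \<Rightarrow> bool" where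
  "decomposition n a b z \<longleftrightarrow> (\<forall>i<n. a i \<in> FA L \<and> b i \<in> FA M) \<and>
     z - (\<Sum>i<n. fmul (inL (a i)) (inR (b i))) \<in> uea_ideal N"

lemma decomposition_cong:
  assumes "decomposition n a b z" "z' - z \<in> uea_ideal N"
  shows "decomposition n a b z'"
proof -
  have "z' - (\<Sum>i<n. fmul (inL (a i)) (inR (b i))) = (z' - z) + (z - (\<Sum>i<n. fmul (inL (a i)) (inR (b i))))"
    by simp
  also have "\<dots> \<in> uea_ideal N"
    using assms by (intro N.I_closed(3)) (simp_all only: decomposition_def)
  finally show ?thesis
    using assms(1) by (simp add: decomposition_def)
qed

lemma decomposition_add:
  assumes "decomposition n a b z" "decomposition m a' b' z'"
  shows "decomposition (n + m) (\<lambda>i. if i < n then a i else a' (i - n)) (\<lambda>i. if i < n then b i else b' (i - n)) (z + z')"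
proof -
  let ?f = "\<lambda>i. fmul (inL (if i < n then a i else a' (i - n))) (inR (if i < n then b i else b' (i - n)))"
  have "(\<Sum>i<n + m. ?f i) = (\<Sum>i<n. fmul (inL (a i)) (inR (b i))) + (\<Sum>i<m. fmul (inL (a' i)) (inR (b' i)))"
    unfolding sum_lessThan_add by simp
  then have "z + z' - (\<Sum>i<n + m. ?f i) = (z - (\<Sum>i<n. fmul (inL (a i)) (inR (b i)))) + (z' - (\<Sum>i<m. fmul (inL (a' i)) (inR (b' i))))"
    by (simp only: algebra_simps)
  also have "\<dots> \<in> uea_ideal N"
    using assms by (intro N.I_closed(3)) (simp_all add: decomposition_def)
  finally show ?thesis
    using assms by (auto simp: decomposition_def)
qed

lemma decomposition_scale:
  assumes "decomposition n a b z"
  shows "decomposition n (\<lambda>i. fscale c (a i)) b (fscale c z)"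
proof -
  have "(\<Sum>i<n. fmul (inL (fscale c (a i))) (inR (b i))) = (\<Sum>i<n. fscale c (fmul (inL (a i)) (inR (b i))))"
    by (rule sum.cong) (use assms in \<open>auto simp: decomposition_def push_scale FA_finsupp fmul_scale_left\<close>)
  then have "fscale c z - (\<Sum>i<n. fmul (inL (fscale c (a i))) (inR (b i))) =
      fscale c (z - (\<Sum>i<n. fmul (inL (a i)) (inR (b i))))"
    by (simp only: fun_vs.scale_sum_right fun_vs.scale_right_diff_distrib)
  also have "\<dots> \<in> uea_ideal N"
    using assms by (intro N.I_closed(6)) (simp only: decomposition_def)
  finally show ?thesis
    using assms by (simp add: decomposition_def FA_scale)
qed

lemma decomposition_left_letter:
  assumes "decomposition n a b z" and X: "X \<in> L"
  shows "decomposition n (\<lambda>i. fmul (word_ind [X]) (a i)) b (fmul (word_ind [blk X 0]) z)"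
proof -
  have x: "word_ind [X] \<in> FA L" using X by (intro FA_word) simp
  have x': "word_ind [blk X 0] \<in> FA N" using X by (intro FA_word) (simp add: blk_in_N_iff M.zero_mem)
  have "(\<Sum>i<n. fmul (inL (fmul (word_ind [X]) (a i))) (inR (b i))) = (\<Sum>i<n. fmul (word_ind [blk X 0]) (fmul (inL (a i)) (inR (b i))))"
  proof (rule sum.cong[OF refl])
    fix i assume "i \<in> {..<n}"
    then have "finsupp (a i)" "finsupp (b i)" using assms FA_finsupp by (auto simp: decomposition_def)
    then show "fmul (inL (fmul (word_ind [X]) (a i))) (inR (b i)) = fmul (word_ind [blk X 0]) (fmul (inL (a i)) (inR (b i)))"
      by (simp add: push_fmul finsupp_word push_word fmul_assoc finsupp_push)
  qed
  then have "fmul (word_ind [blk X 0]) z - (\<Sum>i<n. fmul (inL (fmul (word_ind [X]) (a i))) (inR (b i))) =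
      fmul (word_ind [blk X 0]) (z - (\<Sum>i<n. fmul (inL (a i)) (inR (b i))))"
    by (simp only: fmul_sum_right fmul_diff_right)
  also have "\<dots> \<in> uea_ideal N"
    using assms by (intro N.I_closed(4) x') (simp only: decomposition_def)
  finally show ?thesis
    using assms by (simp add: decomposition_def FA_fmul[OF x])
qed

text \<open>A new letter enters on the far left and has to pass \<open>inL (a i)\<close> to join the
  second factor; the error comes from a commutator and lies in the ideal.\<close>

lemma decomposition_right_letter:
  assumes dec: "decomposition n a b z" and Y: "Y \<in> M"
  shows "decomposition n a (\<lambda>i. fmul (word_ind [Y]) (b i)) (fmul (word_ind [blk 0 Y]) z)"
proof -
  let ?y = "word_ind [blk 0 Y]"
  have y: "word_ind [Y] \<in> FA M" using Y by (intro FA_word) simp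
  have y': "?y \<in> FA N" using Y by (intro FA_word) (simp add: blk_in_N_iff L.zero_mem)
  have comm: "fmul ?y (fmul (inL (a i)) (inR (b i))) - fmul (inL (a i)) (inR (fmul (word_ind [Y]) (b i))) \<in> uea_ideal N"
    if "i < n" for i
  proof -
    have ai: "a i \<in> FA L" and bi: "b i \<in> FA M" using dec that by (auto simp: decomposition_def)
    have "fmul ?y (fmul (inL (a i)) (inR (b i))) - fmul (inL (a i)) (inR (fmul (word_ind [Y]) (b i))) =
        fmul (fmul ?y (inL (a i)) - fmul (inL (a i)) ?y) (inR (b i))"
      using ai bi by (simp add: push_fmul finsupp_word push_word fmul_assoc finsupp_push FA_finsupp fmul_diff_left)
    then show ?thesis
      using N.I_closed(5)[OF commute_letter[OF Y ai] inR_FA[OF bi]] by simp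
  qed
  have "fmul ?y z - (\<Sum>i<n. fmul (inL (a i)) (inR (fmul (word_ind [Y]) (b i)))) =
      fmul ?y (z - (\<Sum>i<n. fmul (inL (a i)) (inR (b i)))) +
      (\<Sum>i<n. fmul ?y (fmul (inL (a i)) (inR (b i))) - fmul (inL (a i)) (inR (fmul (word_ind [Y]) (b i))))"
    by (simp only: fmul_sum_right fmul_diff_right sum_subtractf algebra_simps)
  also have "\<dots> \<in> uea_ideal N"
  proof (rule N.I_closed(3)[OF N.I_closed(4)[OF _ y'] N.I_sum])
    show "z - (\<Sum>i<n. fmul (inL (a i)) (inR (b i))) \<in> uea_ideal N"
      using dec by (simp only: decomposition_def)
  qed (use comm in simp)
  finally show ?thesis
    using dec by (simp add: decomposition_def FA_fmul[OF y])
qed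

lemma decomposition_exists:
  assumes "z \<in> FA N"
  shows "\<exists>n a b. decomposition n a b z"
  using assms
proof (induction rule: FA_induct)
  case zero
  have "decomposition 0 (\<lambda>i. 0) (\<lambda>i. 0) 0"
    using N.I_closed(2) by (simp add: decomposition_def)
  then show ?case by blast
next
  case (word w)
  then show ?case
  proof (induction w)
    case Nil
    have "decomposition 1 (\<lambda>i. word_ind []) (\<lambda>i. word_ind []) (word_ind [])"
      using N.I_closed(2) by (simp add: decomposition_def FA_word push_word fmul_one)
    then show ?case by blast
  next
    case (Cons Z w)
    then obtain n a b where d: "decomposition n a b (word_ind w)" by auto
    obtain X Y where XY: "X \<in> L" "Y \<in> M" and Z: "Z = blk X Y"
      using Cons.prems N_iff by auto
    have m1: "msmult 1 Z = Z" for Z :: "complex^'k^'k"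
      by (simp add: msmult_def map_matrix_def vec_eq_iff)
    have f1: "fscale 1 u = u" for u :: "'k \<Rightarrow> complex"
      by (simp add: fscale_def)
    have in_N: "blk X 0 \<in> N" "blk 0 Y \<in> N"
      using XY by (simp_all add: blk_in_N_iff L.zero_mem M.zero_mem)
    have ww: "word_ind w \<in> FA N" using Cons by (intro FA_word) simp
    \<comment> \<open>The linear relation with both coefficients 1 splits the letter
      \<open>Z\<close> into its two diagonal blocks.\<close>
    have "word_ind [Z] - word_ind [blk X 0] - word_ind [blk 0 Y] \<in> uea_ideal N"
      using N.linear_relation[OF in_N, of 1 1] unfolding m1 f1 by (simp add: blk_add Z)
    from N.I_closed(5)[OF this ww]
    have "word_ind (Z # w) - (fmul (word_ind [blk X 0]) (word_ind w) + fmul (word_ind [blk 0 Y]) (word_ind w)) \<in> uea_ideal N"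
      by (simp add: fmul_diff_left fmul_word) (simp only: diff_diff_eq)
    then show ?case
      using decomposition_cong[OF decomposition_add[OF decomposition_left_letter[OF d XY(1)] decomposition_right_letter[OF d XY(2)]]]
      by blast
  qed
next
  case (add u v)
  then show ?case using decomposition_add by blast
next
  case (scale c u)
  then show ?case using decomposition_scale by blast
qed

end

section \<open>Tensor products of functionals\<close>

context group_pair
begin

text \<open>
  \<open>U(\<gg> \<oplus> \<hh>)\<close> acts by right translation on the linear functionals of \<open>U(\<gg>) \<otimes> U(\<hh>)\<close>, which are
  functions on pairs of words; evaluation at the pair of empty words turns \<open>\<alpha> \<otimes> \<beta>\<close> into a functional
  on \<open>U(\<gg> \<oplus> \<hh>)\<close>.
\<close>
definition tensor_op :: "complex^('n + 'm)^('n + 'm) \<Rightarrow> ((complex^'n^'n) list \<times> (complex^'m^'m) list \<Rightarrow> complex)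
    \<Rightarrow> (complex^'n^'n) list \<times> (complex^'m^'m) list \<Rightarrow> complex" where
  "tensor_op Z T = (\<lambda>(a, b). T (a @ [ul Z], b) + T (a, b @ [lr Z]))"

text \<open>These are the functionals on the tensor product of the two enveloping algebras: in each
  variable they vanish on the ideal. Requiring the value 0 on words with foreign letters lets
  identities hold for all pairs of words.\<close>

definition tensor_dual :: "((complex^'n^'n) list \<times> (complex^'m^'m) list \<Rightarrow> complex) set" where
  "tensor_dual = {T. (\<forall>a b. \<not> (set a \<subseteq> L \<and> set b \<subseteq> M) \<longrightarrow> T (a, b) = 0) \<and>
     (\<forall>b. \<forall>u\<in>uea_ideal L. pairing u (\<lambda>a. T (a, b)) = 0) \<and>
     (\<forall>a. \<forall>v\<in>uea_ideal M. pairing v (\<lambda>b. T (a, b)) = 0)}"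

text \<open>The ideal absorbs a prefix from the left. This allows relations to be applied at the end
  of a word already accumulated by \<open>tensor_op\<close>.\<close>

lemma tensor_dual_left:
  assumes T: "T \<in> tensor_dual" and u: "u \<in> uea_ideal L" and x: "set x \<subseteq> L"
  shows "pairing u (\<lambda>a. T (x @ a, b)) = 0"
proof -
  have "fmul (word_ind x) u \<in> uea_ideal L"
    using u x by (intro L.I_closed(4) FA_word)
  then have "pairing (fmul (word_ind x) u) (\<lambda>a. T (a, b)) = 0"
    using T by (simp add: tensor_dual_def)
  then show ?thesis
    using FA_finsupp[OF L.I_closed(1)[OF u]] by (simp add: pairing_fmul finsupp_word)
qed

lemma tensor_dual_right:
  assumes T: "T \<in> tensor_dual" and v: "v \<in> uea_ideal M" and y: "set y \<subseteq> M"
  shows "pairing v (\<lambda>b. T (a, y @ b)) = 0"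
proof -
  have "fmul (word_ind y) v \<in> uea_ideal M"
    using v y by (intro M.I_closed(4) FA_word)
  then have "pairing (fmul (word_ind y) v) (\<lambda>b. T (a, b)) = 0"
    using T by (simp add: tensor_dual_def)
  then show ?thesis
    using FA_finsupp[OF M.I_closed(1)[OF v]] by (simp add: pairing_fmul finsupp_word)
qed

text \<open>The ideal absorbs a letter from the right; this makes \<open>tensor_dual\<close> stable
  under \<open>tensor_op\<close>.\<close>

lemma tensor_dual_right_append:
  assumes T: "T \<in> tensor_dual" and u: "u \<in> uea_ideal L" and X: "X \<in> L"
  shows "pairing u (\<lambda>a. T (a @ [X], b)) = 0"
proof -
  have "fmul u (word_ind [X]) \<in> uea_ideal L"
    using u X by (intro L.I_closed(5) FA_word) auto
  then have "pairing (fmul u (word_ind [X])) (\<lambda>a. T (a, b)) = 0"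
    using T by (simp add: tensor_dual_def)
  then show ?thesis
    using FA_finsupp[OF L.I_closed(1)[OF u]] by (simp add: pairing_fmul finsupp_word)
qed

lemma tensor_dual_right_append':
  assumes T: "T \<in> tensor_dual" and v: "v \<in> uea_ideal M" and Y: "Y \<in> M"
  shows "pairing v (\<lambda>b. T (a, b @ [Y])) = 0"
proof -
  have "fmul v (word_ind [Y]) \<in> uea_ideal M"
    using v Y by (intro M.I_closed(5) FA_word) auto
  then have "pairing (fmul v (word_ind [Y])) (\<lambda>b. T (a, b)) = 0"
    using T by (simp add: tensor_dual_def)
  then show ?thesis
    using FA_finsupp[OF M.I_closed(1)[OF v]] by (simp add: pairing_fmul finsupp_word)
qed

lemma tensor_dual_off: "T \<in> tensor_dual \<Longrightarrow> \<not> (set a \<subseteq> L \<and> set b \<subseteq> M) \<Longrightarrow> T (a, b) = 0"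
  unfolding tensor_dual_def by blast

lemma tensor_dual_linear:
  assumes T: "T \<in> tensor_dual" and X: "X \<in> L" "X' \<in> L" and Y: "Y \<in> M" "Y' \<in> M"
  shows "T (a @ [msmult c X + msmult d X'], b) = c * T (a @ [X], b) + d * T (a @ [X'], b)" (is ?l)
    and "T (a, b @ [msmult c Y + msmult d Y']) = c * T (a, b @ [Y]) + d * T (a, b @ [Y'])" (is ?r)
    and "T (a @ [bracket X X'], b) = T (a @ [X, X'], b) - T (a @ [X', X], b)" (is ?bl)
    and "T (a, b @ [bracket Y Y']) = T (a, b @ [Y, Y']) - T (a, b @ [Y', Y])" (is ?br)
proof -
  have lin: "pairing (word_ind [u] - fscale c (word_ind [v]) - fscale d (word_ind [w])) \<alpha> = \<alpha> [u] - c * \<alpha> [v] - d * \<alpha> [w]"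
    for u v w :: 'k and \<alpha>
    by (simp only: pairing_diff finsupp_diff finsupp_scale finsupp_word pairing_scale pairing_word)
  have br: "pairing (word_ind [v, w] - word_ind [w, v] - word_ind [u]) \<alpha> = \<alpha> [v, w] - \<alpha> [w, v] - \<alpha> [u]"
    for u v w :: 'k and \<alpha>
    by (simp only: pairing_diff finsupp_diff finsupp_word pairing_word)
  show ?l
  proof (cases "set a \<subseteq> L")
    case True
    show ?thesis using tensor_dual_left[OF T L.linear_relation[OF X, of c d] True, where b=b] unfolding lin by (simp add: algebra_simps)
  qed (simp add: tensor_dual_off[OF T])
  show ?bl
  proof (cases "set a \<subseteq> L")
    case True
    show ?thesis using tensor_dual_left[OF T L.bracket_relation[OF X] True, where b=b] unfolding br by (simp add: algebra_simps)
  qed (simp add: tensor_dual_off[OF T])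
  show ?r
  proof (cases "set b \<subseteq> M")
    case True
    show ?thesis using tensor_dual_right[OF T M.linear_relation[OF Y, of c d] True, where a=a] unfolding lin by (simp add: algebra_simps)
  qed (simp add: tensor_dual_off[OF T])
  show ?br
  proof (cases "set b \<subseteq> M")
    case True
    show ?thesis using tensor_dual_right[OF T M.bracket_relation[OF Y] True, where a=a] unfolding br by (simp add: algebra_simps)
  qed (simp add: tensor_dual_off[OF T])
qed

lemma tensor_dual_zero_letter:
  assumes T: "T \<in> tensor_dual"
  shows "T (a @ [0], b) = 0" "T (a, b @ [0]) = 0"
proof -
  have m0: "msmult 0 0 + msmult 0 0 = (0 :: complex^'n^'n)" "msmult 0 0 + msmult 0 0 = (0 :: complex^'m^'m)"
    by (simp_all add: msmult_def map_matrix_def vec_eq_iff)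
  show "T (a @ [0], b) = 0" "T (a, b @ [0]) = 0"
    using tensor_dual_linear(1,2)[OF T L.zero_mem L.zero_mem M.zero_mem M.zero_mem, where a=a and b=b and c=0 and d=0]
    unfolding m0 by simp_all
qed

text \<open>Appending a letter to the first word commutes with appending one to the second, so the
  mixed terms of a commutator cancel and the bracket relations of the two factors remain.\<close>

lemma lie_rep_tensor: "lie_rep N tensor_op tensor_dual"
proof
  fix T T' :: "(complex^'n^'n) list \<times> (complex^'m^'m) list \<Rightarrow> complex" and c :: complex
  assume T: "T \<in> tensor_dual"
  show "fscale c T \<in> tensor_dual"
    using T by (simp add: tensor_dual_def fscale_def pairing_mult_right)
  assume T': "T' \<in> tensor_dual"
  show "T + T' \<in> tensor_dual"
    using T T' by (simp add: tensor_dual_def pairing_add_right)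
next
  fix Z T assume "Z \<in> N" and T: "T \<in> tensor_dual"
  then obtain X Y where XY: "X \<in> L" "Y \<in> M" and Z: "Z = blk X Y" using N_iff by auto
  show "tensor_op Z T \<in> tensor_dual"
    unfolding tensor_dual_def mem_Collect_eq
  proof (intro conjI allI impI ballI)
    fix a b assume "\<not> (set a \<subseteq> L \<and> set b \<subseteq> M)"
    then show "tensor_op Z T (a, b) = 0"
      using tensor_dual_off[OF T] by (simp add: tensor_op_def)
  next
    fix b u assume u: "u \<in> uea_ideal L"
    show "pairing u (\<lambda>a. tensor_op Z T (a, b)) = 0"
      using tensor_dual_right_append[OF T u XY(1)] tensor_dual_left[OF T u, of "[]"]
      by (simp add: tensor_op_def Z pairing_add_right)
  next
    fix a v assume v: "v \<in> uea_ideal M"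
    show "pairing v (\<lambda>b. tensor_op Z T (a, b)) = 0"
      using tensor_dual_right_append'[OF T v XY(2)] tensor_dual_right[OF T v, of "[]"]
      by (simp add: tensor_op_def Z pairing_add_right)
  qed
next
  fix Z Z' T c d assume "Z \<in> N" "Z' \<in> N" and T: "T \<in> tensor_dual"
  then obtain X Y X' Y' where XY: "X \<in> L" "X' \<in> L" "Y \<in> M" "Y' \<in> M" and Z: "Z = blk X Y" "Z' = blk X' Y'"
    using N_iff by auto
  note lin = tensor_dual_linear[OF T XY]
  show "tensor_op (msmult c Z + msmult d Z') T = fscale c (tensor_op Z T) + fscale d (tensor_op Z' T)"
    by (auto simp: tensor_op_def Z blk_msmult blk_add lin fscale_def algebra_simps)
  show "tensor_op (bracket Z Z') T = tensor_op Z (tensor_op Z' T) - tensor_op Z' (tensor_op Z T)"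
    by (auto simp: tensor_op_def Z blk_bracket lin)
qed (auto simp: tensor_op_def fscale_def algebra_simps)

text \<open>A letter \<open>blk X 0\<close> also appends 0 to the second word, but that term
  vanishes by \<open>tensor_dual_zero_letter\<close>.\<close>

lemma foldr_tensor_left:
  assumes T: "T \<in> tensor_dual" and "set w \<subseteq> L"
  shows "foldr tensor_op (map (\<lambda>X. blk X 0) w) T (a, b) = T (a @ w, b)"
  using assms(2)
proof (induction w arbitrary: a b)
  case (Cons X w)
  then show ?case
    using tensor_dual_zero_letter(2)[OF T] by (simp add: tensor_op_def[of "blk X 0"])
qed simp

lemma foldr_tensor_right:
  assumes T: "T \<in> tensor_dual" and "set w \<subseteq> M"
  shows "foldr tensor_op (map (\<lambda>Y. blk 0 Y) w) T (a, b) = T (a, b @ w)"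
  using assms(2)
proof (induction w arbitrary: a b)
  case (Cons Y w)
  then show ?case
    using tensor_dual_zero_letter(1)[OF T] by (simp add: tensor_op_def[of "blk 0 Y"])
qed simp

text \<open>Cutting \<alpha> and \<beta> off outside the two alphabets serves to place their product
  in \<open>tensor_dual\<close>; pairings with elements of the free algebras do not notice it
  (\<open>pairing_restrict\<close>).\<close>

definition tensor_functional ::
  "((complex^'n^'n) list \<Rightarrow> complex) \<Rightarrow> ((complex^'m^'m) list \<Rightarrow> complex)
    \<Rightarrow> ((complex^('n + 'm)^('n + 'm)) list \<Rightarrow> complex) \<Rightarrow> complex" where
  "tensor_functional \<alpha> \<beta> z = word_action tensor_op z
     (\<lambda>(a, b). (if set a \<subseteq> L then \<alpha> a else 0) * (if set b \<subseteq> M then \<beta> b else 0)) ([], [])"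

context
  fixes \<alpha> :: "(complex^'n^'n) list \<Rightarrow> complex" and \<beta> :: "(complex^'m^'m) list \<Rightarrow> complex"
  assumes \<alpha>: "\<And>u. u \<in> uea_ideal L \<Longrightarrow> pairing u \<alpha> = 0" and \<beta>: "\<And>v. v \<in> uea_ideal M \<Longrightarrow> pairing v \<beta> = 0"
begin

lemma pairing_restrict:
  "u \<in> FA L \<Longrightarrow> pairing u (\<lambda>a. if set a \<subseteq> L then \<alpha> a else 0) = pairing u \<alpha>"
  "v \<in> FA M \<Longrightarrow> pairing v (\<lambda>b. if set b \<subseteq> M then \<beta> b else 0) = pairing v \<beta>"
  by (rule pairing_cong, simp add: FA_iff)+

lemma tensor_in_dual:
  "(\<lambda>(a, b). (if set a \<subseteq> L then \<alpha> a else 0) * (if set b \<subseteq> M then \<beta> b else 0)) \<in> tensor_dual"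
  unfolding tensor_dual_def mem_Collect_eq
proof (intro conjI allI impI ballI)
  fix b u assume u: "u \<in> uea_ideal L"
  then have "pairing u (\<lambda>a. if set a \<subseteq> L then \<alpha> a else 0) = 0"
    using \<alpha> pairing_restrict(1)[OF L.I_closed(1)] by simp
  then show "pairing u (\<lambda>a. case (a, b) of (a, b) \<Rightarrow> (if set a \<subseteq> L then \<alpha> a else 0) * (if set b \<subseteq> M then \<beta> b else 0)) = 0"
    using pairing_mult_right[of u "if set b \<subseteq> M then \<beta> b else 0" "\<lambda>a. if set a \<subseteq> L then \<alpha> a else 0"]
    by (simp only: split mult.commute mult_zero_right mult_zero_left)
next
  fix a v assume v: "v \<in> uea_ideal M"
  then have "pairing v (\<lambda>b. if set b \<subseteq> M then \<beta> b else 0) = 0"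
    using \<beta> pairing_restrict(2)[OF M.I_closed(1)] by simp
  then show "pairing v (\<lambda>b. case (a, b) of (a, b) \<Rightarrow> (if set a \<subseteq> L then \<alpha> a else 0) * (if set b \<subseteq> M then \<beta> b else 0)) = 0"
    unfolding split pairing_mult_right by (simp only: mult_zero_right)
qed auto

lemma tensor_functional_ideal: "z \<in> uea_ideal N \<Longrightarrow> tensor_functional \<alpha> \<beta> z = 0"
  unfolding tensor_functional_def
  using lie_rep.word_action_ideal[OF lie_rep_tensor N.lie_subalg_axioms _ tensor_in_dual] by simp

text \<open>\<open>inR b\<close> acts first and only lengthens the second word, then
  \<open>inL a\<close> lengthens the first; at the pair of empty words the product of the two
  pairings remains.\<close>

lemma tensor_functional_mult:
  assumes a: "a \<in> FA L" and b: "b \<in> FA M"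
  shows "tensor_functional \<alpha> \<beta> (fmul (inL a) (inR b)) = pairing a \<alpha> * pairing b \<beta>"
proof -
  interpret lie_rep N tensor_op tensor_dual by (rule lie_rep_tensor)
  let ?T = "\<lambda>(a, b). (if set a \<subseteq> L then \<alpha> a else 0) * (if set b \<subseteq> M then \<beta> b else 0)"
  have R: "word_action tensor_op (inR b) ?T (x, []) = pairing b (\<lambda>w. ?T (x, w))" for x
  proof -
    have "word_action tensor_op (inR b) ?T (x, []) = pairing b (\<lambda>w. foldr tensor_op (map (\<lambda>Y. blk 0 Y) w) ?T (x, []))"
      using b by (simp only: word_action_pairing pairing_push[OF FA_finsupp])
    also have "\<dots> = pairing b (\<lambda>w. ?T (x, w))"
      by (rule pairing_cong) (use b foldr_tensor_right[OF tensor_in_dual, of _ x "[]"] in \<open>simp add: FA_iff\<close>)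
    finally show ?thesis .
  qed
  have RV: "word_action tensor_op (inR b) ?T \<in> tensor_dual"
    by (rule word_action_closed[OF inR_FA[OF b] tensor_in_dual])
  have "tensor_functional \<alpha> \<beta> (fmul (inL a) (inR b)) = word_action tensor_op (inL a) (word_action tensor_op (inR b) ?T) ([], [])"
    unfolding tensor_functional_def by (subst word_action_fmul[OF inL_FA[OF a] inR_FA[OF b] tensor_in_dual]) (rule refl)
  also have "\<dots> = pairing a (\<lambda>w. foldr tensor_op (map (\<lambda>X. blk X 0) w) (word_action tensor_op (inR b) ?T) ([], []))"
    using a by (simp only: word_action_pairing pairing_push[OF FA_finsupp])
  also have "\<dots> = pairing a (\<lambda>w. pairing b (\<lambda>w'. ?T (w, w')))"
    by (rule pairing_cong) (use a R foldr_tensor_left[OF RV, of _ "[]" "[]"] in \<open>simp add: FA_iff\<close>)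
  also have "\<dots> = pairing a (\<lambda>w. (if set w \<subseteq> L then \<alpha> w else 0) * pairing b \<beta>)"
    unfolding split pairing_mult_right pairing_restrict(2)[OF b] ..
  also have "\<dots> = pairing a \<alpha> * pairing b \<beta>"
    using pairing_mult_right[of a "pairing b \<beta>" "\<lambda>w. if set w \<subseteq> L then \<alpha> w else 0"] pairing_restrict(1)[OF a]
    by (simp add: mult.commute)
  finally show ?thesis .
qed

lemma tensor_functional_diff:
  "finsupp z \<Longrightarrow> finsupp z' \<Longrightarrow> tensor_functional \<alpha> \<beta> (z - z') = tensor_functional \<alpha> \<beta> z - tensor_functional \<alpha> \<beta> z'"
  by (simp add: tensor_functional_def word_action_diff)

lemma tensor_functional_cong:
  assumes "z \<in> FA N" "z' \<in> FA N" "z - z' \<in> uea_ideal N"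
  shows "tensor_functional \<alpha> \<beta> z = tensor_functional \<alpha> \<beta> z'"
  using tensor_functional_ideal[OF assms(3)] tensor_functional_diff[OF assms(1,2)[THEN FA_finsupp]] by simp

lemma tensor_functional_sum:
  assumes "\<And>i. i < n \<Longrightarrow> a i \<in> FA L" "\<And>i. i < n \<Longrightarrow> b i \<in> FA M"
  shows "tensor_functional \<alpha> \<beta> (\<Sum>i<n. fmul (inL (a i)) (inR (b i))) = (\<Sum>i<(n::nat). pairing (a i) \<alpha> * pairing (b i) \<beta>)"
proof -
  have "tensor_functional \<alpha> \<beta> (\<Sum>i<n. fmul (inL (a i)) (inR (b i))) = (\<Sum>i<n. tensor_functional \<alpha> \<beta> (fmul (inL (a i)) (inR (b i))))"
    unfolding tensor_functional_def
    by (subst word_action_sum) (use assms[THEN FA_finsupp] in \<open>auto simp: sum_fun_apply intro!: finsupp_fmul finsupp_push\<close>)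
  also have "\<dots> = (\<Sum>i<n. pairing (a i) \<alpha> * pairing (b i) \<beta>)"
    by (rule sum.cong) (use assms tensor_functional_mult in auto)
  finally show ?thesis .
qed

text \<open>The value may be computed from any decomposition, in particular from the translate of a
  given one.\<close>

lemma tensor_functional_decomposition:
  assumes "decomposition n a b z" "z \<in> FA N"
  shows "tensor_functional \<alpha> \<beta> z = (\<Sum>i<n. pairing (a i) \<alpha> * pairing (b i) \<beta>)"
proof -
  have ab: "\<And>i. i < n \<Longrightarrow> a i \<in> FA L" "\<And>i. i < n \<Longrightarrow> b i \<in> FA M"
    using assms(1) by (auto simp: decomposition_def)
  have "(\<Sum>i<n. fmul (inL (a i)) (inR (b i))) \<in> FA N"
    by (rule FA_sum) (use ab in \<open>auto intro!: FA_fmul inL_FA inR_FA\<close>)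
  then show ?thesis
    using tensor_functional_cong[OF assms(2)] assms(1) tensor_functional_sum[OF ab] by (simp add: decomposition_def)
qed

end

text \<open>An element outside the ideal would be separated from it by some functional, so
  membership can be tested by pairings alone.\<close>

lemma in_ideal_if_all_functionals:
  assumes "lie_subalg K" "u \<in> FA K" "\<And>\<alpha>. (\<And>v. v \<in> uea_ideal K \<Longrightarrow> pairing v \<alpha> = 0) \<Longrightarrow> pairing u \<alpha> = 0"
  shows "u \<in> uea_ideal K"
proof (rule ccontr)
  interpret K: lie_subalg K by fact
  assume "u \<notin> uea_ideal K"
  then obtain \<alpha> where \<alpha>: "\<And>v. v \<in> uea_ideal K \<Longrightarrow> finsupp v \<Longrightarrow> pairing v \<alpha> = 0" "pairing u \<alpha> = 1"
    using separating_functional[OF subspace_ideal[OF K.ideal_uea] _ FA_finsupp[OF assms(2)]] by blast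
  then have "pairing u \<alpha> = 0"
    using K.I_closed(1) FA_finsupp by (intro assms(3)) blast
  then show False using \<alpha>(2) by simp
qed

section \<open>Adjoint action and invariant factors\<close>

lemma push_Ad_blk:
  assumes gh: "g \<in> G" "h \<in> H"
  shows "a \<in> FA L \<Longrightarrow> push_words (Ad (blk g h)) (inL a) = inL (push_words (Ad g) a)"
    and "b \<in> FA M \<Longrightarrow> push_words (Ad (blk g h)) (inR b) = inR (push_words (Ad h) b)"
proof -
  have 1: "Ad (blk g h) (blk X 0) = blk (Ad g X) 0" for X
    using Ad_blk[OF gh, of X 0] by (simp add: Ad_def)
  have 2: "Ad (blk g h) (blk 0 Y) = blk 0 (Ad h Y)" for Y
    using Ad_blk[OF gh, of 0 Y] by (simp add: Ad_def)
  show "a \<in> FA L \<Longrightarrow> push_words (Ad (blk g h)) (inL a) = inL (push_words (Ad g) a)"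
    using FA_finsupp[of a L] 1 by (simp add: push_push comp_def)
  show "b \<in> FA M \<Longrightarrow> push_words (Ad (blk g h)) (inR b) = inR (push_words (Ad h) b)"
    using FA_finsupp[of b M] 2 by (simp add: push_push comp_def)
qed

lemma Ad_one: "Ad (mat 1) X = X"
  by (simp add: Ad_def map_matrix_of_real_one)

lemma push_Ad_one: "u \<in> FA S \<Longrightarrow> push_words (Ad (mat 1)) u = u"
  by (rule pairing_ext) (auto simp: FA_finsupp finsupp_push pairing_push Ad_one map_idI)

text \<open>Ad(g, h) is multiplicative and acts on the two factors separately, so it translates a
  decomposition factor by factor.\<close>

lemma decomposition_Ad:
  assumes dec: "decomposition n a b z" and z: "z \<in> FA N" and gh: "g \<in> G" "h \<in> H"
  shows "decomposition n (\<lambda>i. push_words (Ad g) (a i)) (\<lambda>i. push_words (Ad h) (b i)) (push_words (Ad (blk g h)) z)"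
proof -
  have ab: "\<And>i. i < n \<Longrightarrow> a i \<in> FA L" "\<And>i. i < n \<Longrightarrow> b i \<in> FA M"
    using dec by (auto simp: decomposition_def)
  have hom: "lie_hom N N (Ad (blk g h))"
    using gh by (intro P.lie_hom_Ad) simp
  have memG: "push_words (Ad g) u \<in> FA L" if "u \<in> FA L" for u
    using that G.lie_hom_Ad[OF gh(1)] by (auto simp: lie_hom_def intro!: FA_push[OF that])
  have memH: "push_words (Ad h) u \<in> FA M" if "u \<in> FA M" for u
    using that H.lie_hom_Ad[OF gh(2)] by (auto simp: lie_hom_def intro!: FA_push[OF that])
  have fs: "finsupp (fmul (inL (a i)) (inR (b i)))" if "i < n" for i
    using ab[OF that] by (intro finsupp_fmul finsupp_push FA_finsupp)
  have "push_words (Ad (blk g h)) (\<Sum>i<n. fmul (inL (a i)) (inR (b i))) =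
      (\<Sum>i<n. push_words (Ad (blk g h)) (fmul (inL (a i)) (inR (b i))))"
    by (rule push_sum) (use fs in simp)
  also have "\<dots> = (\<Sum>i<n. fmul (inL (push_words (Ad g) (a i))) (inR (push_words (Ad h) (b i))))"
  proof (rule sum.cong[OF refl])
    fix i assume "i \<in> {..<n}"
    then have i: "a i \<in> FA L" "b i \<in> FA M" using ab by auto
    show "push_words (Ad (blk g h)) (fmul (inL (a i)) (inR (b i))) = fmul (inL (push_words (Ad g) (a i))) (inR (push_words (Ad h) (b i)))"
      unfolding push_fmul[OF finsupp_push[OF FA_finsupp[OF i(1)]] finsupp_push[OF FA_finsupp[OF i(2)]]]
        push_Ad_blk(1)[OF gh i(1)] push_Ad_blk(2)[OF gh i(2)] ..
  qed
  finally have eq: "push_words (Ad (blk g h)) z - (\<Sum>i<n. fmul (inL (push_words (Ad g) (a i))) (inR (push_words (Ad h) (b i)))) =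
      push_words (Ad (blk g h)) (z - (\<Sum>i<n. fmul (inL (a i)) (inR (b i))))"
    using push_diff[OF FA_finsupp[OF z] finsupp_sum, of "{..<n}" "\<lambda>i. fmul (inL (a i)) (inR (b i))" "Ad (blk g h)"] fs by simp
  have "push_words (Ad (blk g h)) (z - (\<Sum>i<n. fmul (inL (a i)) (inR (b i)))) \<in> uea_ideal N"
    using dec by (intro push_ideal[OF N.lie_subalg_axioms N.lie_subalg_axioms hom]) (simp add: decomposition_def)
  then show ?thesis
    using ab memG memH unfolding decomposition_def eq by simp
qed

lemma sum_dual: "j < n \<Longrightarrow> q j = 1 \<Longrightarrow> (\<And>i. i < n \<Longrightarrow> i \<noteq> j \<Longrightarrow> q i = 0) \<Longrightarrow> (\<Sum>i<n. p i * q i) = p j"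
  for p q :: "nat \<Rightarrow> complex"
  by (subst sum.remove[of _ j]) auto

text \<open>Contracting z with a functional \<beta> dual to \<open>b j\<close> returns
  \<open>a j\<close>, and contracting its Ad(g, 1)-translate returns the Ad(g)-translate of
  \<open>a j\<close>. As z and its translate agree modulo the ideal, every functional \<alpha>
  vanishing on the ideal takes the same value on both.\<close>

lemma Z_decomposition:
  assumes z: "z \<in> FA N" and inv: "uea_class N z \<in> carrier (Z_alg P)"
  obtains n a b where "decomposition n a b z"
    "\<And>i. i < n \<Longrightarrow> uea_class L (a i) \<in> carrier (Z_alg G)" "\<And>i. i < n \<Longrightarrow> uea_class M (b i) \<in> carrier (Z_alg H)"
proof -
  define n where "n = (LEAST n. \<exists>a b. decomposition n a b z)"
  have "\<exists>a b. decomposition n a b z"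
    unfolding n_def using decomposition_exists[OF z] by (rule LeastI_ex)
  then obtain a b where dec: "decomposition n a b z" by blast
  have min: "\<not> decomposition m a' b' z" if "m < n" for m a' b'
    using not_less_Least[OF that[unfolded n_def]] by blast
  have ab: "\<And>i. i < n \<Longrightarrow> a i \<in> FA L" "\<And>i. i < n \<Longrightarrow> b i \<in> FA M"
    and zI: "z - (\<Sum>i<n. fmul (inL (a i)) (inR (b i))) \<in> uea_ideal N"
    using dec by (auto simp: decomposition_def)
  have inLI: "inL y \<in> uea_ideal N" if "y \<in> uea_ideal L" for y
    by (rule push_ideal[OF L.lie_subalg_axioms N.lie_subalg_axioms lie_hom_left that])
  have inRI: "inR y \<in> uea_ideal N" if "y \<in> uea_ideal M" for y
    by (rule push_ideal[OF M.lie_subalg_axioms N.lie_subalg_axioms lie_hom_right that])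
  note ideals = subspace_ideal[OF L.ideal_uea] subspace_ideal[OF M.ideal_uea] subspace_ideal[OF N.ideal_uea]
  \<comment> \<open>For y in the ideal, \<open>fmul (inL x) (inR y)\<close> lies in
    \<open>uea_ideal N\<close>, so independence holds even modulo the ideal.\<close>
  have indb: "b j \<noteq> (\<Sum>i\<in>{..<n} - {j}. fscale (c i) (b i)) + y" if j: "j < n" and y: "y \<in> uea_ideal M" for j c y
  proof (rule minimal_sum_independent[where B="\<lambda>u v. fmul (inL u) (inR v)", OF subspace_FA subspace_FA ideals(3) _ _ _ _ ab zI _ j])
    show "y \<in> FA M" using y by (rule M.I_closed(1))
    show "fmul (inL x) (inR y) \<in> uea_ideal N" if "x \<in> FA L" for x
      by (rule N.I_closed(4)[OF inRI[OF y] inL_FA[OF that]])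
  next
    fix m a' b' assume "m < n" "\<And>i. i < m \<Longrightarrow> a' i \<in> FA L" "\<And>i. i < m \<Longrightarrow> b' i \<in> FA M"
    then show "z - (\<Sum>i<m. fmul (inL (a' i)) (inR (b' i))) \<notin> uea_ideal N"
      using min[of m a' b'] by (simp add: decomposition_def)
  qed (simp_all only: push_add[OF FA_finsupp FA_finsupp] push_scale[OF FA_finsupp] fmul_add_left fmul_add_right
      fmul_scale_left fmul_scale_right)
  \<comment> \<open>The same with the roles of the two factors exchanged.\<close>
  have inda: "a j \<noteq> (\<Sum>i\<in>{..<n} - {j}. fscale (c i) (a i)) + y" if j: "j < n" and y: "y \<in> uea_ideal L" for j c y
  proof (rule minimal_sum_independent[where B="\<lambda>v u. fmul (inL u) (inR v)", OF subspace_FA subspace_FA ideals(3) _ _ _ _ ab(2) ab(1) zI _ j])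
    show "y \<in> FA L" using y by (rule L.I_closed(1))
    show "fmul (inL y) (inR x) \<in> uea_ideal N" if "x \<in> FA M" for x
      by (rule N.I_closed(5)[OF inLI[OF y] inR_FA[OF that]])
  next
    fix m b' a' assume "m < n" "\<And>i. i < m \<Longrightarrow> b' i \<in> FA M" "\<And>i. i < m \<Longrightarrow> a' i \<in> FA L"
    then show "z - (\<Sum>i<m. fmul (inL (a' i)) (inR (b' i))) \<notin> uea_ideal N"
      using min[of m a' b'] by (simp add: decomposition_def)
  qed (simp_all only: push_add[OF FA_finsupp FA_finsupp] push_scale[OF FA_finsupp] fmul_add_left fmul_add_right
      fmul_scale_left fmul_scale_right)
  have invz: "push_words (Ad x) z - z \<in> uea_ideal N" if "x \<in> P" for x
    using inv P.class_in_Z_iff[OF z] that by blast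
  have memz: "push_words (Ad x) z \<in> FA N" if "x \<in> P" for x
    using P.lie_hom_Ad[OF that] by (intro FA_push[OF z]) (simp add: lie_hom_def)
  show thesis
  proof (rule that[OF dec])
    fix j assume j: "j < n"
    obtain \<beta> where \<beta>: "\<And>u. u \<in> uea_ideal M \<Longrightarrow> finsupp u \<Longrightarrow> pairing u \<beta> = 0" "pairing (b j) \<beta> = 1"
        "\<And>i. i < n \<Longrightarrow> i \<noteq> j \<Longrightarrow> pairing (b i) \<beta> = 0"
      using dual_functional[OF ideals(2) FA_finsupp[OF ab(2)[OF j]] FA_finsupp[OF ab(2)] indb[OF j]] by blast
    have \<beta>0: "pairing v \<beta> = 0" if "v \<in> uea_ideal M" for v
      using \<beta>(1) that FA_finsupp[OF M.I_closed(1)[OF that]] by blast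
    show "uea_class L (a j) \<in> carrier (Z_alg G)"
      unfolding G.class_in_Z_iff[OF ab(1)[OF j]]
    proof
      fix g assume g: "g \<in> G"
      \<comment> \<open>The second component is the identity, so every \<open>b i\<close> stays
        fixed and \<beta> still isolates the term j.\<close>
      have x: "blk g (mat 1) \<in> P" using g by simp
      have mem: "push_words (Ad g) (a j) \<in> FA L"
        using G.lie_hom_Ad[OF g] by (intro FA_push[OF ab(1)[OF j]]) (simp add: lie_hom_def)
      show "push_words (Ad g) (a j) - a j \<in> uea_ideal L"
      proof (rule in_ideal_if_all_functionals[OF L.lie_subalg_axioms FA_diff[OF mem ab(1)[OF j]]])
        fix \<alpha> assume \<alpha>: "\<And>v. v \<in> uea_ideal L \<Longrightarrow> pairing v \<alpha> = 0"
        have "tensor_functional \<alpha> \<beta> (push_words (Ad (blk g (mat 1))) z) =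
            (\<Sum>i<n. pairing (push_words (Ad g) (a i)) \<alpha> * pairing (push_words (Ad (mat 1)) (b i)) \<beta>)"
          by (rule tensor_functional_decomposition[OF \<alpha> \<beta>0 decomposition_Ad[OF dec z g H.one_mem] memz[OF x]])
        also have "\<dots> = pairing (push_words (Ad g) (a j)) \<alpha>"
          by (rule sum_dual) (use j \<beta> push_Ad_one[OF ab(2)] in auto)
        finally have "pairing (push_words (Ad g) (a j)) \<alpha> = tensor_functional \<alpha> \<beta> (push_words (Ad (blk g (mat 1))) z)" ..
        also have "\<dots> = tensor_functional \<alpha> \<beta> z"
          by (rule tensor_functional_cong[OF \<alpha> \<beta>0 memz[OF x] z invz[OF x]])
        also have "\<dots> = (\<Sum>i<n. pairing (a i) \<alpha> * pairing (b i) \<beta>)"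
          by (rule tensor_functional_decomposition[OF \<alpha> \<beta>0 dec z])
        also have "\<dots> = pairing (a j) \<alpha>"
          by (rule sum_dual) (use j \<beta> in auto)
        finally show "pairing (push_words (Ad g) (a j) - a j) \<alpha> = 0"
          unfolding pairing_diff[OF FA_finsupp[OF mem] FA_finsupp[OF ab(1)[OF j]]] by simp
      qed
    qed
  next
    fix j assume j: "j < n"
    obtain \<alpha> where \<alpha>: "\<And>u. u \<in> uea_ideal L \<Longrightarrow> finsupp u \<Longrightarrow> pairing u \<alpha> = 0" "pairing (a j) \<alpha> = 1"
        "\<And>i. i < n \<Longrightarrow> i \<noteq> j \<Longrightarrow> pairing (a i) \<alpha> = 0"
      using dual_functional[OF ideals(1) FA_finsupp[OF ab(1)[OF j]] FA_finsupp[OF ab(1)] inda[OF j]] by blast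
    have \<alpha>0: "pairing v \<alpha> = 0" if "v \<in> uea_ideal L" for v
      using \<alpha>(1) that FA_finsupp[OF L.I_closed(1)[OF that]] by blast
    show "uea_class M (b j) \<in> carrier (Z_alg H)"
      unfolding H.class_in_Z_iff[OF ab(2)[OF j]]
    proof
      fix h assume h: "h \<in> H"
      have x: "blk (mat 1) h \<in> P" using h by simp
      have mem: "push_words (Ad h) (b j) \<in> FA M"
        using H.lie_hom_Ad[OF h] by (intro FA_push[OF ab(2)[OF j]]) (simp add: lie_hom_def)
      show "push_words (Ad h) (b j) - b j \<in> uea_ideal M"
      proof (rule in_ideal_if_all_functionals[OF M.lie_subalg_axioms FA_diff[OF mem ab(2)[OF j]]])
        fix \<beta> assume \<beta>: "\<And>v. v \<in> uea_ideal M \<Longrightarrow> pairing v \<beta> = 0"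
        have "tensor_functional \<alpha> \<beta> (push_words (Ad (blk (mat 1) h)) z) =
            (\<Sum>i<n. pairing (push_words (Ad (mat 1)) (a i)) \<alpha> * pairing (push_words (Ad h) (b i)) \<beta>)"
          by (rule tensor_functional_decomposition[OF \<alpha>0 \<beta> decomposition_Ad[OF dec z G.one_mem h] memz[OF x]])
        also have "\<dots> = pairing (push_words (Ad h) (b j)) \<beta>"
          unfolding mult.commute[of "pairing _ \<alpha>"]
          by (rule sum_dual) (use j \<alpha> push_Ad_one[OF ab(1)] in auto)
        finally have "pairing (push_words (Ad h) (b j)) \<beta> = tensor_functional \<alpha> \<beta> (push_words (Ad (blk (mat 1) h)) z)" ..
        also have "\<dots> = tensor_functional \<alpha> \<beta> z"
          by (rule tensor_functional_cong[OF \<alpha>0 \<beta> memz[OF x] z invz[OF x]])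
        also have "\<dots> = (\<Sum>i<n. pairing (a i) \<alpha> * pairing (b i) \<beta>)"
          by (rule tensor_functional_decomposition[OF \<alpha>0 \<beta> dec z])
        also have "\<dots> = pairing (b j) \<beta>"
          unfolding mult.commute[of "pairing _ \<alpha>"] by (rule sum_dual) (use j \<alpha> in auto)
        finally show "pairing (push_words (Ad h) (b j) - b j) \<beta> = 0"
          unfolding pairing_diff[OF FA_finsupp[OF mem] FA_finsupp[OF ab(2)[OF j]]] by simp
      qed
    qed
  qed
qed

end

section \<open>The product character\<close>

context closed_linear_group
begin

abbreviation "LC \<equiv> lie_algebra_C G"

text \<open>The preimage of Z(G) in the free algebra. It is a linear subspace containing the ideal,
  which permits characters to be treated as linear functionals.\<close>

definition invariants :: "((complex^'n^'n) list \<Rightarrow> complex) set" where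
  "invariants = {u \<in> FA LC. uea_class LC u \<in> carrier (Z_alg G)}"

interpretation LC: lie_subalg LC by (rule lie_subalg_lie_algebra_C)

lemma invariants_iff:
  "u \<in> invariants \<longleftrightarrow> u \<in> FA LC \<and> (\<forall>g\<in>G. push_words (Ad g) u - u \<in> uea_ideal LC)"
  using class_in_Z_iff by (auto simp: invariants_def)

lemma push_Ad_FA:
  assumes "g \<in> G" "u \<in> FA LC"
  shows "push_words (Ad g) u \<in> FA LC"
  using lie_hom_Ad[OF assms(1)] by (intro FA_push[OF assms(2)]) (simp add: lie_hom_def)

lemma invariants_ideal:
  assumes "u \<in> uea_ideal LC"
  shows "u \<in> invariants"
  unfolding invariants_iff
proof (intro conjI ballI)
  show "u \<in> FA LC" using assms by (rule LC.I_closed(1))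
  fix g assume "g \<in> G"
  then show "push_words (Ad g) u - u \<in> uea_ideal LC"
    by (intro LC.I_closed(7)[OF push_ideal[OF LC.lie_subalg_axioms LC.lie_subalg_axioms lie_hom_Ad]] assms)
qed

lemma invariants_add: "u \<in> invariants \<Longrightarrow> v \<in> invariants \<Longrightarrow> u + v \<in> invariants"
  unfolding invariants_iff
proof (intro conjI ballI; elim conjE)
  fix g assume u: "u \<in> FA LC" "\<forall>g\<in>G. push_words (Ad g) u - u \<in> uea_ideal LC"
    and v: "v \<in> FA LC" "\<forall>g\<in>G. push_words (Ad g) v - v \<in> uea_ideal LC" and g: "g \<in> G"
  have "push_words (Ad g) (u + v) - (u + v) = (push_words (Ad g) u - u) + (push_words (Ad g) v - v)"
    unfolding push_add[OF FA_finsupp[OF u(1)] FA_finsupp[OF v(1)]] by (simp only: algebra_simps)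
  also have "\<dots> \<in> uea_ideal LC"
    using u(2) v(2) g by (intro LC.I_closed(3)) auto
  finally show "push_words (Ad g) (u + v) - (u + v) \<in> uea_ideal LC" .
qed (rule FA_add)

lemma invariants_scale: "u \<in> invariants \<Longrightarrow> fscale c u \<in> invariants"
  unfolding invariants_iff
proof (intro conjI ballI; elim conjE)
  fix g assume u: "u \<in> FA LC" "\<forall>g\<in>G. push_words (Ad g) u - u \<in> uea_ideal LC" and g: "g \<in> G"
  have "push_words (Ad g) (fscale c u) - fscale c u = fscale c (push_words (Ad g) u - u)"
    unfolding push_scale[OF FA_finsupp[OF u(1)]] by (simp only: fun_vs.scale_right_diff_distrib)
  also have "\<dots> \<in> uea_ideal LC"
    using u(2) g by (intro LC.I_closed(6)) auto
  finally show "push_words (Ad g) (fscale c u) - fscale c u \<in> uea_ideal LC" .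
qed (rule FA_scale)

text \<open>Telescoping: Ad(uv) - uv = (Ad u - u) Ad v + u (Ad v - v).\<close>

lemma invariants_fmul: "u \<in> invariants \<Longrightarrow> v \<in> invariants \<Longrightarrow> fmul u v \<in> invariants"
  unfolding invariants_iff
proof (intro conjI ballI; elim conjE)
  fix g assume u: "u \<in> FA LC" "\<forall>g\<in>G. push_words (Ad g) u - u \<in> uea_ideal LC"
    and v: "v \<in> FA LC" "\<forall>g\<in>G. push_words (Ad g) v - v \<in> uea_ideal LC" and g: "g \<in> G"
  have "push_words (Ad g) (fmul u v) - fmul u v =
      fmul (push_words (Ad g) u - u) (push_words (Ad g) v) + fmul u (push_words (Ad g) v - v)"
    unfolding push_fmul[OF FA_finsupp[OF u(1)] FA_finsupp[OF v(1)]] fmul_diff_left fmul_diff_right by simp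
  also have "\<dots> \<in> uea_ideal LC"
    using u v g by (intro LC.I_closed(3) LC.I_closed(4)[OF _ u(1)] LC.I_closed(5)[OF _ push_Ad_FA]) auto
  finally show "push_words (Ad g) (fmul u v) - fmul u v \<in> uea_ideal LC" .
qed (rule FA_fmul)

lemma invariants_one: "word_ind [] \<in> invariants"
  unfolding invariants_iff using LC.I_closed(2) by (simp add: FA_word push_word)

lemma Z_carrier_iff: "c \<in> carrier (Z_alg G) \<longleftrightarrow> (\<exists>u\<in>invariants. c = uea_class LC u)"
proof
  assume "c \<in> carrier (Z_alg G)"
  then obtain u where "u \<in> FA LC" "c = uea_class LC u"
    by (rule Z_cases)
  then show "\<exists>u\<in>invariants. c = uea_class LC u"
    using \<open>c \<in> carrier (Z_alg G)\<close> by (auto simp: invariants_def)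
qed (auto simp: invariants_def)

lemma rep_invariant:
  assumes "c \<in> carrier (Z_alg G)"
  shows "rep c \<in> invariants" "uea_class LC (rep c) = c"
proof -
  have "rep c \<in> FA LC" "uea_class LC (rep c) = c"
    by (rule Z_cases[OF assms], assumption)+
  then show "rep c \<in> invariants" "uea_class LC (rep c) = c"
    using assms by (simp_all add: invariants_def)
qed

lemma character_class:
  assumes \<eta>: "Z_character G \<eta>" and uv: "u \<in> invariants" "v \<in> invariants"
  shows "\<eta> (uea_class LC (u + v)) = \<eta> (uea_class LC u) + \<eta> (uea_class LC v)"
    and "\<eta> (uea_class LC (fmul u v)) = \<eta> (uea_class LC u) * \<eta> (uea_class LC v)"
    and "\<eta> (uea_class LC (fscale c u)) = c * \<eta> (uea_class LC u)"
    and "\<eta> (uea_class LC (word_ind [])) = 1"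
proof -
  have hom: "\<eta> \<in> ring_hom (Z_alg G) complex_ring"
    and sc: "\<And>c. \<eta> (uea_class LC (fscale c (word_ind []))) = c"
    using \<eta> by (simp_all add: Z_character_def fscale_def)
  have FA: "u \<in> FA LC" "v \<in> FA LC" and Z: "uea_class LC u \<in> carrier (Z_alg G)" "uea_class LC v \<in> carrier (Z_alg G)"
    using uv by (auto simp: invariants_def)
  have ops: "mult (Z_alg G) = mult (U_alg G)" "add (Z_alg G) = add (U_alg G)"
    by (simp_all add: Z_alg_def)
  show "\<eta> (uea_class LC (u + v)) = \<eta> (uea_class LC u) + \<eta> (uea_class LC v)"
    using ring_hom_add[OF hom Z] LC.class_add[OF FA] by (simp add: ops complex_ring_def)
  have mult: "\<eta> (uea_class LC (fmul u v)) = \<eta> (uea_class LC u) * \<eta> (uea_class LC v)"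
    if "u \<in> invariants" "v \<in> invariants" for u v
    using that ring_hom_mult[OF hom, of "uea_class LC u" "uea_class LC v"] LC.class_mult[of u v]
    by (simp add: ops complex_ring_def invariants_def)
  then show "\<eta> (uea_class LC (fmul u v)) = \<eta> (uea_class LC u) * \<eta> (uea_class LC v)"
    using uv by blast
  \<comment> \<open>c u is the product of c times the unit with u, and a character sends c times the
    unit to c.\<close>
  show "\<eta> (uea_class LC (fscale c u)) = c * \<eta> (uea_class LC u)"
    using mult[OF invariants_scale[OF invariants_one, of c] uv(1)] sc[of c]
    by (simp add: fmul_scale_left fmul_one)
  show "\<eta> (uea_class LC (word_ind [])) = 1"
    using sc[of 1] by (simp add: fscale_def)
qed

text \<open>The character is controlled on Z(G) only, while \<open>tensor_functional\<close> needs
  functionals on all words. A linear extension from the invariants does; it vanishes on the ideal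
  because the elements there have the class of 0.\<close>

lemma character_functional:
  assumes \<eta>: "Z_character G \<eta>"
  obtains \<alpha> where "\<And>u. u \<in> invariants \<Longrightarrow> pairing u \<alpha> = \<eta> (uea_class LC u)"
    "\<And>u. u \<in> uea_ideal LC \<Longrightarrow> pairing u \<alpha> = 0"
proof -
  have "0 \<in> invariants" using invariants_ideal LC.I_closed(2) by blast
  then have W: "fun_vs.subspace invariants"
    by (intro fun_vs.subspaceI invariants_add invariants_scale)
  have "\<exists>\<alpha>. \<forall>u. u \<in> invariants \<longrightarrow> finsupp u \<longrightarrow> pairing u \<alpha> = \<eta> (uea_class LC u)"
  proof (rule extend_functional[OF W, of "\<lambda>u. \<eta> (uea_class LC u)"])
    show "\<eta> (uea_class LC (u + v)) = \<eta> (uea_class LC u) + \<eta> (uea_class LC v)" if "u \<in> invariants" "v \<in> invariants" for u v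
      by (rule character_class(1)[OF \<eta> that])
    show "\<eta> (uea_class LC (fscale c u)) = c * \<eta> (uea_class LC u)" if "u \<in> invariants" for u c
      by (rule character_class(3)[OF \<eta> that that])
    show ?thesis if "\<And>u. u \<in> invariants \<Longrightarrow> finsupp u \<Longrightarrow> pairing u \<alpha> = \<eta> (uea_class LC u)" for \<alpha>
      using that by (intro exI allI impI)
  qed
  then obtain \<alpha> where \<alpha>: "\<And>u. u \<in> invariants \<Longrightarrow> finsupp u \<Longrightarrow> pairing u \<alpha> = \<eta> (uea_class LC u)"
    by auto
  have 1: "pairing u \<alpha> = \<eta> (uea_class LC u)" if "u \<in> invariants" for u
    using \<alpha>[OF that] that FA_finsupp by (auto simp: invariants_def)
  have "pairing u \<alpha> = 0" if u: "u \<in> uea_ideal LC" for u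
  proof -
    have "uea_class LC u = uea_class LC 0"
      using LC.class_eq_iff[OF LC.I_closed(1)[OF u] FA_zero] u by simp
    then have "pairing u \<alpha> = pairing 0 \<alpha>"
      using 1[OF invariants_ideal[OF u]] 1[OF \<open>0 \<in> invariants\<close>] by simp
    then show ?thesis by simp
  qed
  with 1 show thesis using that by blast
qed

end

section \<open>Existence of the product character\<close>

context group_pair
begin

lemma tensor_functional_lin_sum:
  "(\<And>i. i \<in> I \<Longrightarrow> finsupp (u i)) \<Longrightarrow>
    tensor_functional \<alpha> \<beta> (\<Sum>i\<in>I. u i) = (\<Sum>i\<in>I. tensor_functional \<alpha> \<beta> (u i))"
  unfolding tensor_functional_def by (simp add: word_action_sum sum_fun_apply)

text \<open>Only the inner factors \<open>inR b\<close> and \<open>inL a'\<close> have to be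
  exchanged.\<close>

lemma inL_inR_interchange:
  assumes "a \<in> FA L" "b \<in> FA M" "a' \<in> FA L" "b' \<in> FA M"
  shows "fmul (fmul (inL a) (inR b)) (fmul (inL a') (inR b')) - fmul (inL (fmul a a')) (inR (fmul b b')) \<in> uea_ideal N"
proof -
  note FA = inL_FA[OF assms(1)] inR_FA[OF assms(2)] inL_FA[OF assms(3)] inR_FA[OF assms(4)]
  note fs = FA[THEN FA_finsupp]
  have "fmul (fmul (inL a) (inR b)) (fmul (inL a') (inR b')) - fmul (inL (fmul a a')) (inR (fmul b b')) =
      fmul (inL a) (fmul (fmul (inR b) (inL a') - fmul (inL a') (inR b)) (inR b'))"
    using fs assms[THEN FA_finsupp]
    by (simp add: push_fmul fmul_assoc fmul_diff_left fmul_diff_right finsupp_fmul)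
  also have "\<dots> \<in> uea_ideal N"
    by (intro N.I_closed(4)[OF _ FA(1)] N.I_closed(5)[OF _ FA(4)] inR_inL_commute assms)
  finally show ?thesis .
qed

text \<open>The candidate is \<open>tensor_functional \<alpha> \<beta>\<close> on a representative.
  As \<alpha> and \<beta> are known to be multiplicative on invariants only, products are computed
  after writing both elements with invariant factors by \<open>Z_decomposition\<close>.\<close>

lemma prod_character_exists:
  assumes \<eta>: "Z_character G \<eta>" and \<eta>': "Z_character H \<eta>'"
  shows "\<exists>\<psi>. Z_character P \<psi> \<and> (\<forall>u\<in>carrier (Z_alg G). \<forall>v\<in>carrier (Z_alg H).
     \<psi> (uea_map N (\<lambda>X. blk X 0) u \<otimes>\<^bsub>U_alg P\<^esub> uea_map N (\<lambda>Y. blk 0 Y) v) = \<eta> u * \<eta>' v)"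
proof -
  obtain \<alpha> where \<alpha>: "\<And>u. u \<in> G.invariants \<Longrightarrow> pairing u \<alpha> = \<eta> (uea_class L u)"
    and \<alpha>0: "\<And>u. u \<in> uea_ideal L \<Longrightarrow> pairing u \<alpha> = 0"
    using G.character_functional[OF \<eta>] by blast
  obtain \<beta> where \<beta>: "\<And>u. u \<in> H.invariants \<Longrightarrow> pairing u \<beta> = \<eta>' (uea_class M u)"
    and \<beta>0: "\<And>u. u \<in> uea_ideal M \<Longrightarrow> pairing u \<beta> = 0"
    using H.character_functional[OF \<eta>'] by blast
  let ?\<Phi> = "tensor_functional \<alpha> \<beta>"
  define \<psi> where "\<psi> c = ?\<Phi> (rep c)" for c
  have cong: "?\<Phi> z = ?\<Phi> z'" if "z \<in> FA N" "z' \<in> FA N" "z - z' \<in> uea_ideal N" for z z'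
    by (rule tensor_functional_cong[OF \<alpha>0 \<beta>0 that])
  have cls: "\<psi> (uea_class N z) = ?\<Phi> z" if "z \<in> FA N" for z
    unfolding \<psi>_def using N.rep_class[OF that] that by (intro cong) auto
  have tensor: "?\<Phi> (fmul (inL a) (inR b)) = pairing a \<alpha> * pairing b \<beta>" if "a \<in> FA L" "b \<in> FA M" for a b
    by (rule tensor_functional_mult[OF \<alpha>0 \<beta>0 that])
  have ex: "\<exists>n a b. decomposition n a b z \<and> (\<forall>i<n. uea_class L (a i) \<in> carrier (Z_alg G)) \<and>
      (\<forall>i<n. uea_class M (b i) \<in> carrier (Z_alg H))"
    if "z \<in> FA N" "uea_class N z \<in> carrier (Z_alg P)" for z
    by (rule Z_decomposition[OF that]) (intro exI conjI allI impI)
  have mult: "?\<Phi> (fmul z z') = ?\<Phi> z * ?\<Phi> z'" if z: "z \<in> P.invariants" "z' \<in> P.invariants" for z z'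
  proof -
    have zN: "z \<in> FA N" "z' \<in> FA N" and zZ: "uea_class N z \<in> carrier (Z_alg P)" "uea_class N z' \<in> carrier (Z_alg P)"
      using z by (auto simp: P.invariants_def)
    obtain n a b where dec: "decomposition n a b z"
      and inv: "\<And>i. i < n \<Longrightarrow> uea_class L (a i) \<in> carrier (Z_alg G)" "\<And>i. i < n \<Longrightarrow> uea_class M (b i) \<in> carrier (Z_alg H)"
      using ex[OF zN(1) zZ(1)] by blast
    obtain m a' b' where dec': "decomposition m a' b' z'"
      and inv': "\<And>i. i < m \<Longrightarrow> uea_class L (a' i) \<in> carrier (Z_alg G)" "\<And>i. i < m \<Longrightarrow> uea_class M (b' i) \<in> carrier (Z_alg H)"
      using ex[OF zN(2) zZ(2)] by blast
    have ab: "\<And>i. i < n \<Longrightarrow> a i \<in> G.invariants" "\<And>i. i < n \<Longrightarrow> b i \<in> H.invariants"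
      using dec inv by (auto simp: decomposition_def G.invariants_def H.invariants_def)
    have ab': "\<And>i. i < m \<Longrightarrow> a' i \<in> G.invariants" "\<And>i. i < m \<Longrightarrow> b' i \<in> H.invariants"
      using dec' inv' by (auto simp: decomposition_def G.invariants_def H.invariants_def)
    have FAs: "\<And>i. i < n \<Longrightarrow> a i \<in> FA L" "\<And>i. i < n \<Longrightarrow> b i \<in> FA M"
      "\<And>i. i < m \<Longrightarrow> a' i \<in> FA L" "\<And>i. i < m \<Longrightarrow> b' i \<in> FA M"
      using ab ab' by (auto simp: G.invariants_def H.invariants_def)
    let ?t = "\<lambda>i. fmul (inL (a i)) (inR (b i))" and ?t' = "\<lambda>i. fmul (inL (a' i)) (inR (b' i))"
    let ?S = "\<Sum>i<n. ?t i" and ?S' = "\<Sum>i<m. ?t' i"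
    have t: "\<And>i. i < n \<Longrightarrow> ?t i \<in> FA N" "\<And>i. i < m \<Longrightarrow> ?t' i \<in> FA N"
      using FAs by (auto intro!: FA_fmul inL_FA inR_FA)
    have S: "?S \<in> FA N" "?S' \<in> FA N"
      by (rule FA_sum, use t in simp)+
    have dS: "z - ?S \<in> uea_ideal N" "z' - ?S' \<in> uea_ideal N"
      using dec dec' by (auto simp: decomposition_def)
    \<comment> \<open>Both elements are replaced by their decompositions, one at a time, so that
      each error term lies in the ideal.\<close>
    have "fmul z z' - fmul ?S ?S' = fmul (z - ?S) z' + fmul ?S (z' - ?S')"
      unfolding fmul_diff_left fmul_diff_right by simp
    also have "\<dots> \<in> uea_ideal N"
      by (rule N.I_closed(3)[OF N.I_closed(5)[OF dS(1) zN(2)] N.I_closed(4)[OF dS(2) S(1)]])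
    finally have "?\<Phi> (fmul z z') = ?\<Phi> (fmul ?S ?S')"
      by (intro cong FA_fmul zN S)
    also have "\<dots> = (\<Sum>i<n. \<Sum>j<m. ?\<Phi> (fmul (?t i) (?t' j)))"
    proof -
      have "?\<Phi> (fmul ?S ?S') = (\<Sum>i<n. ?\<Phi> (fmul (?t i) ?S'))"
        unfolding fmul_sum_left
        by (rule tensor_functional_lin_sum) (rule FA_finsupp[OF FA_fmul[OF t(1) S(2)]], simp)
      also have "\<dots> = (\<Sum>i<n. \<Sum>j<m. ?\<Phi> (fmul (?t i) (?t' j)))"
        unfolding fmul_sum_right
      proof (rule sum.cong[OF refl])
        fix i assume i: "i \<in> {..<n}"
        show "?\<Phi> (\<Sum>j<m. fmul (?t i) (?t' j)) = (\<Sum>j<m. ?\<Phi> (fmul (?t i) (?t' j)))"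
          by (rule tensor_functional_lin_sum) (rule FA_finsupp[OF FA_fmul[OF t(1) t(2)]], use i in simp_all)
      qed
      finally show ?thesis .
    qed
    also have "\<dots> = (\<Sum>i<n. \<Sum>j<m. (\<eta> (uea_class L (a i)) * \<eta>' (uea_class M (b i))) *
        (\<eta> (uea_class L (a' j)) * \<eta>' (uea_class M (b' j))))"
    proof (intro sum.cong refl)
      fix i j assume "i \<in> {..<n}" "j \<in> {..<m}"
      then have ij: "i < n" "j < m" by auto
      have fa: "fmul (a i) (a' j) \<in> G.invariants" "fmul (b i) (b' j) \<in> H.invariants"
        using ab ab' ij G.invariants_fmul H.invariants_fmul by auto
      have faFA: "fmul (a i) (a' j) \<in> FA L" "fmul (b i) (b' j) \<in> FA M"
        using FAs ij by (auto intro!: FA_fmul)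
      \<comment> \<open>After interchanging the inner factors each component is a product of
        invariants, where \<eta> and \<eta>' are multiplicative.\<close>
      have "?\<Phi> (fmul (?t i) (?t' j)) = ?\<Phi> (fmul (inL (fmul (a i) (a' j))) (inR (fmul (b i) (b' j))))"
        by (rule cong[OF FA_fmul[OF t(1)[OF ij(1)] t(2)[OF ij(2)]] FA_fmul[OF inL_FA[OF faFA(1)] inR_FA[OF faFA(2)]]
              inL_inR_interchange[OF FAs(1)[OF ij(1)] FAs(2)[OF ij(1)] FAs(3)[OF ij(2)] FAs(4)[OF ij(2)]]])
      also have "\<dots> = \<eta> (uea_class L (fmul (a i) (a' j))) * \<eta>' (uea_class M (fmul (b i) (b' j)))"
        unfolding tensor[OF faFA] \<alpha>[OF fa(1)] \<beta>[OF fa(2)] ..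
      also have "\<dots> = (\<eta> (uea_class L (a i)) * \<eta>' (uea_class M (b i))) * (\<eta> (uea_class L (a' j)) * \<eta>' (uea_class M (b' j)))"
        unfolding G.character_class(2)[OF \<eta> ab(1)[OF ij(1)] ab'(1)[OF ij(2)]]
          H.character_class(2)[OF \<eta>' ab(2)[OF ij(1)] ab'(2)[OF ij(2)]] by (simp only: mult_ac)
      finally show "?\<Phi> (fmul (?t i) (?t' j)) =
        (\<eta> (uea_class L (a i)) * \<eta>' (uea_class M (b i))) * (\<eta> (uea_class L (a' j)) * \<eta>' (uea_class M (b' j)))" .
    qed
    also have "\<dots> = (\<Sum>i<n. pairing (a i) \<alpha> * pairing (b i) \<beta>) * (\<Sum>j<m. pairing (a' j) \<alpha> * pairing (b' j) \<beta>)"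
      unfolding sum_product by (intro sum.cong refl) (use \<alpha> \<beta> ab ab' in auto)
    also have "\<dots> = ?\<Phi> z * ?\<Phi> z'"
      using tensor_functional_decomposition[OF \<alpha>0 \<beta>0 dec zN(1)]
        tensor_functional_decomposition[OF \<alpha>0 \<beta>0 dec' zN(2)] by simp
    finally show ?thesis .
  qed
  have scal: "?\<Phi> (fscale c (word_ind [])) = c" for c
  proof -
    \<comment> \<open>The unit is the product of the images of the two units.\<close>
    have "?\<Phi> (fmul (inL (word_ind [])) (inR (word_ind []))) = 1"
      unfolding tensor[OF FA_word FA_word, of "[]" "[]", simplified]
      using \<alpha>[OF G.invariants_one] \<beta>[OF H.invariants_one] G.character_class(4)[OF \<eta> G.invariants_one G.invariants_one]
        H.character_class(4)[OF \<eta>' H.invariants_one H.invariants_one] by simp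
    then have "?\<Phi> (word_ind []) = 1"
      by (simp add: push_word fmul_one)
    then show ?thesis
      by (simp add: tensor_functional_def word_action_scale) (simp add: fscale_def)
  qed
  have ops: "mult (Z_alg P) = mult (U_alg P)" "add (Z_alg P) = add (U_alg P)" "one (Z_alg P) = one (U_alg P)"
    by (simp_all add: Z_alg_def)
  have sc: "\<psi> (uea_class N (\<lambda>w. c * word_ind [] w)) = c" for c
    using cls[OF FA_scale[OF FA_word[of "[]"]], of c] scal[of c] by (simp add: fscale_def)
  have "\<psi> \<in> ring_hom (Z_alg P) complex_ring"
  proof (rule ring_hom_memI)
    fix c d assume "c \<in> carrier (Z_alg P)" "d \<in> carrier (Z_alg P)"
    then obtain z z' where z: "z \<in> P.invariants" "z' \<in> P.invariants" "c = uea_class N z" "d = uea_class N z'"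
      unfolding P.Z_carrier_iff by blast
    then have zN: "z \<in> FA N" "z' \<in> FA N" by (auto simp: P.invariants_def)
    show "\<psi> (c \<otimes>\<^bsub>Z_alg P\<^esub> d) = \<psi> c \<otimes>\<^bsub>complex_ring\<^esub> \<psi> d"
      unfolding z(3,4) ops N.class_mult[OF zN] cls[OF FA_fmul[OF zN]] cls[OF zN(1)] cls[OF zN(2)] mult[OF z(1,2)]
      by (simp add: complex_ring_def)
    have "?\<Phi> (z + z') = ?\<Phi> z + ?\<Phi> z'"
      by (simp add: tensor_functional_def word_action_add[OF zN[THEN FA_finsupp]])
    then show "\<psi> (c \<oplus>\<^bsub>Z_alg P\<^esub> d) = \<psi> c \<oplus>\<^bsub>complex_ring\<^esub> \<psi> d"
      unfolding z(3,4) ops N.class_add[OF zN] cls[OF FA_add[OF zN]] cls[OF zN(1)] cls[OF zN(2)]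
      by (simp add: complex_ring_def)
  next
    show "\<psi> \<one>\<^bsub>Z_alg P\<^esub> = \<one>\<^bsub>complex_ring\<^esub>"
      unfolding ops N.class_one using sc[of 1] by (simp add: complex_ring_def)
  qed (simp add: complex_ring_def)
  then have "Z_character P \<psi>"
    using sc by (simp add: Z_character_def)
  moreover have "\<psi> (uea_map N (\<lambda>X. blk X 0) u \<otimes>\<^bsub>U_alg P\<^esub> uea_map N (\<lambda>Y. blk 0 Y) v) = \<eta> u * \<eta>' v"
    if uv: "u \<in> carrier (Z_alg G)" "v \<in> carrier (Z_alg H)" for u v
  proof -
    note u = G.rep_invariant[OF uv(1)] and v = H.rep_invariant[OF uv(2)]
    have FA: "rep u \<in> FA L" "rep v \<in> FA M" using u v by (auto simp: G.invariants_def H.invariants_def)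
    show ?thesis
      unfolding uea_map_def N.class_mult[OF inL_FA[OF FA(1)] inR_FA[OF FA(2)]]
        cls[OF FA_fmul[OF inL_FA[OF FA(1)] inR_FA[OF FA(2)]]] tensor[OF FA] \<alpha>[OF u(1)] \<beta>[OF v(1)] u(2) v(2) ..
  qed
  ultimately show ?thesis by blast
qed

text \<open>Existence turns the choice into a usable character; the second part is its defining
  property on representatives.\<close>

lemma prod_character:
  assumes "Z_character G \<eta>" "Z_character H \<eta>'"
  shows "Z_character P (prod_character G H \<eta> \<eta>')"
    and "a \<in> G.invariants \<Longrightarrow> b \<in> H.invariants \<Longrightarrow>
      prod_character G H \<eta> \<eta>' (uea_class N (fmul (inL a) (inR b))) = \<eta> (uea_class L a) * \<eta>' (uea_class M b)"
proof -
  have *: "Z_character P (prod_character G H \<eta> \<eta>') \<and> (\<forall>u\<in>carrier (Z_alg G). \<forall>v\<in>carrier (Z_alg H).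
     prod_character G H \<eta> \<eta>' (uea_map N (\<lambda>X. blk X 0) u \<otimes>\<^bsub>U_alg P\<^esub> uea_map N (\<lambda>Y. blk 0 Y) v) = \<eta> u * \<eta>' v)"
    unfolding prod_character_def by (rule someI_ex[OF prod_character_exists[OF assms]])
  then show "Z_character P (prod_character G H \<eta> \<eta>')" by (rule conjunct1)
  assume ab: "a \<in> G.invariants" "b \<in> H.invariants"
  then have FA: "a \<in> FA L" "b \<in> FA M" and Z: "uea_class L a \<in> carrier (Z_alg G)" "uea_class M b \<in> carrier (Z_alg H)"
    by (auto simp: G.invariants_def H.invariants_def)
  show "prod_character G H \<eta> \<eta>' (uea_class N (fmul (inL a) (inR b))) = \<eta> (uea_class L a) * \<eta>' (uea_class M b)"
    using conjunct2[OF *, THEN bspec, OF Z(1), THEN bspec, OF Z(2)]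
    unfolding uea_map_class[OF L.lie_subalg_axioms N.lie_subalg_axioms lie_hom_left FA(1)]
      uea_map_class[OF M.lie_subalg_axioms N.lie_subalg_axioms lie_hom_right FA(2)]
      N.class_mult[OF inL_FA[OF FA(1)] inR_FA[OF FA(2)]] .
qed

text \<open>Ad(g, h) acts on \<open>inL a\<close> through g and on \<open>inR b\<close> through
  h.\<close>

lemma inL_inR_invariant:
  assumes "a \<in> G.invariants" "b \<in> H.invariants"
  shows "fmul (inL a) (inR b) \<in> P.invariants"
proof (rule P.invariants_fmul)
  have FA: "a \<in> FA L" "b \<in> FA M" using assms by (auto simp: G.invariants_def H.invariants_def)
  show "inL a \<in> P.invariants"
    unfolding P.invariants_iff
  proof (intro conjI ballI inL_FA FA)
    fix x assume "x \<in> P"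
    then obtain g h where x: "x = blk g h" "g \<in> G" "h \<in> H" by (auto simp: prod_group_def)
    have "inL (push_words (Ad g) a - a) \<in> uea_ideal N"
      using assms(1) x by (intro push_ideal[OF L.lie_subalg_axioms N.lie_subalg_axioms lie_hom_left]) (simp add: G.invariants_iff)
    then show "push_words (Ad x) (inL a) - inL a \<in> uea_ideal N"
      unfolding x(1) push_Ad_blk(1)[OF x(2,3) FA(1)]
      by (simp only: push_diff[OF finsupp_push[OF FA_finsupp[OF FA(1)]] FA_finsupp[OF FA(1)]])
  qed
  show "inR b \<in> P.invariants"
    unfolding P.invariants_iff
  proof (intro conjI ballI inR_FA FA)
    fix x assume "x \<in> P"
    then obtain g h where x: "x = blk g h" "g \<in> G" "h \<in> H" by (auto simp: prod_group_def)
    have "inR (push_words (Ad h) b - b) \<in> uea_ideal N"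
      using assms(2) x by (intro push_ideal[OF M.lie_subalg_axioms N.lie_subalg_axioms lie_hom_right]) (simp add: H.invariants_iff)
    then show "push_words (Ad x) (inR b) - inR b \<in> uea_ideal N"
      unfolding x(1) push_Ad_blk(2)[OF x(2,3) FA(2)]
      by (simp only: push_diff[OF finsupp_push[OF FA_finsupp[OF FA(2)]] FA_finsupp[OF FA(2)]])
  qed
qed

end

section \<open>Pulling back along the multiplication map\<close>

text \<open>\<phi> is asked to be smooth on an open set around \<open>B\<close>, since smoothness on
  a group means smoothness of local extensions; these are composed with \<phi>.\<close>

lemma smooth_pullback:
  fixes A :: "(real^'n^'n) set" and B :: "(real^'m^'m) set" and \<phi> :: "real^'m^'m \<Rightarrow> real^'n^'n"
  assumes f: "f \<in> smooth_functions A" and V: "open V" "B \<subseteq> V" "\<And>k. Ck_on k V \<phi>"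
    and \<phi>: "\<And>x. x \<in> B \<Longrightarrow> \<phi> x \<in> A"
  shows "(\<lambda>x. if x \<in> B then f (\<phi> x) else 0) \<in> smooth_functions B"
  unfolding smooth_functions_iff
proof (intro conjI allI impI ballI)
  fix x assume x: "x \<in> B"
  obtain U F where "local_extension A f (\<phi> x) U F"
    using f \<phi>[OF x] unfolding smooth_functions_iff by blast
  then have U: "open U" "\<phi> x \<in> U" "\<And>k. Ck_on k U F" and F: "\<And>y. y \<in> U \<Longrightarrow> y \<in> A \<Longrightarrow> f y = F y"
    by (auto simp: local_extension_def)
  define W where "W = V \<inter> \<phi> -` U"
  have W: "open W" "x \<in> W"
    using continuous_open_preimage[OF Ck_on_continuous[OF V(3)] V(1) U(1)] V(2) U(2) x
    by (auto simp: W_def)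
  have "Ck_on k W (\<lambda>y. F (\<phi> y))" for k
    by (rule Ck_on_compose[OF U(1) W(1) _ Ck_on_subset[OF V(3)] U(3)]) (auto simp: W_def)
  then have "local_extension B (\<lambda>x. if x \<in> B then f (\<phi> x) else 0) x W (\<lambda>y. F (\<phi> y))"
    using W F \<phi> by (auto simp: local_extension_def W_def)
  then show "\<exists>U F. local_extension B (\<lambda>x. if x \<in> B then f (\<phi> x) else 0) x U F" by blast
qed simp

locale subgroup_pair = group_pair G H for G H :: "(real^'n^'n) set" +
  assumes sub: "H \<subseteq> G"
begin

text \<open>The pull-back seen on the product group before passing to cosets
  (\<open>lift_phi_pullback\<close>). It involves no choice of representatives, so derivatives are
  taken here.\<close>

definition pb :: "(real^'n^'n \<Rightarrow> complex) \<Rightarrow> real^('n + 'n)^('n + 'n) \<Rightarrow> complex" where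
  "pb f x = (if x \<in> P then f (lr x ** matrix_inv (ul x)) else 0)"

text \<open>Restriction along x |-> (x^-1, 1), which is a right inverse of (g, h) |-> h
  g^-1.\<close>

definition sect :: "(real^('n + 'n)^('n + 'n) \<Rightarrow> complex) \<Rightarrow> real^'n^'n \<Rightarrow> complex" where
  "sect F x = (if x \<in> G then F (blk (matrix_inv x) (mat 1)) else 0)"

lemma pb_blk: "g \<in> G \<Longrightarrow> h \<in> H \<Longrightarrow> pb f (blk g h) = f (h ** matrix_inv g)"
  by (simp add: pb_def)

lemma pb_off: "x \<notin> P \<Longrightarrow> pb f x = 0"
  by (simp add: pb_def)

lemma P_cases:
  assumes "x \<in> P"
  obtains g h where "g \<in> G" "h \<in> H" "x = blk g h"
  using assms by (auto simp: prod_group_def)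

lemma pb_smooth:
  assumes "f \<in> smooth_functions G"
  shows "pb f \<in> smooth_functions P"
proof -
  let ?V = "{x :: real^('n + 'n)^('n + 'n). invertible (ul x)}"
  have V: "open ?V"
    using open_vimage[OF open_invertible linear_continuous_on[OF bounded_linear_ul]] by (simp add: vimage_def)
  have "Ck_on k ?V (\<lambda>x. lr x ** matrix_inv (ul x))" for k
    by (intro Ck_on_bilinear[OF V bounded_bilinear_matrix_mult] Ck_on_bounded_linear[OF V] bounded_linear_lr
        Ck_on_compose[OF open_invertible V _ Ck_on_bounded_linear[OF V bounded_linear_ul] Ck_on_matrix_inv]) simp
  then have "(\<lambda>x. if x \<in> P then f (lr x ** matrix_inv (ul x)) else 0) \<in> smooth_functions P"
    using sub by (intro smooth_pullback[OF assms V]) (auto elim!: P_cases)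
  then show ?thesis
    by (simp add: pb_def[abs_def])
qed

lemma sect_smooth:
  assumes "F \<in> smooth_functions P"
  shows "sect F \<in> smooth_functions G"
proof -
  have "Ck_on k {x :: real^'n^'n. invertible x} (\<lambda>x. blk (matrix_inv x) (0 :: real^'n^'n) + blk (0 :: real^'n^'n) (mat 1))" for k
    by (intro Ck_on_add[OF open_invertible] Ck_on_compose_linear[OF open_invertible bounded_linear_blk_left]
        Ck_on_matrix_inv Ck_on_const[OF open_invertible])
  then have "Ck_on k {x :: real^'n^'n. invertible x} (\<lambda>x. blk (matrix_inv x) (mat 1 :: real^'n^'n))" for k
    by (simp add: blk_add)
  then have "(\<lambda>x. if x \<in> G then F (blk (matrix_inv x) (mat 1)) else 0) \<in> smooth_functions G"
    by (intro smooth_pullback[OF assms open_invertible]) auto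
  then show ?thesis
    by (simp add: sect_def[abs_def])
qed

text \<open>Inverting g turns exp(-tX) on its left into exp(tX) on the right of h g^-1. The sign in
  \<open>L_real\<close> thus disappears and a right derivative remains.\<close>

lemma L_real_left:
  assumes X: "X \<in> lie_algebra G"
  shows "L_real (blk X 0) (pb f) = pb (R_real X f)"
proof
  fix x
  have bX: "blk X 0 \<in> lie_algebra P"
    using X subspace_0[OF H.subspace_lie_algebra] by (auto simp: lie_algebra_prod)
  show "L_real (blk X 0) (pb f) x = pb (R_real X f) x"
  proof (cases "x \<in> P")
    case True
    then obtain g h where gh: "g \<in> G" "h \<in> H" "x = blk g h" by (rule P_cases)
    have "pb f (mexp ((- t) *\<^sub>R blk X 0) ** x) = f (h ** matrix_inv g ** mexp (t *\<^sub>R X))" for t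
    proof -
      have e: "mexp ((- t) *\<^sub>R X) \<in> G" using X by (rule G.mexp_mem)
      have "matrix_inv (mexp ((- t) *\<^sub>R X)) = mexp (t *\<^sub>R X)"
        by (rule matrix_inv_unique) simp
      then have inv: "matrix_inv (mexp ((- t) *\<^sub>R X) ** g) = matrix_inv g ** mexp (t *\<^sub>R X)"
        using gh e by (simp add: matrix_inv_mult)
      have "mexp ((- t) *\<^sub>R blk X 0) ** x = blk (mexp ((- t) *\<^sub>R X) ** g) h"
        unfolding gh(3) blk_scaleR mexp_blk blk_mult by simp
      then show ?thesis
        using gh e by (simp only: pb_blk G.mult_mem inv matrix_mul_assoc)
    qed
    then show ?thesis
      using gh by (simp add: L_real_def R_real_def pb_blk)
  next
    case False
    have "mexp ((- t) *\<^sub>R blk X 0) ** x \<notin> P" for t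
      using False P.mult_mem_cancel_left[OF P.mexp_mem[OF bX]] by blast
    then show ?thesis
      using False by (simp add: L_real_def pb_off)
  qed
qed

lemma L_real_right:
  assumes Y: "Y \<in> lie_algebra H"
  shows "L_real (blk 0 Y) (pb f) = pb (L_real Y f)"
proof
  fix x
  have bY: "blk 0 Y \<in> lie_algebra P"
    using Y subspace_0[OF G.subspace_lie_algebra] by (auto simp: lie_algebra_prod)
  show "L_real (blk 0 Y) (pb f) x = pb (L_real Y f) x"
  proof (cases "x \<in> P")
    case True
    then obtain g h where gh: "g \<in> G" "h \<in> H" "x = blk g h" by (rule P_cases)
    have "pb f (mexp ((- t) *\<^sub>R blk 0 Y) ** x) = f (mexp ((- t) *\<^sub>R Y) ** (h ** matrix_inv g))" for t
    proof -
      have e: "mexp ((- t) *\<^sub>R Y) \<in> H" using Y by (rule H.mexp_mem)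
      have "mexp ((- t) *\<^sub>R blk 0 Y) ** x = blk g (mexp ((- t) *\<^sub>R Y) ** h)"
        unfolding gh(3) blk_scaleR mexp_blk blk_mult by simp
      then show ?thesis
        using gh e by (simp only: pb_blk H.mult_mem matrix_mul_assoc)
    qed
    then show ?thesis
      using gh by (simp add: L_real_def pb_blk)
  next
    case False
    have "mexp ((- t) *\<^sub>R blk 0 Y) ** x \<notin> P" for t
      using False P.mult_mem_cancel_left[OF P.mexp_mem[OF bY]] by blast
    then show ?thesis
      using False by (simp add: L_real_def pb_off)
  qed
qed

lemma pb_add: "pb (f + f') = pb f + pb f'"
  by (auto simp: pb_def)

lemma pb_scale: "pb (fscale c f) = fscale c (pb f)"
  by (auto simp: pb_def fscale_def)

lemma pb_sum: "pb (\<Sum>i\<in>I. f i) = (\<Sum>i\<in>I. pb (f i))"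
  by (auto simp: pb_def sum_fun_apply)

lemma L_lie_left:
  assumes X: "X \<in> L"
  shows "L_lie (blk X 0) (pb f) = pb (R_lie X f)"
proof -
  have m: "map_matrix Re (blk X 0) = blk (map_matrix Re X) 0" "map_matrix Im (blk X 0) = blk (map_matrix Im X) 0"
    by (simp_all add: blk_eq_simps map_matrix_def)
  have R: "R_lie X f = R_real (map_matrix Re X) f + fscale \<i> (R_real (map_matrix Im X) f)"
    by (rule ext) (simp add: R_lie_def fscale_def)
  have "L_lie (blk X 0) (pb f) = L_real (blk (map_matrix Re X) 0) (pb f) + fscale \<i> (L_real (blk (map_matrix Im X) 0) (pb f))"
    by (rule ext) (simp add: L_lie_def fscale_def m)
  also have "\<dots> = pb (R_lie X f)"
    using X unfolding R pb_add pb_scale by (simp add: complexification_def L_real_left)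
  finally show ?thesis .
qed

lemma L_lie_right:
  assumes Y: "Y \<in> M"
  shows "L_lie (blk 0 Y) (pb f) = pb (L_lie Y f)"
proof -
  have m: "map_matrix Re (blk 0 Y) = blk 0 (map_matrix Re Y)" "map_matrix Im (blk 0 Y) = blk 0 (map_matrix Im Y)"
    by (simp_all add: blk_eq_simps map_matrix_def)
  have R: "L_lie Y f = L_real (map_matrix Re Y) f + fscale \<i> (L_real (map_matrix Im Y) f)"
    by (rule ext) (simp add: L_lie_def fscale_def)
  have "L_lie (blk 0 Y) (pb f) = L_real (blk 0 (map_matrix Re Y)) (pb f) + fscale \<i> (L_real (blk 0 (map_matrix Im Y)) (pb f))"
    by (rule ext) (simp add: L_lie_def fscale_def m)
  also have "\<dots> = pb (L_lie Y f)"
    using Y unfolding R pb_add pb_scale by (simp add: complexification_def L_real_right)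
  finally show ?thesis .
qed

lemma action_inL:
  assumes a: "a \<in> FA L"
  shows "word_action L_lie (inL a) (pb f) = pb (word_action R_lie a f)"
proof -
  have fold: "foldr L_lie (map (\<lambda>X. blk X 0) w) (pb f) = pb (foldr R_lie w f)" if "set w \<subseteq> L" for w
    using that by (induction w) (simp_all add: L_lie_left)
  have "word_action L_lie (inL a) (pb f) = word_action (L_lie \<circ> (\<lambda>X. blk X 0)) a (pb f)"
    by (rule word_action_push[OF FA_finsupp[OF a]])
  also have "\<dots> = (\<Sum>w | a w \<noteq> 0. fscale (a w) (pb (foldr R_lie w f)))"
    unfolding word_action_eq_sum using a fold by (intro sum.cong) (auto simp: FA_iff foldr_map)
  also have "\<dots> = pb (word_action R_lie a f)"
    unfolding word_action_eq_sum pb_sum pb_scale ..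
  finally show ?thesis .
qed

lemma action_inR:
  assumes b: "b \<in> FA M"
  shows "word_action L_lie (inR b) (pb f) = pb (word_action L_lie b f)"
proof -
  have fold: "foldr L_lie (map (\<lambda>Y. blk 0 Y) w) (pb f) = pb (foldr L_lie w f)" if "set w \<subseteq> M" for w
    using that by (induction w) (simp_all add: L_lie_right)
  have "word_action L_lie (inR b) (pb f) = word_action (L_lie \<circ> (\<lambda>Y. blk 0 Y)) b (pb f)"
    by (rule word_action_push[OF FA_finsupp[OF b]])
  also have "\<dots> = (\<Sum>w | b w \<noteq> 0. fscale (b w) (pb (foldr L_lie w f)))"
    unfolding word_action_eq_sum using b fold by (intro sum.cong) (auto simp: FA_iff foldr_map)
  also have "\<dots> = pb (word_action L_lie b f)"
    unfolding word_action_eq_sum pb_sum pb_scale ..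
  finally show ?thesis .
qed

section \<open>Actions on functions on the group and on the product\<close>

lemma H_in_G_algebra: "lie_algebra H \<subseteq> lie_algebra G"
  using sub by (auto simp: lie_algebra_def)

sublocale RG: lie_rep L R_lie "smooth_functions G"
  by (rule G.lie_rep_R[OF G.subspace_lie_algebra G.bracket_in_lie_algebra subset_refl])

sublocale LH: lie_rep M L_lie "smooth_functions G"
  by (rule G.lie_rep_L[OF H.subspace_lie_algebra H.bracket_in_lie_algebra H_in_G_algebra])

sublocale LP: lie_rep N L_lie "smooth_functions P"
  by (rule P.lie_rep_L[OF P.subspace_lie_algebra P.bracket_in_lie_algebra subset_refl])

lemma action_tensor:
  assumes f: "f \<in> smooth_functions G" and a: "a \<in> FA L" and b: "b \<in> FA M"
  shows "word_action L_lie (fmul (inL a) (inR b)) (pb f) = pb (word_action R_lie a (word_action L_lie b f))"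
  unfolding LP.word_action_fmul[OF inL_FA[OF a] inR_FA[OF b] pb_smooth[OF f]] action_inR[OF b] action_inL[OF a] ..

lemma R_act_class:
  assumes "f \<in> smooth_functions G" "a \<in> FA L"
  shows "R_act (uea_class L a) f = word_action R_lie a f"
  unfolding R_act_def using L.rep_class[OF assms(2)] assms
  by (intro RG.word_action_cong_ideal[OF L.lie_subalg_axioms]) auto

lemma L_act_class:
  assumes "f \<in> smooth_functions G" "b \<in> FA M"
  shows "L_act (uea_class M b) f = word_action L_lie b f"
  unfolding L_act_def using M.rep_class[OF assms(2)] assms
  by (intro LH.word_action_cong_ideal[OF M.lie_subalg_axioms]) auto

lemma L_act_class_prod:
  assumes "F \<in> smooth_functions P" "z \<in> FA N"
  shows "L_act (uea_class N z) F = word_action L_lie z F"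
  unfolding L_act_def using N.rep_class[OF assms(2)] assms
  by (intro LP.word_action_cong_ideal[OF N.lie_subalg_axioms]) auto

text \<open>A point x of \<open>G\<close> is the value of h g^-1 at (x^-1, 1), so the pull-back
  loses nothing on \<open>G\<close>.\<close>

lemma pb_inj:
  assumes "pb f = pb f'" "\<And>x. x \<notin> G \<Longrightarrow> f x = 0" "\<And>x. x \<notin> G \<Longrightarrow> f' x = 0"
  shows "f = f'"
proof
  fix x
  show "f x = f' x"
  proof (cases "x \<in> G")
    case True
    then have "pb f (blk (matrix_inv x) (mat 1)) = f x" for f
      by (simp add: pb_blk matrix_inv_matrix_inv)
    then show ?thesis using assms(1) by metis
  qed (use assms in simp)
qed

text \<open>One direction tests the product with pairs (u, 1) and (1, v) and uses injectivity of the
  pull-back; the other decomposes an invariant of the product into invariant factors, on each of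
  which the eigenvalues are known.\<close>

lemma eigen_iff:
  assumes \<eta>: "Z_character G \<eta>" and \<eta>': "Z_character H \<eta>'" and f: "f \<in> smooth_functions G"
  shows "(\<forall>u\<in>carrier (Z_alg P). L_act u (pb f) = fscale (prod_character G H \<eta> \<eta>' u) (pb f)) \<longleftrightarrow>
    (\<forall>u\<in>carrier (Z_alg G). R_act u f = fscale (\<eta> u) f) \<and> (\<forall>v\<in>carrier (Z_alg H). L_act v f = fscale (\<eta>' v) f)"
    (is "?lhs \<longleftrightarrow> ?rhs")
proof
  let ?\<psi> = "prod_character G H \<eta> \<eta>'"
  note \<psi> = prod_character[OF \<eta> \<eta>']
  have off: "x \<notin> G \<Longrightarrow> f x = 0" for x using f by (simp add: smooth_functions_iff)
  {
    assume lhs: ?lhs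
    have key: "pb (word_action R_lie a (word_action L_lie b f)) = pb (fscale (\<eta> (uea_class L a) * \<eta>' (uea_class M b)) f)"
      if ab: "a \<in> G.invariants" "b \<in> H.invariants" for a b
    proof -
      have FA: "a \<in> FA L" "b \<in> FA M" using ab by (auto simp: G.invariants_def H.invariants_def)
      note inv = inL_inR_invariant[OF ab]
      have z: "fmul (inL a) (inR b) \<in> FA N" "uea_class N (fmul (inL a) (inR b)) \<in> carrier (Z_alg P)"
        using inv by (auto simp: P.invariants_def)
      have "pb (word_action R_lie a (word_action L_lie b f)) = L_act (uea_class N (fmul (inL a) (inR b))) (pb f)"
        unfolding L_act_class_prod[OF pb_smooth[OF f] z(1)] action_tensor[OF f FA] ..
      also have "\<dots> = fscale (\<eta> (uea_class L a) * \<eta>' (uea_class M b)) (pb f)"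
        unfolding lhs[THEN bspec, OF z(2)] \<psi>(2)[OF ab] ..
      finally show ?thesis unfolding pb_scale .
    qed
    have zero: "g x = 0" if "g \<in> smooth_functions G" "x \<notin> G" for g x
      using that by (simp add: smooth_functions_iff)
    show ?rhs
    proof (intro conjI ballI)
      fix u assume u: "u \<in> carrier (Z_alg G)"
      note r = G.rep_invariant[OF u]
      have rFA: "rep u \<in> FA L" using r(1) by (simp add: G.invariants_def)
      \<comment> \<open>The second factor is the unit, on which \<eta>' takes the value 1.\<close>
      have "pb (word_action R_lie (rep u) f) = pb (fscale (\<eta> u) f)"
        using key[OF r(1) H.invariants_one] H.character_class(4)[OF \<eta>' H.invariants_one H.invariants_one] r(2) by simp
      then have "word_action R_lie (rep u) f = fscale (\<eta> u) f"
        by (rule pb_inj) (use zero[OF RG.word_action_closed[OF rFA f]] zero[OF smooth_functions_scale[OF f]] in auto)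
      then show "R_act u f = fscale (\<eta> u) f" by (simp add: R_act_def)
    next
      fix v assume v: "v \<in> carrier (Z_alg H)"
      note r = H.rep_invariant[OF v]
      have rFA: "rep v \<in> FA M" using r(1) by (simp add: H.invariants_def)
      have "pb (word_action L_lie (rep v) f) = pb (fscale (\<eta>' v) f)"
        using key[OF G.invariants_one r(1)] G.character_class(4)[OF \<eta> G.invariants_one G.invariants_one] r(2) by simp
      then have "word_action L_lie (rep v) f = fscale (\<eta>' v) f"
        by (rule pb_inj) (use zero[OF LH.word_action_closed[OF rFA f]] zero[OF smooth_functions_scale[OF f]] in auto)
      then show "L_act v f = fscale (\<eta>' v) f" by (simp add: L_act_def)
    qed
  next
    assume rhs: ?rhs
    show ?lhs
    proof
      fix u assume u: "u \<in> carrier (Z_alg P)"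
      note r = P.rep_invariant[OF u]
      have z: "rep u \<in> FA N" "uea_class N (rep u) \<in> carrier (Z_alg P)" using r u by (auto simp: P.invariants_def)
      have "\<exists>n a b. decomposition n a b (rep u) \<and> (\<forall>i<n. uea_class L (a i) \<in> carrier (Z_alg G)) \<and>
          (\<forall>i<n. uea_class M (b i) \<in> carrier (Z_alg H))"
        by (rule Z_decomposition[OF z]) (intro exI conjI allI impI)
      then obtain n a b where dec: "decomposition n a b (rep u)"
        and inv: "\<And>i. i < n \<Longrightarrow> uea_class L (a i) \<in> carrier (Z_alg G)" "\<And>i. i < n \<Longrightarrow> uea_class M (b i) \<in> carrier (Z_alg H)"
        by blast
      have FA: "\<And>i. i < n \<Longrightarrow> a i \<in> FA L" "\<And>i. i < n \<Longrightarrow> b i \<in> FA M"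
        and dI: "rep u - (\<Sum>i<n. fmul (inL (a i)) (inR (b i))) \<in> uea_ideal N"
        using dec by (auto simp: decomposition_def)
      have ab: "\<And>i. i < n \<Longrightarrow> a i \<in> G.invariants" "\<And>i. i < n \<Longrightarrow> b i \<in> H.invariants"
        using FA inv by (auto simp: G.invariants_def H.invariants_def)
      let ?t = "\<lambda>i. fmul (inL (a i)) (inR (b i))" and ?c = "\<lambda>i. \<eta> (uea_class L (a i)) * \<eta>' (uea_class M (b i))"
      have t: "\<And>i. i < n \<Longrightarrow> ?t i \<in> P.invariants" using inL_inR_invariant ab by blast
      have tFA: "\<And>i. i < n \<Longrightarrow> ?t i \<in> FA N" using t by (auto simp: P.invariants_def)
      have S: "(\<Sum>i<n. ?t i) \<in> FA N" by (rule FA_sum) (use tFA in simp)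
      have act: "word_action L_lie (?t i) (pb f) = fscale (?c i) (pb f)" if i: "i < n" for i
      proof -
        have "word_action L_lie (b i) f = fscale (\<eta>' (uea_class M (b i))) f"
          using rhs inv(2)[OF i] L_act_class[OF f FA(2)[OF i]] by metis
        moreover have "word_action R_lie (a i) f = fscale (\<eta> (uea_class L (a i))) f"
          using rhs inv(1)[OF i] R_act_class[OF f FA(1)[OF i]] by metis
        ultimately show ?thesis
          unfolding action_tensor[OF f FA(1)[OF i] FA(2)[OF i]]
          by (simp add: RG.word_action_fun_scale[OF FA(1)[OF i] f] pb_scale mult.commute)
      qed
      have "L_act u (pb f) = word_action L_lie (\<Sum>i<n. ?t i) (pb f)"
        unfolding L_act_def by (rule LP.word_action_cong_ideal[OF N.lie_subalg_axioms z(1) S dI pb_smooth[OF f]])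
      also have "\<dots> = (\<Sum>i<n. word_action L_lie (?t i) (pb f))"
        by (rule word_action_sum) (use tFA FA_finsupp in blast)
      also have "\<dots> = fscale (\<Sum>i<n. ?c i) (pb f)"
        unfolding fun_vs.scale_sum_left by (rule sum.cong) (use act in auto)
      also have "(\<Sum>i<n. ?c i) = ?\<psi> u"
      proof -
        \<comment> \<open>The character is additive for two invariant summands at a time, so
          invariance of the partial sums is carried along the induction.\<close>
        have sum: "(\<Sum>i<m. ?t i) \<in> P.invariants \<and> ?\<psi> (uea_class N (\<Sum>i<m. ?t i)) = (\<Sum>i<m. ?c i)" if "m \<le> n" for m
          using that
        proof (induction m)
          case 0
          have z0: "0 \<in> P.invariants" using P.invariants_scale[OF P.invariants_one, of 0] unfolding fun_vs.scale_zero_left .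
          have "?\<psi> (uea_class N 0) = 0"
            using P.character_class(3)[OF \<psi>(1) z0 z0, of 0] unfolding fun_vs.scale_zero_left by simp
          then show ?case using z0 by (simp del: zero_fun_apply)
        next
          case (Suc m)
          then have m: "m < n" and IH: "(\<Sum>i<m. ?t i) \<in> P.invariants" "?\<psi> (uea_class N (\<Sum>i<m. ?t i)) = (\<Sum>i<m. ?c i)"
            by auto
          have "?\<psi> (uea_class N ((\<Sum>i<m. ?t i) + ?t m)) = (\<Sum>i<m. ?c i) + ?c m"
            unfolding P.character_class(1)[OF \<psi>(1) IH(1) t[OF m]] IH(2) \<psi>(2)[OF ab(1)[OF m] ab(2)[OF m]] ..
          then show ?case
            unfolding sum.lessThan_Suc using P.invariants_add[OF IH(1) t[OF m]] by blast
        qed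
        have "uea_class N (\<Sum>i<n. ?t i) = uea_class N (rep u)"
          using N.class_eq_iff[OF z(1) S] dI by simp
        then show ?thesis using sum[of n] r(2) by simp
      qed
      finally show "L_act u (pb f) = fscale (?\<psi> u) (pb f)" .
    qed
  }
qed

section \<open>Cosets of the diagonal subgroup\<close>

abbreviation "D \<equiv> diag_group H"

lemma coset_iff: "y \<in> blk g h <#\<^bsub>GL\<^esub> D \<longleftrightarrow> (\<exists>x\<in>H. y = blk (g ** x) (h ** x))"
  by (auto simp: l_coset_def diag_group_def blk_mult)

lemma coset_space_iff: "c \<in> coset_space P D \<longleftrightarrow> (\<exists>g\<in>G. \<exists>h\<in>H. c = blk g h <#\<^bsub>GL\<^esub> D)"
  by (auto simp: coset_space_def prod_group_def)

lemma coset_mult: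
  assumes "x \<in> H"
  shows "blk (g ** x) (h ** x) <#\<^bsub>GL\<^esub> D = blk g h <#\<^bsub>GL\<^esub> D"
proof (intro Set.set_eqI iffI)
  fix y
  assume "y \<in> blk (g ** x) (h ** x) <#\<^bsub>GL\<^esub> D"
  then show "y \<in> blk g h <#\<^bsub>GL\<^esub> D"
    using assms H.mult_mem unfolding coset_iff by (metis matrix_mul_assoc)
next
  fix y
  assume "y \<in> blk g h <#\<^bsub>GL\<^esub> D"
  then obtain z where z: "z \<in> H" "y = blk (g ** z) (h ** z)" unfolding coset_iff by blast
  have xz: "x ** (matrix_inv x ** z) = z"
    using assms by (simp add: matrix_mul_assoc matrix_inv_mult_self)
  have "y = blk (g ** x ** (matrix_inv x ** z)) (h ** x ** (matrix_inv x ** z))"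
    unfolding z(2) matrix_mul_assoc[symmetric] xz ..
  then show "y \<in> blk (g ** x) (h ** x) <#\<^bsub>GL\<^esub> D"
    using assms z(1) unfolding coset_iff by (intro bexI[of _ "matrix_inv x ** z"]) auto
qed

lemma left_translate_coset:
  assumes "k \<in> G" "k' \<in> H"
  shows "matrix_inv (blk k k') <#\<^bsub>GL\<^esub> (blk g h <#\<^bsub>GL\<^esub> D) = blk (matrix_inv k ** g) (matrix_inv k' ** h) <#\<^bsub>GL\<^esub> D"
  unfolding matrix_inv_blk[OF G.invertible[OF assms(1)] H.invertible[OF assms(2)]]
  by (auto simp: l_coset_def diag_group_def blk_mult matrix_mul_assoc)

text \<open>The choice in \<open>phi_pullback\<close> is harmless: (g x, h x) gives h x x^-1 g^-1 =
  h g^-1.\<close>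

lemma phi_pullback_coset:
  assumes gh: "g \<in> G" "h \<in> H"
  shows "phi_pullback G H f (blk g h <#\<^bsub>GL\<^esub> D) = f (h ** matrix_inv g)"
proof -
  let ?c = "blk g h <#\<^bsub>GL\<^esub> D"
  let ?p = "SOME p. case p of (g, h) \<Rightarrow> blk g h \<in> ?c"
  have "blk g h \<in> ?c"
    unfolding coset_iff by (intro bexI[of _ "mat 1"]) auto
  then have "case (g, h) of (g, h) \<Rightarrow> blk g h \<in> ?c" by simp
  then have "case ?p of (g, h) \<Rightarrow> blk g h \<in> ?c" by (rule someI)
  then obtain g' h' x where p: "?p = (g', h')" and x: "x \<in> H" "g' = g ** x" "h' = h ** x"
    unfolding coset_iff by (auto split: prod.splits)
  have xG: "x \<in> G" using x(1) sub by blast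
  have "h ** x ** matrix_inv (g ** x) = h ** (x ** matrix_inv x) ** matrix_inv g"
    unfolding matrix_inv_mult[OF G.invertible[OF gh(1)] G.invertible[OF xG]] by (simp only: matrix_mul_assoc)
  then have "phi ?p = h ** matrix_inv g"
    unfolding p phi_def using xG by (simp add: x(2,3) matrix_inv_mult_self)
  moreover have "?c \<in> coset_space P D" using gh coset_space_iff by blast
  ultimately show ?thesis by (simp add: phi_pullback_def)
qed

lemma lift_phi_pullback: "lift_fun P D (phi_pullback G H f) = pb f"
proof
  fix x
  show "lift_fun P D (phi_pullback G H f) x = pb f x"
  proof (cases "x \<in> P")
    case True
    then obtain g h where "g \<in> G" "h \<in> H" "x = blk g h" by (rule P_cases)
    then show ?thesis using True by (simp add: lift_fun_def phi_pullback_coset pb_blk)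
  qed (simp add: lift_fun_def pb_off)
qed

lemma phi_pullback_off: "c \<notin> coset_space P D \<Longrightarrow> phi_pullback G H f c = 0"
  by (simp add: phi_pullback_def)

lemma phi_pullback_add: "phi_pullback G H (f + f') = phi_pullback G H f + phi_pullback G H f'"
  by (rule ext) (simp add: phi_pullback_def)

lemma phi_pullback_scale: "phi_pullback G H (fscale c f) = fscale c (phi_pullback G H f)"
  by (rule ext) (simp add: phi_pullback_def fscale_def)

lemma phi_pullback_inj:
  assumes "phi_pullback G H f = phi_pullback G H f'" "f \<in> smooth_functions G" "f' \<in> smooth_functions G"
  shows "f = f'"
  by (rule pb_inj) (use assms lift_phi_pullback[symmetric] in \<open>auto simp: smooth_functions_iff\<close>)

text \<open>The coset of (g, h) also contains (g h^-1, 1), which is the point that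
  \<open>sect\<close> uses at h g^-1.\<close>

lemma phi_pullback_sect:
  assumes F: "F \<in> smooth_functions_quot P D"
  shows "phi_pullback G H (sect (lift_fun P D F)) = F"
proof
  fix c
  show "phi_pullback G H (sect (lift_fun P D F)) c = F c"
  proof (cases "c \<in> coset_space P D")
    case True
    then obtain g h where gh: "g \<in> G" "h \<in> H" "c = blk g h <#\<^bsub>GL\<^esub> D" unfolding coset_space_iff by blast
    have hG: "h \<in> G" using gh sub by blast
    have "matrix_inv (h ** matrix_inv g) = g ** matrix_inv h"
      using gh hG by (simp add: matrix_inv_mult invertible_matrix_inv matrix_inv_matrix_inv)
    then have "phi_pullback G H (sect (lift_fun P D F)) c = F (blk (g ** matrix_inv h) (mat 1) <#\<^bsub>GL\<^esub> D)"
      unfolding gh(3) phi_pullback_coset[OF gh(1,2)] using gh hG by (simp add: sect_def lift_fun_def)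
    also have "blk (g ** matrix_inv h) (mat 1) <#\<^bsub>GL\<^esub> D = c"
      using coset_mult[OF gh(2), of "g ** matrix_inv h" "mat 1"] hG
      unfolding gh(3) by (simp add: matrix_inv_mult_self flip: matrix_mul_assoc)
    finally show ?thesis .
  next
    case False
    then show ?thesis using F by (simp add: smooth_functions_quot_def phi_pullback_off)
  qed
qed

text \<open>Translation by (k, k')^-1 turns h g^-1 into k'^-1 h g^-1 k, and h g^-1 runs through all
  of \<open>G\<close>.\<close>

lemma fixed_iff:
  assumes K: "linear_group K" "K \<subseteq> G"
  shows "(\<forall>k\<in>prod_group K (K \<inter> H). \<forall>c\<in>coset_space P D.
      phi_pullback G H f (matrix_inv k <#\<^bsub>GL\<^esub> c) = phi_pullback G H f c) \<longleftrightarrow>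
    (\<forall>k'\<in>K \<inter> H. \<forall>k\<in>K. \<forall>g\<in>G. f (k' ** g ** k) = f g)"
    (is "?lhs \<longleftrightarrow> ?rhs")
proof -
  interpret K: linear_group K by fact
  have key: "phi_pullback G H f (matrix_inv (blk k k') <#\<^bsub>GL\<^esub> (blk g h <#\<^bsub>GL\<^esub> D)) =
      f (matrix_inv k' ** (h ** matrix_inv g) ** k)"
    if "k \<in> K" "k' \<in> K \<inter> H" "g \<in> G" "h \<in> H" for k k' g h
  proof -
    have kG: "k \<in> G" and k'H: "k' \<in> H" using that K(2) by auto
    have "matrix_inv (matrix_inv k ** g) = matrix_inv g ** k"
      using that kG by (simp add: matrix_inv_mult invertible_matrix_inv matrix_inv_matrix_inv)
    then show ?thesis
      unfolding left_translate_coset[OF kG k'H] using that kG k'H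
      by (simp add: phi_pullback_coset matrix_mul_assoc)
  qed
  show ?thesis
  proof
    assume lhs: ?lhs
    show ?rhs
    proof (intro ballI)
      fix k' k g assume k': "k' \<in> K \<inter> H" and k: "k \<in> K" and g: "g \<in> G"
      \<comment> \<open>\<open>fixed_vectors\<close> translates by inverses, so k' is inverted
        beforehand; k needs no such correction, because the first component is inverted once more in
        h g^-1.\<close>
      have k'i: "matrix_inv k' \<in> K \<inter> H" using k' by simp
      have "blk k (matrix_inv k') \<in> prod_group K (K \<inter> H)" using k k'i by simp
      moreover have "blk (matrix_inv g) (mat 1) <#\<^bsub>GL\<^esub> D \<in> coset_space P D"
        unfolding coset_space_iff using g by (intro bexI[of _ "matrix_inv g"] bexI[of _ "mat 1"] refl) auto
      ultimately have "phi_pullback G H f (matrix_inv (blk k (matrix_inv k')) <#\<^bsub>GL\<^esub> (blk (matrix_inv g) (mat 1) <#\<^bsub>GL\<^esub> D)) =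
          phi_pullback G H f (blk (matrix_inv g) (mat 1) <#\<^bsub>GL\<^esub> D)"
        using lhs by blast
      then show "f (k' ** g ** k) = f g"
        using key[OF k k'i, of "matrix_inv g" "mat 1"] g k'
        by (simp add: phi_pullback_coset matrix_inv_matrix_inv)
    qed
  next
    assume rhs: ?rhs
    show ?lhs
    proof (intro ballI)
      fix x c assume xK: "x \<in> prod_group K (K \<inter> H)" and cQ: "c \<in> coset_space P D"
      from xK obtain k k' where x: "x = blk k k'" "k \<in> K" "k' \<in> K \<inter> H"
        unfolding prod_group_def by blast
      from cQ obtain g h where c: "c = blk g h <#\<^bsub>GL\<^esub> D" "g \<in> G" "h \<in> H"
        unfolding coset_space_iff by blast
      have "matrix_inv k' \<in> K \<inter> H" "h ** matrix_inv g \<in> G" using x c sub by auto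
      then have "f (matrix_inv k' ** (h ** matrix_inv g) ** k) = f (h ** matrix_inv g)"
        using rhs x(2) by blast
      then show "phi_pullback G H f (matrix_inv x <#\<^bsub>GL\<^esub> c) = phi_pullback G H f c"
        unfolding x(1) c(1) key[OF x(2,3) c(2,3)] phi_pullback_coset[OF c(2,3)] .
    qed
  qed
qed

section \<open>Shintani functions and the linear isomorphism\<close>

lemma Sh_iff:
  "f \<in> Sh G H K \<eta> \<eta>' \<longleftrightarrow> f \<in> smooth_functions G \<and>
     (\<forall>k'\<in>K \<inter> H. \<forall>k\<in>K. \<forall>g\<in>G. f (k' ** g ** k) = f g) \<and>
     (\<forall>u\<in>carrier (Z_alg G). R_act u f = fscale (\<eta> u) f) \<and> (\<forall>v\<in>carrier (Z_alg H). L_act v f = fscale (\<eta>' v) f)"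
  by (simp add: Sh_def fscale_def)

lemma phi_pullback_in_Hom_iff:
  assumes K: "linear_group K" "K \<subseteq> G" and \<eta>: "Z_character G \<eta>" "Z_character H \<eta>'" and f: "f \<in> smooth_functions G"
  shows "phi_pullback G H f \<in> Hom_trivial G H K \<eta> \<eta>' \<longleftrightarrow> f \<in> Sh G H K \<eta> \<eta>'"
  unfolding Hom_trivial_def fixed_vectors_def eigen_functions_quot_def smooth_functions_quot_def mem_Collect_eq
    lift_phi_pullback fixed_iff[OF K] Sh_iff
  using eigen_iff[OF \<eta> f] f pb_smooth[OF f] phi_pullback_off by (auto simp: fscale_def)

lemma subspace_Sh: "fun_vs.subspace (Sh G H K \<eta> \<eta>')"
proof (rule fun_vs.subspaceI)
  have FAG: "rep u \<in> FA L" if "u \<in> carrier (Z_alg G)" for u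
    using G.rep_invariant(1)[OF that] by (simp add: G.invariants_def)
  have FAH: "rep v \<in> FA M" if "v \<in> carrier (Z_alg H)" for v
    using H.rep_invariant(1)[OF that] by (simp add: H.invariants_def)
  have R_scale: "R_act u (fscale c f) = fscale c (R_act u f)" if "u \<in> carrier (Z_alg G)" "f \<in> smooth_functions G" for u c f
    unfolding R_act_def by (rule RG.word_action_fun_scale[OF FAG[OF that(1)] that(2)])
  have L_scale: "L_act v (fscale c f) = fscale c (L_act v f)" if "v \<in> carrier (Z_alg H)" "f \<in> smooth_functions G" for v c f
    unfolding L_act_def by (rule LH.word_action_fun_scale[OF FAH[OF that(1)] that(2)])
  have R_add: "R_act u (f + g) = R_act u f + R_act u g"
    if "u \<in> carrier (Z_alg G)" "f \<in> smooth_functions G" "g \<in> smooth_functions G" for u f g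
    unfolding R_act_def by (rule RG.word_action_fun_add[OF FAG[OF that(1)] that(2,3)])
  have L_add: "L_act v (f + g) = L_act v f + L_act v g"
    if "v \<in> carrier (Z_alg H)" "f \<in> smooth_functions G" "g \<in> smooth_functions G" for v f g
    unfolding L_act_def by (rule LH.word_action_fun_add[OF FAH[OF that(1)] that(2,3)])
  have R0: "R_act u 0 = fscale c 0" if "u \<in> carrier (Z_alg G)" for u c
    using R_scale[OF that smooth_functions_zero, of 0] unfolding fun_vs.scale_zero_left fun_vs.scale_zero_right .
  have L0: "L_act v 0 = fscale c 0" if "v \<in> carrier (Z_alg H)" for v c
    using L_scale[OF that smooth_functions_zero, of 0] unfolding fun_vs.scale_zero_left fun_vs.scale_zero_right .
  show "0 \<in> Sh G H K \<eta> \<eta>'"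
    unfolding Sh_iff using smooth_functions_zero R0 L0 by auto
  fix f assume f: "f \<in> Sh G H K \<eta> \<eta>'"
  show "fscale c f \<in> Sh G H K \<eta> \<eta>'" for c
    unfolding Sh_iff
  proof (intro conjI ballI)
    show "fscale c f \<in> smooth_functions G"
      using f smooth_functions_scale unfolding Sh_iff by blast
    show "fscale c f (k' ** g ** k) = fscale c f g" if "k' \<in> K \<inter> H" "k \<in> K" "g \<in> G" for k' g k
      using f that unfolding Sh_iff fscale_def by simp
    show "R_act u (fscale c f) = fscale (\<eta> u) (fscale c f)" if "u \<in> carrier (Z_alg G)" for u
      using f that R_scale unfolding Sh_iff by (simp add: mult.commute)
    show "L_act v (fscale c f) = fscale (\<eta>' v) (fscale c f)" if "v \<in> carrier (Z_alg H)" for v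
      using f that L_scale unfolding Sh_iff by (simp add: mult.commute)
  qed
  fix g assume g: "g \<in> Sh G H K \<eta> \<eta>'"
  show "f + g \<in> Sh G H K \<eta> \<eta>'"
    unfolding Sh_iff
  proof (intro conjI ballI)
    show "f + g \<in> smooth_functions G"
      using f g unfolding Sh_iff by (intro smooth_functions_add) auto
    show "(f + g) (k' ** x ** k) = (f + g) x" if "k' \<in> K \<inter> H" "k \<in> K" "x \<in> G" for k' x k
      using f g that unfolding Sh_iff by simp
    show "R_act u (f + g) = fscale (\<eta> u) (f + g)" if "u \<in> carrier (Z_alg G)" for u
      using f g that R_add unfolding Sh_iff fun_vs.scale_right_distrib by simp
    show "L_act v (f + g) = fscale (\<eta>' v) (f + g)" if "v \<in> carrier (Z_alg H)" for v
      using f g that L_add unfolding Sh_iff fun_vs.scale_right_distrib by simp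
  qed
qed

text \<open>Surjectivity comes from the section: \<open>phi_pullback_in_Hom_iff\<close> is an
  equivalence, so the section of an element of the target is automatically a Shintani
  function.\<close>

lemma phi_pullback_isomorphism:
  assumes K: "linear_group K" "K \<subseteq> G" and \<eta>: "Z_character G \<eta>" "Z_character H \<eta>'"
  shows "linear_isomorphism (phi_pullback G H) (Sh G H K \<eta> \<eta>') (Hom_trivial G H K \<eta> \<eta>')"
proof -
  let ?T = "phi_pullback G H" and ?S = "Sh G H K \<eta> \<eta>'" and ?W = "Hom_trivial G H K \<eta> \<eta>'"
  have smooth: "f \<in> smooth_functions G" if "f \<in> ?S" for f
    using that unfolding Sh_iff by blast
  have image: "?T ` ?S = ?W"
  proof (intro Set.set_eqI iffI)
    fix F assume "F \<in> ?T ` ?S"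
    then obtain f where f: "f \<in> ?S" "F = ?T f" by blast
    then show "F \<in> ?W"
      using phi_pullback_in_Hom_iff[OF K \<eta> smooth[OF f(1)]] by simp
  next
    fix F assume F: "F \<in> ?W"
    then have quot: "F \<in> smooth_functions_quot P D"
      unfolding Hom_trivial_def fixed_vectors_def eigen_functions_quot_def by blast
    let ?f = "sect (lift_fun P D F)"
    have f: "?f \<in> smooth_functions G"
      using quot by (intro sect_smooth) (simp add: smooth_functions_quot_def)
    have "?T ?f = F"
      by (rule phi_pullback_sect[OF quot])
    moreover from this have "?f \<in> ?S"
      using phi_pullback_in_Hom_iff[OF K \<eta> f] F by simp
    ultimately show "F \<in> ?T ` ?S" by (metis imageI)
  qed
  have "inj_on ?T ?S"
    by (rule inj_onI) (use phi_pullback_inj smooth in blast)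
  then have bij: "bij_betw ?T ?S ?W"
    using image by (simp add: bij_betw_def)
  \<comment> \<open>The target is a subspace as the image of a subspace under a linear map.\<close>
  have "fun_vs.subspace ?W"
    unfolding image[symmetric]
  proof (rule fun_vs.subspaceI)
    have "0 = ?T 0" by (rule ext) (simp add: phi_pullback_def)
    then show "0 \<in> ?T ` ?S" using fun_vs.subspace_0[OF subspace_Sh] by (rule image_eqI)
    fix F F' assume "F \<in> ?T ` ?S" "F' \<in> ?T ` ?S"
    then obtain f f' where "f \<in> ?S" "f' \<in> ?S" "F = ?T f" "F' = ?T f'" by blast
    then show "F + F' \<in> ?T ` ?S"
      by (intro image_eqI[of _ _ "f + f'"]) (simp_all only: phi_pullback_add fun_vs.subspace_add[OF subspace_Sh])
  next
    fix c F assume "F \<in> ?T ` ?S"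
    then obtain f where "f \<in> ?S" "F = ?T f" by blast
    then show "fscale c F \<in> ?T ` ?S"
      by (intro image_eqI[of _ _ "fscale c f"]) (simp_all only: phi_pullback_scale fun_vs.subspace_scale[OF subspace_Sh])
  qed
  then show ?thesis
    unfolding linear_isomorphism_def using subspace_Sh bij phi_pullback_add phi_pullback_scale by blast
qed

end

theorem lemma5p5:
  fixes G G' K \<jj> \<jj>' :: "(real^'n^'n) set"
    and \<Lambda> \<Lambda>' :: "(complex^'n^'n \<Rightarrow> complex) set"
    and \<eta> \<eta>' :: "((complex^'n^'n) list \<Rightarrow> complex) set \<Rightarrow> complex"
  assumes "real_reductive_linear_group G"
    and "algebraic_reductive_subgroup G' G"
    and "maximal_compact_subgroup K G"
    and "maximal_compact_subgroup (K \<inter> G') G'"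
    and "cartan_subalgebra \<jj> (lie_algebra G)"
    and "cartan_subalgebra \<jj>' (lie_algebra G')"
    and "\<Lambda> \<in> hc_parameters G \<jj>"
    and "\<Lambda>' \<in> hc_parameters G' \<jj>'"
    and "infinitesimal_character G \<jj> \<Lambda> \<eta>"
    and "infinitesimal_character G' \<jj>' \<Lambda>' \<eta>'"
  shows "(\<forall>f\<in>Sh G G' K \<eta> \<eta>'. \<forall>g\<in>G. \<forall>h\<in>G'.
            phi_pullback G G' f (blk g h <#\<^bsub>GL\<^esub> diag_group G') = f (phi (g, h))) \<and>
         linear_isomorphism (phi_pullback G G') (Sh G G' K \<eta> \<eta>') (Hom_trivial G G' K \<eta> \<eta>')"
proof -
  obtain A where "reductive_algebraic_group A" "openin (top_of_set A) G" "subgroup G GL"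
    using assms(1) unfolding real_reductive_linear_group_def by blast
  \<comment> \<open>An open subgroup of an algebraic group is closed in GL, which is what gives its
    Lie algebra the structure of a Lie algebra.\<close>
  then have G: "closed_linear_group G"
    unfolding reductive_algebraic_group_def by (intro open_subgroup_closed) auto
  obtain A' where "reductive_algebraic_group A'" "openin (top_of_set A') G'" "subgroup G' GL" and sub: "G' = G \<inter> A'"
    using assms(2) unfolding algebraic_reductive_subgroup_def by blast
  then have G': "closed_linear_group G'"
    unfolding reductive_algebraic_group_def by (intro open_subgroup_closed) auto
  interpret subgroup_pair G G'
    using G G' sub by (intro subgroup_pair.intro group_pair.intro subgroup_pair_axioms.intro) auto
  have "linear_group K" "K \<subseteq> G"
    using assms(3) by (auto simp: maximal_compact_subgroup_def linear_group_def)
  moreover have "Z_character G \<eta>" "Z_character G' \<eta>'"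
    using assms(9,10) by (simp_all add: infinitesimal_character_def)
  ultimately have "linear_isomorphism (phi_pullback G G') (Sh G G' K \<eta> \<eta>') (Hom_trivial G G' K \<eta> \<eta>')"
    by (rule phi_pullback_isomorphism)
  moreover have "phi_pullback G G' f (blk g h <#\<^bsub>GL\<^esub> diag_group G') = f (phi (g, h))"
    if "g \<in> G" "h \<in> G'" for f g h
    unfolding phi_pullback_coset[OF that] by (simp add: phi_def)
  ultimately show ?thesis by blast
qed

end
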